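(* Let $\{F_\theta:\theta\in\Theta\}$ be a standard exponential family generated by $F_0$, with $\Theta=[0,\theta_{\max})$, and for $\theta\in\Theta$ let $X_1,X_2,\dots$ be i.i.d. with law $F_\theta$ under $\mathbb{P}_\theta$. Then there exist constants $C>0$, $r>0$, $\theta^\ast>0$ with $[0,\theta^\ast]\subset\Theta$ such that $$\mathbb{E}_\theta[R_b^{\,k}]\le \frac{1}{k+1}\frac{\mathbb{E}_\theta[(X_1^+)^{k+1}]}{\mu_\theta}+C\,\frac{k\Gamma(k)}{r^k}e^{-rb}\qquad\text{for all }k\in\mathbb{N},\ b>0,\ \theta\in(0,\theta^\ast],$$ and such that, with these same constants, the following holds for every $k\in\mathbb{N}$ and every $\theta\in(0,\theta^\ast]$. Set $$A_{\theta,k}:=\frac{\mathbb{E}_\theta[(X_1^+)^{k+1}]}{\mu_\theta},\qquad B_k:=C\,\frac{k\Gamma(k)}{r^k},\qquad b_0(\theta,k):=\frac1r\ln_+\!\left(\frac{(k+1)B_k}{k\,A_{\theta,k}}\right),$$ where $\ln_+(x)=\max\{\ln x,0\}$. Then for all $b\ge b_0(\theta,k)$, $$\mathbb{E}_\theta[R_b^{\,k}]\ \le\ \frac{\mathbb{E}_\theta[(X_1^+)^{k+1}]}{\mu_\theta}=A_{\theta,k}.$$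
   Context: Standard exponential family: $F_0$ is a probability measure on $\mathbb{R}$ and $\Theta=[0,\theta_{\max})$, $\theta_{\max}\in(0,\infty]$, is such that $\int e^{\theta x}F_0(dx)<\infty$ for all $\theta\in\Theta$. Put $\psi(\theta)=\ln\int e^{\theta x}F_0(dx)$ and $F_\theta(dx)=e^{\theta x-\psi(\theta)}F_0(dx)$. The family $\{F_\theta\}$ is called standard if, for $X\sim F_0$, $\mathbb{E}[X]=0$ and $\mathrm{Var}(X)=1$, and $F_0$ is strongly non-lattice, i.e. $\limsup_{|t|\to\infty}\left|\int e^{itx}F_0(dx)\right|<1$. $\mathbb{P}_\theta,\mathbb{E}_\theta$ denote probability and expectation when $X_1,X_2,\dots$ are i.i.d. with law $F_\theta$; $\mu_\theta:=\mathbb{E}_\theta[X_1]=\psi'(\theta)$, which is $>0$ for $\theta>0$. $S_0=0$, $S_n=X_1+\dots+X_n$. For $b\ge 0$: $\tau(b)=\inf\{n\ge1:S_n>b\}$ and the overshoot is $R_b=S_{\tau(b)}-b$. $x^+=\max\{x,0\}$, and $\Gamma(k)=\int_0^\infty z^{k-1}e^{-z}\,dz$. *)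

theory Defs
  imports "HOL-Probability.Probability"
begin

definition param_set :: "ereal \<Rightarrow> real set" where
  "param_set \<theta>max = {\<theta>. 0 \<le> \<theta> \<and> ereal \<theta> < \<theta>max}"

definition cumulant :: "real measure \<Rightarrow> real \<Rightarrow> real" where
  "cumulant F0 \<theta> = ln (\<integral>x. exp (\<theta> * x) \<partial>F0)"

definition tilted :: "real measure \<Rightarrow> real \<Rightarrow> real measure" where
  "tilted F0 \<theta> = density F0 (\<lambda>x. ennreal (exp (\<theta> * x - cumulant F0 \<theta>)))"

definition strongly_nonlattice :: "real measure \<Rightarrow> bool" where
  "strongly_nonlattice F \<longleftrightarrow> Limsup at_infinity (\<lambda>t. ereal (cmod (char F t))) < 1"

(* The integrability conditions are stated explicitly because the Bochner integral
   of a non-integrable function is 0. *)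
definition standard_exponential_family :: "real measure \<Rightarrow> ereal \<Rightarrow> bool" where
  "standard_exponential_family F0 \<theta>max \<longleftrightarrow>
     prob_space F0 \<and> sets F0 = sets borel \<and> 0 < \<theta>max \<and>
     (\<forall>\<theta>\<in>param_set \<theta>max. integrable F0 (\<lambda>x. exp (\<theta> * x))) \<and>
     integrable F0 (\<lambda>x. x) \<and> integrable F0 (\<lambda>x. x\<^sup>2) \<and>
     prob_space.expectation F0 (\<lambda>x. x) = 0 \<and>
     prob_space.variance F0 (\<lambda>x. x) = 1 \<and>
     strongly_nonlattice F0"

(* Sequences are indexed from 1; the value X 0 plays no role. *)
definition iid_with_law :: "'a measure \<Rightarrow> (nat \<Rightarrow> 'a \<Rightarrow> real) \<Rightarrow> real measure \<Rightarrow> bool" where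
  "iid_with_law M X F \<longleftrightarrow>
     prob_space M \<and> prob_space.indep_vars M (\<lambda>_. borel) X {1..} \<and>
     (\<forall>n\<ge>1. distr M borel (X n) = F)"

definition walk :: "(nat \<Rightarrow> 'a \<Rightarrow> real) \<Rightarrow> nat \<Rightarrow> 'a \<Rightarrow> real" where
  "walk X n \<omega> = (\<Sum>i=1..n. X i \<omega>)"

definition passage_time :: "(nat \<Rightarrow> 'a \<Rightarrow> real) \<Rightarrow> real \<Rightarrow> 'a \<Rightarrow> enat" where
  "passage_time X b \<omega> = Inf (enat ` {n. 1 \<le> n \<and> walk X n \<omega> > b})"

(* If the level b is never exceeded, the overshoot is set to infinity. That event is null
   when the drift is positive, so the convention does not affect the moments; a finite
   moment of positive order then really entails that b is exceeded almost surely.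
   On the complement, walk - b > 0, so the embedding into ennreal loses nothing. *)
definition overshoot :: "(nat \<Rightarrow> 'a \<Rightarrow> real) \<Rightarrow> real \<Rightarrow> 'a \<Rightarrow> ennreal" where
  "overshoot X b \<omega> =
     (case passage_time X b \<omega> of enat n \<Rightarrow> ennreal (walk X n \<omega> - b) | \<infinity> \<Rightarrow> \<infinity>)"

definition overshoot_moment ::
  "'a measure \<Rightarrow> (nat \<Rightarrow> 'a \<Rightarrow> real) \<Rightarrow> real \<Rightarrow> nat \<Rightarrow> ennreal" where
  "overshoot_moment M X b k = (\<integral>\<^sup>+\<omega>. overshoot X b \<omega> ^ k \<partial>M)"

definition moment_ratio :: "'a measure \<Rightarrow> (nat \<Rightarrow> 'a \<Rightarrow> real) \<Rightarrow> nat \<Rightarrow> real" where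
  "moment_ratio M X k =
     prob_space.expectation M (\<lambda>\<omega>. (max (X 1 \<omega>) 0) ^ (k + 1)) / prob_space.expectation M (X 1)"

definition ln_plus :: "real \<Rightarrow> real" where
  "ln_plus x = max (ln x) 0"

end

(*
  In terms of the distance d = b - S_n to the level, the overshoot moment is the Green operator G of the
  walk killed on exceeding the level, applied to the function d |-> E[(X - d)^k; X > d]. Writing
  this function as a mixture of indicators of [0, w], everything reduces to
      G 1_[0,w] (b) <= w / mu + C e^(-r b)   for all w, b,
  uniformly in theta: the first term integrates to exactly 1/(k+1) E[(X^+)^(k+1)] / mu.

  For w >= const * mu not even the error term is needed. The expected increment of a convex ramp, quadratic
  with curvature proportional to mu near the lower end of the interval and of slope 1 above, dominates
  mu 1_[0,w], and the value of the ramp at the overshoot stays below w. This is where small theta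
  provides slack: the density of the Green measure near the level is bounded while 1 / mu is large.

  For w <= const * mu one shows G 1_[0,w] (b) <= C w + C e^(-r b). The first N ~ eps b steps are
  unlikely to come near the level. As F_0 is strongly non-lattice, the law of S_N is smooth on
  every scale up to an error that is exponentially small in N, and averaging the starting point of
  the remaining walk over a unit interval gives a bound linear in w. No left exponential moments are
  available; paths that go far to the left are absorbed into the supremum over larger levels.
*)
theory Submission
  imports Defs
begin

section \<open>The Green operator of the killed walk\<close>

text \<open>The delicate point is how smoothness is used. With N proportional to b, the remaining
  walk may start anywhere in a range of length of order b, while the density of S_N is only of order
  N^(-1/2); multiplying the two would lose a factor sqrt b. Hence no bound on a density is used.
  Instead the law is smoothed by a Gaussian of width w, and the second difference 2 q(x) - q(x - u)
  - q(x + u) of the resulting density q is bounded: in Fourier space it carries the factor 1 - cos(t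
  u), of order t^2, which against exp(- c N t^2 / 2) leaves O(1 / N). Over a range of length O(b)
  this error stays bounded, and the leading term, an average of translates of q, still has mass one.
  Frequencies beyond T contribute rho^N / w; the factor w gained by averaging starting points
  cancels the 1 / w, so the error e^(-r b) is free of w. Uniformity in theta rests on choosing every
  constant at theta = 0 with some slack; near frequency 0 a doubling inequality derives the
  quadratic decay of the characteristic function from T and rho alone.\<close>

definition killed_step :: "real measure \<Rightarrow> (real \<Rightarrow> ennreal) \<Rightarrow> real \<Rightarrow> ennreal" where
  "killed_step F f d = (\<integral>\<^sup>+x. f (d - x) * indicator {..d} x \<partial>F)"

definition green :: "real measure \<Rightarrow> (real \<Rightarrow> ennreal) \<Rightarrow> real \<Rightarrow> ennreal" where
  "green F f d = (\<Sum>n. (killed_step F ^^ n) f d)"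

context real_distribution
begin

lemma measurable_killed_step [measurable]:
  assumes [measurable]: "f \<in> borel_measurable borel"
  shows "killed_step M f \<in> borel_measurable borel"
proof -
  have "(\<lambda>d. \<integral>\<^sup>+x. f (d - x) * indicator {..d} x \<partial>M) \<in> borel_measurable borel"
    by (rule borel_measurable_nn_integral) (simp add: split_beta' indicator_def atMost_def)
  then show ?thesis by (simp add: killed_step_def[abs_def])
qed

lemma measurable_killed_steps [measurable]:
  assumes [measurable]: "f \<in> borel_measurable borel"
  shows "(killed_step M ^^ n) f \<in> borel_measurable borel"
  by (induction n) auto

lemma measurable_green [measurable]:
  assumes [measurable]: "f \<in> borel_measurable borel"
  shows "green M f \<in> borel_measurable borel"
  unfolding green_def[abs_def] by measurable

text \<open>The argument \<open>d - x\<close> is nonnegative wherever the indicator is nonzero, so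
  values at negative distances never enter.\<close>

lemma killed_step_mono:
  assumes "\<And>d. d \<ge> 0 \<Longrightarrow> f d \<le> g d"
  shows "killed_step M f d \<le> killed_step M g d"
  unfolding killed_step_def
  by (rule nn_integral_mono) (use assms in \<open>auto simp: indicator_def\<close>)

lemma killed_steps_mono:
  assumes "\<And>d. d \<ge> 0 \<Longrightarrow> f d \<le> g d" "d \<ge> 0"
  shows "(killed_step M ^^ n) f d \<le> (killed_step M ^^ n) g d"
  using assms(2)
proof (induction n arbitrary: d)
  case (Suc n)
  then show ?case by (auto intro!: killed_step_mono)
qed (use assms in auto)

lemma green_mono:
  assumes "\<And>d. d \<ge> 0 \<Longrightarrow> f d \<le> g d" "d \<ge> 0"
  shows "green M f d \<le> green M g d"
  unfolding green_def by (intro suminf_le killed_steps_mono assms) auto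

lemma killed_step_add:
  assumes [measurable]: "f \<in> borel_measurable borel" "g \<in> borel_measurable borel"
  shows "killed_step M (\<lambda>d. f d + g d) d = killed_step M f d + killed_step M g d"
  unfolding killed_step_def by (subst nn_integral_add[symmetric]) (auto simp: distrib_right)

lemma killed_steps_add:
  assumes [measurable]: "f \<in> borel_measurable borel" "g \<in> borel_measurable borel"
  shows "(killed_step M ^^ n) (\<lambda>d. f d + g d) = (\<lambda>d. (killed_step M ^^ n) f d + (killed_step M ^^ n) g d)"
  by (induction n) (auto simp: killed_step_add)

lemma green_add:
  assumes [measurable]: "f \<in> borel_measurable borel" "g \<in> borel_measurable borel"
  shows "green M (\<lambda>d. f d + g d) d = green M f d + green M g d"
  unfolding green_def by (simp add: killed_steps_add suminf_add)

lemma killed_step_cmult: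
  assumes [measurable]: "f \<in> borel_measurable borel"
  shows "killed_step M (\<lambda>d. c * f d) d = c * killed_step M f d"
  unfolding killed_step_def by (subst nn_integral_cmult[symmetric]) (auto simp: mult.assoc)

lemma killed_steps_cmult:
  assumes [measurable]: "f \<in> borel_measurable borel"
  shows "(killed_step M ^^ n) (\<lambda>d. c * f d) = (\<lambda>d. c * (killed_step M ^^ n) f d)"
  by (induction n) (auto simp: killed_step_cmult)

lemma green_cmult:
  assumes [measurable]: "f \<in> borel_measurable borel"
  shows "green M (\<lambda>d. c * f d) d = c * green M f d"
  unfolding green_def by (simp add: killed_steps_cmult ennreal_suminf_cmult)

lemma killed_step_suminf:
  assumes [measurable]: "\<And>i. f i \<in> borel_measurable borel"
  shows "killed_step M (\<lambda>d. \<Sum>i. f i d) d = (\<Sum>i. killed_step M (f i) d)"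
  unfolding killed_step_def
  by (subst nn_integral_suminf[symmetric])
     (auto intro!: nn_integral_cong simp: ennreal_suminf_multc)

lemma killed_steps_suminf:
  assumes [measurable]: "\<And>i. f i \<in> borel_measurable borel"
  shows "(killed_step M ^^ n) (\<lambda>d. \<Sum>i. f i d) = (\<lambda>d. \<Sum>i. (killed_step M ^^ n) (f i) d)"
proof (induction n)
  case (Suc n)
  show ?case by (simp add: Suc killed_step_suminf)
qed simp

text \<open>Markov property at the fixed time \<open>N\<close>.\<close>

lemma green_split:
  assumes [measurable]: "f \<in> borel_measurable borel"
  shows "green M f d = (\<Sum>n<N. (killed_step M ^^ n) f d) + (killed_step M ^^ N) (green M f) d"
proof -
  have "green M f d = (\<Sum>n. (killed_step M ^^ (n + N)) f d) + (\<Sum>n<N. (killed_step M ^^ n) f d)"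
    unfolding green_def by (rule suminf_offset) auto
  also have "(\<Sum>n. (killed_step M ^^ (n + N)) f d) = (killed_step M ^^ N) (green M f) d"
    by (simp add: green_def[abs_def] killed_steps_suminf funpow_add add.commute[of _ N])
  finally show ?thesis by (simp add: add.commute)
qed

text \<open>Iterating the inequality telescopes; the remainder is kept on the left, so no decay of
  \<open>u\<close> along the walk has to be known.\<close>

lemma partial_green_superharmonic:
  assumes [measurable]: "f \<in> borel_measurable borel" "u \<in> borel_measurable borel"
  assumes super: "\<And>d. d \<ge> 0 \<Longrightarrow> f d + killed_step M u d \<le> u d"
  assumes "d \<ge> 0"
  shows "(\<Sum>n<N. (killed_step M ^^ n) f d) + (killed_step M ^^ N) u d \<le> u d"
proof (induction N)
  case (Suc N)
  have "(killed_step M ^^ N) f d + (killed_step M ^^ Suc N) u d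
      = (killed_step M ^^ N) (\<lambda>d. f d + killed_step M u d) d"
    by (simp add: killed_steps_add funpow_swap1 )
  also have "\<dots> \<le> (killed_step M ^^ N) u d"
    by (intro killed_steps_mono super \<open>d \<ge> 0\<close>)
  finally show ?case
    using Suc by (simp add: add.assoc) (meson add_left_mono order_trans)
qed simp

text \<open>The Green potential is the least nonnegative solution of this inequality; exhibiting any
  solution \<open>u\<close> bounds it without a limit theorem.\<close>

lemma green_le_superharmonic:
  assumes [measurable]: "f \<in> borel_measurable borel" "u \<in> borel_measurable borel"
  assumes "\<And>d. d \<ge> 0 \<Longrightarrow> f d + killed_step M u d \<le> u d"
  assumes "d \<ge> 0"
  shows "green M f d \<le> u d"
  unfolding green_def
proof (rule suminf_le_const)
  fix N
  have "(\<Sum>n<N. (killed_step M ^^ n) f d) \<le> (\<Sum>n<N. (killed_step M ^^ n) f d) + (killed_step M ^^ N) u d"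
    by simp
  also have "\<dots> \<le> u d" by (rule partial_green_superharmonic) (use assms in auto)
  finally show "(\<Sum>n<N. (killed_step M ^^ n) f d) \<le> u d" .
qed auto

text \<open>Raising the level by \<open>u\<close> lets more paths survive, and moving the test
  function along compensates the change of the starting distance.\<close>

lemma killed_steps_shift:
  assumes "u \<ge> 0"
  shows "(killed_step M ^^ n) f d \<le> (killed_step M ^^ n) (\<lambda>d. f (d - u)) (d + u)"
proof (induction n arbitrary: d)
  case (Suc n)
  show ?case
    unfolding funpow.simps o_def killed_step_def[of M "(killed_step M ^^ n) f" d]
      killed_step_def[of M "(killed_step M ^^ n) (\<lambda>d. f (d - u))" "d + u"]
    apply (rule nn_integral_mono)
    subgoal for x using Suc[of "d - x"] assms by (auto simp: indicator_def algebra_simps)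
    done
qed simp

lemma green_shift:
  assumes "u \<ge> 0"
  shows "green M f d \<le> green M (\<lambda>d. f (d - u)) (d + u)"
  unfolding green_def by (intro suminf_le killed_steps_shift assms) auto

lemma measurable_killed_steps_param [measurable]:
  fixes N :: "'b measure"
  assumes [measurable]: "(\<lambda>(w, d). f w d) \<in> borel_measurable (N \<Otimes>\<^sub>M borel)"
  shows "(\<lambda>(w, d). (killed_step M ^^ n) (f w) d) \<in> borel_measurable (N \<Otimes>\<^sub>M borel)"
proof (induction n)
  case (Suc n)
  note [measurable] = Suc
  have "(\<lambda>p. \<integral>\<^sup>+x. (\<lambda>(w, d). (killed_step M ^^ n) (f w) d) (fst p, snd p - x)
          * indicator {..snd p} x \<partial>M) \<in> borel_measurable (N \<Otimes>\<^sub>M borel)"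
    by (rule borel_measurable_nn_integral) (simp add: split_beta' indicator_def atMost_def)
  then show ?case by (simp add: killed_step_def[abs_def] split_beta')
qed (use assms in auto)

lemma killed_steps_nn_integral:
  fixes N :: "'b measure"
  assumes N: "sigma_finite_measure N"
  assumes [measurable]: "(\<lambda>(w, d). f w d) \<in> borel_measurable (N \<Otimes>\<^sub>M borel)"
  shows "(killed_step M ^^ n) (\<lambda>d. \<integral>\<^sup>+w. f w d \<partial>N) d = (\<integral>\<^sup>+w. (killed_step M ^^ n) (f w) d \<partial>N)"
proof (induction n arbitrary: d)
  case (Suc n)
  interpret N: sigma_finite_measure N by fact
  interpret P: pair_sigma_finite N M ..
  note [measurable] = measurable_killed_steps_param[of f N n, OF assms(2)]
  have [measurable]: "(\<lambda>(w, x). (killed_step M ^^ n) (f w) (d - x)) \<in> borel_measurable (N \<Otimes>\<^sub>M M)" for d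
    using measurable_compose[OF _ measurable_killed_steps_param[of f N n, OF assms(2)],
      of "\<lambda>(w, x). (w, d - x)" "N \<Otimes>\<^sub>M M"] by (simp add: split_beta')
  have "(killed_step M ^^ Suc n) (\<lambda>d. \<integral>\<^sup>+w. f w d \<partial>N) d
     = (\<integral>\<^sup>+x. (\<integral>\<^sup>+w. (killed_step M ^^ n) (f w) (d - x) \<partial>N) * indicator {..d} x \<partial>M)"
    by (simp add: killed_step_def[of _ _ d] Suc)
  also have "\<dots> = (\<integral>\<^sup>+x. (\<integral>\<^sup>+w. (killed_step M ^^ n) (f w) (d - x) * indicator {..d} x \<partial>N)  \<partial>M)"
    by (intro nn_integral_cong nn_integral_multc[symmetric])
       (use measurable_compose[OF measurable_Pair2' measurable_killed_steps_param[of f N n, OF assms(2)]] in auto)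
  also have "\<dots> = (\<integral>\<^sup>+w. (\<integral>\<^sup>+x. (killed_step M ^^ n) (f w) (d - x) * indicator {..d} x \<partial>M)  \<partial>N)"
    by (rule P.Fubini') (simp add: split_beta' indicator_def atMost_def)
  also have "\<dots> = (\<integral>\<^sup>+w. (killed_step M ^^ Suc n) (f w) d \<partial>N)"
    by (simp add: killed_step_def[of _ _ d])
  finally show ?case .
qed simp

text \<open>Reduces mixtures of intervals to single intervals by Tonelli. It serves both the
  overshoot kernel and the averaging over starting points, with Lebesgue measure as mixing
  measure.\<close>

lemma green_nn_integral:
  fixes N :: "'b measure"
  assumes "sigma_finite_measure N"
  assumes [measurable]: "(\<lambda>(w, d). f w d) \<in> borel_measurable (N \<Otimes>\<^sub>M borel)"
  shows "green M (\<lambda>d. \<integral>\<^sup>+w. f w d \<partial>N) d = (\<integral>\<^sup>+w. green M (f w) d \<partial>N)"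
proof -
  have "(\<lambda>w. (killed_step M ^^ n) (f w) d) \<in> borel_measurable N" for n
    using measurable_compose[OF measurable_Pair1' measurable_killed_steps_param[of f N n, OF assms(2)]]
    by auto
  then show ?thesis
    unfolding green_def by (simp add: killed_steps_nn_integral[OF assms] nn_integral_suminf)
qed

end

section \<open>Laws of steps with small positive drift\<close>

text \<open>The exponential series of a nonnegative number dominates its \<open>k\<close>-th
  term.\<close>

lemma power_le_fact_exp:
  fixes s y :: real
  assumes "s > 0" "y \<ge> 0"
  shows "y ^ k \<le> fact k / s ^ k * exp (s * y)"
proof -
  have "(s * y) ^ k /\<^sub>R fact k \<le> (\<Sum>n. (s * y) ^ n /\<^sub>R fact n)"
    using sum_le_suminf[OF summable_exp_generic[of "s * y"], of "{k}"] assms by simp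
  then have "(s * y) ^ k / fact k \<le> exp (s * y)"
    by (simp add: exp_def divide_inverse mult.commute)
  then show ?thesis using assms by (simp add: field_simps power_mult_distrib)
qed

definition overshoot_kernel :: "real measure \<Rightarrow> nat \<Rightarrow> real \<Rightarrow> ennreal" where
  "overshoot_kernel F k d = (\<integral>\<^sup>+x. ennreal ((x - d) ^ k) * indicator {d<..} x \<partial>F)"

text \<open>A convex C^1 function: zero on the negative axis, the parabola
  \<open>y\<^sup>2 / (2 * l)\<close> on \<open>[0, l]\<close>, slope 1 beyond. A difference of two
  truncated squares gives all three branches at once.\<close>

definition ramp :: "real \<Rightarrow> real \<Rightarrow> real" where
  "ramp l y = ((max y 0)\<^sup>2 - (max (y - l) 0)\<^sup>2) / (2 * l)"

text \<open>The derivative of \<open>ramp l\<close>.\<close>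

definition ramp_slope :: "real \<Rightarrow> real \<Rightarrow> real" where
  "ramp_slope l y = min 1 (max 0 (y / l))"

lemma ramp_nonpos: "l > 0 \<Longrightarrow> y \<le> 0 \<Longrightarrow> ramp l y = 0"
  by (simp add: ramp_def max_def)

lemma ramp_middle: "0 \<le> y \<Longrightarrow> y \<le> l \<Longrightarrow> ramp l y = y\<^sup>2 / (2 * l)"
  by (simp add: ramp_def max_def)

lemma ramp_large: "l > 0 \<Longrightarrow> l \<le> y \<Longrightarrow> ramp l y = y - l / 2"
  by (simp add: ramp_def max_def field_simps power2_eq_square)

lemma ramp_cases:
  assumes "l > 0"
  obtains "y \<le> 0" "ramp l y = 0" "ramp_slope l y = 0"
    | "0 \<le> y" "y \<le> l" "ramp l y = y\<^sup>2 / (2 * l)" "ramp_slope l y = y / l"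
    | "l \<le> y" "ramp l y = y - l / 2" "ramp_slope l y = 1"
proof -
  consider "y \<le> 0" | "0 \<le> y" "y \<le> l" | "l \<le> y" by linarith
  then show thesis
  proof cases
    case 1
    then show ?thesis using assms
      by (intro that(1)) (auto simp: ramp_nonpos ramp_slope_def divide_nonpos_pos)
  next
    case 2
    then show ?thesis using assms by (intro that(2)) (auto simp: ramp_middle ramp_slope_def)
  next
    case 3
    then show ?thesis using assms by (intro that(3)) (auto simp: ramp_large ramp_slope_def)
  qed
qed

lemma ramp_nonneg: "l > 0 \<Longrightarrow> 0 \<le> ramp l y"
  by (cases rule: ramp_cases[of l y]) auto

lemma ramp_le_quadratic:
  assumes "l > 0" "y \<ge> 0"
  shows "ramp l y \<le> y\<^sup>2 / (2 * l)"
  using assms by (simp add: ramp_def field_simps)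

lemma ramp_le:
  assumes "l > 0" shows "ramp l y \<le> max y 0"
proof (cases rule: ramp_cases[OF assms, of y])
  case 2
  then have "y\<^sup>2 \<le> y * (2 * l)" unfolding power2_eq_square by (intro mult_left_mono) auto
  with 2(1) assms show ?thesis unfolding 2(3) by (simp add: field_simps)
qed (use assms in auto)

text \<open>Convexity in supporting-line form, checked branch by branch.\<close>

lemma ramp_tangent:
  assumes l: "l > 0"
  shows "ramp l y + ramp_slope l y * (z - y) \<le> ramp l z"
proof -
  have sq: "2 * y * z \<le> y\<^sup>2 + z\<^sup>2" using zero_le_power2[of "y - z"] by (simp add: power2_diff)
  have ge: "z - l / 2 \<le> ramp l z"
  proof (cases rule: ramp_cases[OF l, of z])
    case 2
    have "2 * z * l \<le> l\<^sup>2 + z\<^sup>2" using zero_le_power2[of "z - l"] by (simp add: power2_diff)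
    with 2(1,2) l show ?thesis unfolding 2(3) by (simp add: field_simps power2_eq_square)
  qed (use l in auto)
  show ?thesis
  proof (cases rule: ramp_cases[OF l, of y])
    case 1
    then show ?thesis using ramp_nonneg[OF l, of z] by simp
  next
    case y: 2
    have eq: "ramp l y + ramp_slope l y * (z - y) = (2 * y * z - y\<^sup>2) / (2 * l)"
      unfolding y(3,4) using l by (simp add: field_simps power2_eq_square)
    show ?thesis
    proof (cases rule: ramp_cases[OF l, of z])
      case z: 1
      have "y * z \<le> 0" using y z by (simp add: mult_nonneg_nonpos)
      then have "2 * y * z - y\<^sup>2 \<le> 0" using zero_le_power2[of y] by linarith
      then show ?thesis unfolding eq z(2) using l by (simp add: divide_nonpos_pos)
    next
      case z: 2
      then show ?thesis unfolding eq z(3) using l sq by (intro divide_right_mono) auto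
    next
      case z: 3
      have "0 \<le> (l - y) * (2 * z - l - y)" using y z by (intro mult_nonneg_nonneg) auto
      then have "2 * y * z - y\<^sup>2 \<le> (z - l / 2) * (2 * l)"
        by (simp add: algebra_simps power2_eq_square)
      then show ?thesis unfolding eq z(2) using l by (simp add: field_simps)
    qed
  next
    case 3
    then show ?thesis using ge by simp
  qed
qed

text \<open>A step in \<open>[-a, 0]\<close> from a point of \<open>[a, l]\<close> stays on the
  parabola, where the second-order Taylor expansion is exact.\<close>

lemma ramp_curvature:
  assumes l: "l > 0" and y: "a \<le> y" "y \<le> l" and x: "- a \<le> x" "x \<le> 0"
  shows "ramp l y + ramp_slope l y * x + x\<^sup>2 / (2 * l) \<le> ramp l (y + x)"
proof -
  have "0 \<le> y" "0 \<le> y + x" "y + x \<le> l" using y x by auto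
  then show ?thesis using y l
    by (simp add: ramp_middle ramp_slope_def min_def max_def field_simps power2_eq_square)
qed

lemma measurable_ramp [measurable]: "ramp l \<in> borel_measurable borel"
  unfolding ramp_def[abs_def] by measurable

text \<open>For \<open>F = F\<^sub>\<theta>\<close> only \<open>\<mu>\<close> and \<open>\<kappa> = \<theta>\<close> depend on \<open>\<theta>\<close>; constants built from the other
  parameters are therefore uniform in \<open>\<theta>\<close>.\<close>

locale step_law = real_distribution F for F :: "real measure" +
  fixes \<mu> \<kappa> s M K \<eta> a v m T c \<rho> :: real
  assumes pos: "\<mu> > 0" "s > 0" "M > 1" "\<eta> > 0" "a > 0" "v > 0" "m > 0" "T > 0" "c > 0" "\<rho> > 0" "\<rho> < 1"
    and exp_integrable: "integrable F (\<lambda>x. exp (s * x))"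
    and exp_moment: "(\<integral>x. exp (s * x) \<partial>F) \<le> M"
    and truncated_exp_moment: "1 + \<eta> \<le> (\<integral>x. min (exp (s * x)) K \<partial>F)"
    and integrable: "integrable F (\<lambda>x. x)"
    and mean: "(\<integral>x. x \<partial>F) = \<mu>"
    and abs_moment: "(\<integral>x. \<bar>x\<bar> \<partial>F) \<le> m"
    and left_variance: "v \<le> (\<integral>x. x\<^sup>2 * indicator {-a..0} x \<partial>F)"
    and char_small: "\<And>t. \<bar>t\<bar> \<le> T \<Longrightarrow> (cmod (char F t))\<^sup>2 \<le> 1 - c * t\<^sup>2"
    and char_large: "\<And>t. \<bar>t\<bar> \<ge> T \<Longrightarrow> cmod (char F t) \<le> \<rho>"
    and contraction: "(\<integral>\<^sup>+x. exp (- \<kappa> * x) \<partial>F) < 1" "\<kappa> \<ge> 0"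
begin

section \<open>Exponential moments and survival of the killed walk\<close>

lemma trunc_le_K: "1 + \<eta> \<le> K"
proof -
  \<comment> \<open>A non-integrable function has Bochner integral 0, so the positive lower bound
    forces integrability.\<close>
  have int: "integrable F (\<lambda>x. min (exp (s * x)) K)"
    using truncated_exp_moment pos(4) not_integrable_integral_eq by fastforce
  have "(\<integral>x. min (exp (s * x)) K \<partial>F) \<le> (\<integral>x. K \<partial>F)"
    by (rule integral_mono[OF int]) auto
  then show ?thesis using truncated_exp_moment prob_space by simp
qed

text \<open>The supersolution is \<open>(K - exp (- s * d)) / \<eta>\<close>: a step multiplies the
  exponential by at least \<open>1 + \<eta>\<close> on average, and the surplus pays for one visit.
  Truncation at \<open>K\<close> keeps the comparison integrand nonnegative for steps that exit,
  where the killed walk contributes 0.\<close>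

lemma green_exp:
  assumes "d \<ge> 0"
  shows "green F (\<lambda>d. ennreal (exp (- s * d))) d \<le> ennreal (K / \<eta>)"
proof -
  define u where "u = (\<lambda>d. ennreal ((K - exp (- s * d)) / \<eta>))"
  have [measurable]: "u \<in> borel_measurable borel" unfolding u_def by measurable
  have K: "K > 1" using trunc_le_K pos by simp
  have int: "integrable F (\<lambda>x. min (exp (s * x)) K)"
    using truncated_exp_moment pos(4) not_integrable_integral_eq by fastforce
  have "ennreal (exp (- s * d)) + killed_step F u d \<le> u d" if d: "d \<ge> 0" for d
  proof -
    define e where "e = exp (- s * d)"
    have e: "0 < e" "e \<le> 1" using d pos by (auto simp: e_def)
    have ge0: "0 \<le> K - e * min (exp (s * x)) K" for x
    proof -
      have "e * min (exp (s * x)) K \<le> 1 * K" using e K by (intro mult_mono) auto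
      then show ?thesis by simp
    qed
    have "killed_step F u d \<le> (\<integral>\<^sup>+x. ennreal ((K - e * min (exp (s * x)) K) / \<eta>) \<partial>F)"
      unfolding killed_step_def
    proof (rule nn_integral_mono)
      fix x
      have "exp (- s * (d - x)) = e * exp (s * x)"
        by (simp add: e_def algebra_simps flip: exp_add)
      also have "\<dots> \<ge> e * min (exp (s * x)) K" using e by (intro mult_left_mono) auto
      finally show "u (d - x) * indicator {..d} x \<le> ennreal ((K - e * min (exp (s * x)) K) / \<eta>)"
        using pos by (auto simp: u_def indicator_def intro!: ennreal_leI divide_right_mono)
    qed
    also have "\<dots> = ennreal (\<integral>x. (K - e * min (exp (s * x)) K) / \<eta> \<partial>F)"
      by (rule nn_integral_eq_integral) (use ge0 int pos in auto)
    also have "(\<integral>x. (K - e * min (exp (s * x)) K) / \<eta> \<partial>F)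
        = (K - e * (\<integral>x. min (exp (s * x)) K \<partial>F)) / \<eta>"
      using int prob_space by simp
    also have "\<dots> \<le> (K - e * (1 + \<eta>)) / \<eta>"
      using truncated_exp_moment e pos by (intro divide_right_mono diff_left_mono mult_left_mono) auto
    finally have "ennreal e + killed_step F u d \<le> ennreal e + ennreal ((K - e * (1 + \<eta>)) / \<eta>)"
      by (auto intro!: add_left_mono ennreal_leI)
    also have "\<dots> = ennreal (e + (K - e * (1 + \<eta>)) / \<eta>)"
    proof (rule ennreal_plus[symmetric])
      have "e * (1 + \<eta>) \<le> 1 * K" using e trunc_le_K pos by (intro mult_mono) auto
      then show "0 \<le> (K - e * (1 + \<eta>)) / \<eta>" using pos by simp
    qed (use e in auto)
    also have "\<dots> = u d" using pos by (simp add: u_def e_def field_simps)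
    finally show ?thesis by (simp add: e_def)
  qed
  then have "green F (\<lambda>d. ennreal (exp (- s * d))) d \<le> u d"
    by (intro green_le_superharmonic assms) auto
  also have "\<dots> \<le> ennreal (K / \<eta>)"
    unfolding u_def using pos by (intro ennreal_leI divide_right_mono) auto
  finally show ?thesis .
qed

lemma green_le_exp:
  assumes "\<And>d. d \<ge> 0 \<Longrightarrow> f d \<le> ennreal C * ennreal (exp (- s * d))" "d \<ge> 0" "C \<ge> 0"
  shows "green F f d \<le> ennreal (C * (K / \<eta>))"
proof -
  have "green F f d \<le> green F (\<lambda>d. ennreal C * ennreal (exp (- s * d))) d"
    by (intro green_mono assms)
  also have "\<dots> = ennreal C * green F (\<lambda>d. ennreal (exp (- s * d))) d"
    by (rule green_cmult) simp
  also have "\<dots> \<le> ennreal C * ennreal (K / \<eta>)"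
    by (intro mult_left_mono green_exp assms) simp
  finally show ?thesis by (simp only: ennreal_mult'[OF assms(3)])
qed

text \<open>Exponential in \<open>w\<close>, hence of use only for intervals of bounded
  length.\<close>

lemma green_interval_crude:
  assumes "d \<ge> 0"
  shows "green F (indicator {0..w}) d \<le> ennreal (exp (s * w) * (K / \<eta>))"
proof (rule green_le_exp)
  fix d :: real assume "d \<ge> 0"
  have "1 \<le> ennreal (exp (s * w)) * ennreal (exp (- s * d))" if "d \<le> w"
    using that pos by (subst ennreal_mult[symmetric]) (auto simp flip: exp_add intro!: one_le_exp_iff[THEN iffD2] mult_left_mono)
  then show "indicator {0..w} d \<le> ennreal (exp (s * w)) * ennreal (exp (- s * d))"
    by (auto simp: indicator_def)
qed (use assms in auto)

lemma measurable_overshoot_kernel [measurable]: "overshoot_kernel F k \<in> borel_measurable borel"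
proof -
  have "(\<lambda>d. \<integral>\<^sup>+x. ennreal ((x - d) ^ k) * indicator {d<..} x \<partial>F) \<in> borel_measurable borel"
    by (rule borel_measurable_nn_integral) (simp add: split_beta' indicator_def greaterThan_def)
  then show ?thesis by (simp add: overshoot_kernel_def[abs_def])
qed

text \<open>The constant is far from sharp, but it involves neither the drift nor the distance;
  boundedness as \<mu> tends to 0 is what the ramp argument needs.\<close>

lemma green_overshoot_kernel_crude:
  assumes "d \<ge> 0"
  shows "green F (overshoot_kernel F k) d \<le> ennreal (M * fact k / s ^ k * (K / \<eta>))"
proof (rule green_le_exp)
  fix d :: real assume d: "d \<ge> 0"
  have "overshoot_kernel F k d \<le> (\<integral>\<^sup>+x. ennreal (fact k / s ^ k * exp (- s * d) * exp (s * x)) \<partial>F)"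
    unfolding overshoot_kernel_def
  proof (rule nn_integral_mono)
    fix x
    have "(x - d) ^ k \<le> fact k / s ^ k * exp (- s * d) * exp (s * x)" if "d < x"
      using power_le_fact_exp[of s "x - d" k] that pos by (simp add: algebra_simps mult_exp_exp)
    then show "ennreal ((x - d) ^ k) * indicator {d<..} x
        \<le> ennreal (fact k / s ^ k * exp (- s * d) * exp (s * x))"
      by (auto simp: indicator_def intro!: ennreal_leI)
  qed
  also have "\<dots> = ennreal (fact k / s ^ k * exp (- s * d) * (\<integral>x. exp (s * x) \<partial>F))"
    by (subst nn_integral_eq_integral) (use exp_integrable pos in auto)
  also have "\<dots> \<le> ennreal (fact k / s ^ k * exp (- s * d) * M)"
    using pos exp_moment by (intro ennreal_leI mult_left_mono) auto
  finally show "overshoot_kernel F k d \<le> ennreal (M * fact k / s ^ k) * ennreal (exp (- s * d))"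
    using pos by (simp add: ennreal_mult[symmetric] algebra_simps)
qed (use assms pos in auto)

text \<open>One step either exits or survives, so the constant 1 is a supersolution.\<close>

lemma green_exit_probability: "d \<ge> 0 \<Longrightarrow> green F (overshoot_kernel F 0) d \<le> 1"
proof (rule green_le_superharmonic[where u = "\<lambda>_. 1"])
  fix d :: real
  have "overshoot_kernel F 0 d + killed_step F (\<lambda>_. 1) d = (\<integral>\<^sup>+x. 1 \<partial>F)"
    unfolding overshoot_kernel_def killed_step_def
    by (subst nn_integral_add[symmetric])
       (simp, simp, intro nn_integral_cong, auto split: split_indicator)
  then show "overshoot_kernel F 0 d + killed_step F (\<lambda>_. 1) d \<le> 1" using emeasure_space_1 by simp
qed auto

text \<open>Survival up to time n means d - S_n >= 0, which gives an exponential Chebyshev bound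
  with exponent \<open>\<kappa>\<close>. For a tilted law this exponent undoes the tilt. The
  geometric rate degenerates as \<theta> tends to 0, but only the limit is used.\<close>

lemma survival_tendsto_0:
  assumes "d \<ge> 0"
  shows "(\<lambda>n. (killed_step F ^^ n) (\<lambda>_. 1) d) \<longlonglongrightarrow> 0"
proof -
  define q where "q = (\<integral>\<^sup>+x. exp (- \<kappa> * x) \<partial>F)"
  have "(killed_step F ^^ n) (\<lambda>_. 1) d \<le> ennreal (exp (\<kappa> * d)) * q ^ n" if "d \<ge> 0" for d n
    using that
  proof (induction n arbitrary: d)
    case 0
    then show ?case using contraction by simp
  next
    case (Suc n)
    have "(killed_step F ^^ Suc n) (\<lambda>_. 1) d
        \<le> (\<integral>\<^sup>+x. ennreal (exp (\<kappa> * d)) * q ^ n * ennreal (exp (- \<kappa> * x)) \<partial>F)"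
      unfolding funpow.simps o_def killed_step_def[of F _ d]
    proof (rule nn_integral_mono)
      fix x
      show "(killed_step F ^^ n) (\<lambda>_. 1) (d - x) * indicator {..d} x
        \<le> ennreal (exp (\<kappa> * d)) * q ^ n * ennreal (exp (- \<kappa> * x))"
      proof (cases "x \<le> d")
        case True
        then have "(killed_step F ^^ n) (\<lambda>_. 1) (d - x) \<le> ennreal (exp (\<kappa> * (d - x))) * q ^ n"
          by (intro Suc) auto
        also have "ennreal (exp (\<kappa> * (d - x))) = ennreal (exp (\<kappa> * d)) * ennreal (exp (- \<kappa> * x))"
          by (simp add: ennreal_mult[symmetric] algebra_simps mult_exp_exp)
        finally show ?thesis using True by (simp add: mult_ac)
      qed auto
    qed
    also have "\<dots> = ennreal (exp (\<kappa> * d)) * q ^ Suc n"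
      by (subst nn_integral_cmult) (auto simp: q_def mult_ac)
    finally show ?case .
  qed
  then have le: "(killed_step F ^^ n) (\<lambda>_. 1) d \<le> ennreal (exp (\<kappa> * d)) * q ^ n" for n
    using assms by auto
  obtain r where r: "q = ennreal r" "0 \<le> r" "r < 1"
    using contraction(1) unfolding q_def[symmetric] by (cases q) (auto simp: ennreal_less_one_iff)
  have "(\<lambda>n. ennreal (exp (\<kappa> * d) * r ^ n)) \<longlonglongrightarrow> ennreal (exp (\<kappa> * d) * 0)"
    by (intro tendsto_ennrealI tendsto_mult tendsto_const LIMSEQ_realpow_zero) (use r in auto)
  then have "(\<lambda>n. ennreal (exp (\<kappa> * d)) * q ^ n) \<longlonglongrightarrow> 0"
    using r by (simp add: ennreal_mult ennreal_power)
  then show ?thesis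
    by (rule tendsto_sandwich[OF _ _ tendsto_const, rotated 2]) (auto simp: le)
qed

text \<open>Optional stopping for the bounded function \<open>h\<close>: the terminal value is at
  most \<open>C\<close> times the survival probability, which tends to 0. All inequalities are
  additive because subtraction in \<open>ennreal\<close> truncates.\<close>

lemma green_comparison:
  assumes [measurable]: "h \<in> borel_measurable borel" "f \<in> borel_measurable borel" "g \<in> borel_measurable borel"
    and ineq: "\<And>d. d \<ge> 0 \<Longrightarrow> h d + f d \<le> killed_step F h d + g d"
    and bounded: "\<And>d. d \<ge> 0 \<Longrightarrow> h d \<le> ennreal C" and "d \<ge> 0"
  shows "green F f d \<le> green F g d"
proof -
  have iter: "h d + (\<Sum>n<N. (killed_step F ^^ n) f d)
      \<le> (killed_step F ^^ N) h d + (\<Sum>n<N. (killed_step F ^^ n) g d)" for N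
  proof (induction N)
    case (Suc N)
    have "(killed_step F ^^ N) h d + (killed_step F ^^ N) f d
        = (killed_step F ^^ N) (\<lambda>d. h d + f d) d" by (simp add: killed_steps_add)
    also have "\<dots> \<le> (killed_step F ^^ N) (\<lambda>d. killed_step F h d + g d) d"
      by (intro killed_steps_mono ineq \<open>d \<ge> 0\<close>)
    also have "\<dots> = (killed_step F ^^ Suc N) h d + (killed_step F ^^ N) g d"
      by (simp add: killed_steps_add funpow_swap1)
    finally have *: "(killed_step F ^^ N) h d + (killed_step F ^^ N) f d
      \<le> (killed_step F ^^ Suc N) h d + (killed_step F ^^ N) g d" .
    have "h d + (\<Sum>n<Suc N. (killed_step F ^^ n) f d)
      \<le> (killed_step F ^^ N) h d + (\<Sum>n<N. (killed_step F ^^ n) g d) + (killed_step F ^^ N) f d"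
      using add_right_mono[OF Suc, of "(killed_step F ^^ N) f d"] by (simp add: add.assoc)
    also have "\<dots> = ((killed_step F ^^ N) h d + (killed_step F ^^ N) f d) + (\<Sum>n<N. (killed_step F ^^ n) g d)"
      by (simp add: add_ac)
    also have "\<dots> \<le> ((killed_step F ^^ Suc N) h d + (killed_step F ^^ N) g d) + (\<Sum>n<N. (killed_step F ^^ n) g d)"
      using * by (rule add_right_mono)
    finally show ?case by (simp add: add_ac)
  qed simp
  have small: "(\<lambda>N. ennreal C * (killed_step F ^^ N) (\<lambda>_. 1) d + green F g d) \<longlonglongrightarrow> ennreal C * 0 + green F g d"
    using survival_tendsto_0[OF \<open>d \<ge> 0\<close>]
    by (intro tendsto_add tendsto_const ennreal_tendsto_cmult) auto
  have le: "(\<Sum>n<N. (killed_step F ^^ n) f d) \<le> ennreal C * (killed_step F ^^ N) (\<lambda>_. 1) d + green F g d" for N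
  proof -
    have "(\<Sum>n<N. (killed_step F ^^ n) f d) \<le> h d + (\<Sum>n<N. (killed_step F ^^ n) f d)" by simp
    also note iter
    also have "(killed_step F ^^ N) h d \<le> (killed_step F ^^ N) (\<lambda>_. ennreal C * 1) d"
      using bounded \<open>d \<ge> 0\<close> by (intro killed_steps_mono) auto
    also have "\<dots> = ennreal C * (killed_step F ^^ N) (\<lambda>_. 1) d"
      by (subst killed_steps_cmult) auto
    also have "(\<Sum>n<N. (killed_step F ^^ n) g d) \<le> green F g d"
      unfolding green_def by (rule sum_le_suminf) auto
    finally show ?thesis by (simp add: add_mono)
  qed
  have "(\<lambda>N. \<Sum>n<N. (killed_step F ^^ n) f d) \<longlonglongrightarrow> green F f d"
    unfolding green_def by (rule summable_LIMSEQ) simp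
  from LIMSEQ_le[OF this small] le show ?thesis by auto
qed

section \<open>Intervals that are long relative to the drift\<close>

lemma ramp_integrable:
  assumes "l > 0"
  shows "integrable F (\<lambda>x. ramp l (y + x))"
proof (rule Bochner_Integration.integrable_bound)
  show "integrable F (\<lambda>x. \<bar>y\<bar> + \<bar>x\<bar>)" using integrable by auto
  show "AE x in F. norm (ramp l (y + x)) \<le> norm (\<bar>y\<bar> + \<bar>x\<bar>)"
    using ramp_nonneg[OF assms] by (auto intro!: order_trans[OF ramp_le[OF assms]])
qed measurable

text \<open>The curvature of the ramp is tuned so that near the left end, where its slope is below 1,
  the variance of a step makes up for the missing drift.\<close>

lemma ramp_drift:
  assumes y: "y \<ge> a" and l: "l = v / (2 * \<mu>)"
  shows "ramp l y + \<mu> \<le> (\<integral>x. ramp l (y + x) \<partial>F)"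
proof -
  have l0: "l > 0" using pos l by simp
  show ?thesis
  proof (cases "y \<le> l")
    case True
    have int: "integrable F (\<lambda>x. x\<^sup>2 * indicator {-a..0} x)"
      using left_variance pos not_integrable_integral_eq by fastforce
    have "ramp l y + ramp_slope l y * \<mu> + (\<integral>x. x\<^sup>2 * indicator {-a..0} x \<partial>F) / (2 * l)
        = (\<integral>x. ramp l y + ramp_slope l y * x + x\<^sup>2 * indicator {-a..0} x / (2 * l) \<partial>F)"
      using int integrable mean prob_space by simp
    also have "\<dots> \<le> (\<integral>x. ramp l (y + x) \<partial>F)"
    proof (rule integral_mono)
      fix x
      show "ramp l y + ramp_slope l y * x + x\<^sup>2 * indicator {-a..0} x / (2 * l) \<le> ramp l (y + x)"
        using ramp_curvature[OF l0 y True, of x] ramp_tangent[OF l0, of y "y + x"]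
        by (auto simp: indicator_def)
    qed (use int integrable ramp_integrable[OF l0] in auto)
    finally have "ramp l y + ramp_slope l y * \<mu> + (\<integral>x. x\<^sup>2 * indicator {-a..0} x \<partial>F) / (2 * l)
        \<le> (\<integral>x. ramp l (y + x) \<partial>F)" .
    moreover have "ramp_slope l y * \<mu> \<ge> 0" using pos by (simp add: ramp_slope_def)
    moreover have "\<mu> = v / (2 * l)" unfolding l using pos by simp
    moreover have "v / (2 * l) \<le> (\<integral>x. x\<^sup>2 * indicator {-a..0} x \<partial>F) / (2 * l)"
      using left_variance l0 by (intro divide_right_mono) auto
    ultimately show ?thesis by linarith
  next
    case False
    have "ramp l y + \<mu> = (\<integral>x. ramp l y + x \<partial>F)" using integrable mean prob_space by simp
    also have "\<dots> \<le> (\<integral>x. ramp l (y + x) \<partial>F)"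
    proof (rule integral_mono)
      fix x
      have "ramp_slope l y = 1" using False l0 by (simp add: ramp_slope_def min_def max_def field_simps)
      then show "ramp l y + x \<le> ramp l (y + x)"
        using ramp_tangent[OF l0, of y "y + x"] by simp
    qed (use integrable ramp_integrable[OF l0] in auto)
    finally show ?thesis .
  qed
qed

text \<open>Supporting line plus positive drift. It covers arguments below \<open>a\<close>, where
  the full gain \<open>\<mu>\<close> is not guaranteed.\<close>

lemma ramp_submartingale:
  assumes l: "l > 0"
  shows "ramp l y \<le> (\<integral>x. ramp l (y + x) \<partial>F)"
proof -
  have "ramp l y + 0 \<le> ramp l y + ramp_slope l y * \<mu>"
    using pos by (intro add_left_mono) (simp add: ramp_slope_def)
  also have "\<dots> = (\<integral>x. ramp l y + ramp_slope l y * x \<partial>F)"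
    using integrable mean prob_space by simp
  also have "\<dots> \<le> (\<integral>x. ramp l (y + x) \<partial>F)"
  proof (rule integral_mono)
    fix x
    show "ramp l y + ramp_slope l y * x \<le> ramp l (y + x)"
      using ramp_tangent[OF l, of y "y + x"] by simp
  qed (use ramp_integrable[OF l] integrable in auto)
  finally show ?thesis by simp
qed

text \<open>The ramp is evaluated at \<open>w + a - d\<close>. The offset \<open>a\<close> makes
  this argument at least \<open>a\<close>, hence the gain at least \<open>\<mu>\<close>, for every
  \<open>d\<close> in \<open>[0, w]\<close>. What is gained inside is collected at the exit, when a
  step \<open>x > d\<close> occurs.\<close>

lemma green_interval_le_ramp:
  assumes d: "d \<ge> 0" and w: "w \<ge> 0" and l: "l = v / (2 * \<mu>)"
  shows "green F (\<lambda>d. ennreal \<mu> * indicator {0..w} d) d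
    \<le> green F (\<lambda>d. \<integral>\<^sup>+x. ennreal (ramp l (w + a - d + x)) * indicator {d<..} x \<partial>F) d"
proof (rule green_comparison[where h = "\<lambda>d. ennreal (ramp l (w + a - d))" and C = "w + a"])
  have l0: "l > 0" using pos l by simp
  show "(\<lambda>d. \<integral>\<^sup>+ x. ennreal (ramp l (w + a - d + x)) * indicator {d<..} x \<partial>F) \<in> borel_measurable borel"
    by (rule borel_measurable_nn_integral) (simp add: split_beta' indicator_def greaterThan_def)
  fix d :: real assume d: "d \<ge> 0"
  show "ennreal (ramp l (w + a - d)) \<le> ennreal (w + a)"
    using ramp_le[OF l0, of "w + a - d"] d w pos by (intro ennreal_leI) auto
  have eq: "killed_step F (\<lambda>d. ennreal (ramp l (w + a - d))) d
      + (\<integral>\<^sup>+x. ennreal (ramp l (w + a - d + x)) * indicator {d<..} x \<partial>F)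
    = ennreal (\<integral>x. ramp l (w + a - d + x) \<partial>F)" (is "?L = _")
  proof -
    have "?L = (\<integral>\<^sup>+x. ennreal (ramp l (w + a - d + x)) \<partial>F)"
      unfolding killed_step_def
      by (subst nn_integral_add[symmetric])
         (auto intro!: nn_integral_cong simp: algebra_simps split: split_indicator)
    also have "\<dots> = ennreal (\<integral>x. ramp l (w + a - d + x) \<partial>F)"
      by (rule nn_integral_eq_integral) (use ramp_integrable ramp_nonneg l0 in auto)
    finally show ?thesis .
  qed
  have "ramp l (w + a - d) + \<mu> * indicator {0..w} d \<le> (\<integral>x. ramp l (w + a - d + x) \<partial>F)"
    using ramp_drift[OF _ l, of "w + a - d"] ramp_submartingale[OF l0, of "w + a - d"] d
    by (auto simp: indicator_def)
  then have "ennreal (ramp l (w + a - d) + \<mu> * indicator {0..w} d) \<le> ?L"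
    unfolding eq by (rule ennreal_leI)
  moreover have "ennreal (ramp l (w + a - d) + \<mu> * indicator {0..w} d)
      = ennreal (ramp l (w + a - d)) + ennreal \<mu> * indicator {0..w} d"
    using ramp_nonneg[OF l0] pos by (auto simp: indicator_def ennreal_plus)
  ultimately show "ennreal (ramp l (w + a - d)) + ennreal \<mu> * indicator {0..w} d \<le> ?L"
    by simp
qed (use d in auto)

text \<open>Here \<open>y\<close> stands for the overshoot: a quadratic bound on the ramp at the
  exit needs only the exit probability and the first two overshoot moments, all bounded
  independently of the drift.\<close>

lemma green_interval_le_moments:
  assumes d: "d \<ge> 0" and w: "w \<ge> 0" and l: "l = v / (2 * \<mu>)"
    and nn: "\<alpha> \<ge> 0" "\<beta> \<ge> 0" "\<gamma> \<ge> 0"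
    and le: "\<And>y. y > 0 \<Longrightarrow> ramp l (w + a + y) \<le> \<alpha> + \<beta> * y + \<gamma> * y\<^sup>2"
  shows "ennreal \<mu> * green F (indicator {0..w}) d
    \<le> ennreal (\<alpha> + \<beta> * (M * K / (\<eta> * s)) + \<gamma> * (2 * M * K / (\<eta> * s\<^sup>2)))"
proof -
  let ?q = "overshoot_kernel F"
  define L1 where "L1 = M * fact 1 / s ^ 1 * (K / \<eta>)"
  define L2 where "L2 = M * fact 2 / s ^ 2 * (K / \<eta>)"
  have K: "K > 0" using trunc_le_K pos by simp
  have "ennreal \<mu> * green F (indicator {0..w}) d = green F (\<lambda>d. ennreal \<mu> * indicator {0..w} d) d"
    by (simp add: green_cmult)
  also have "\<dots> \<le> green F (\<lambda>d. \<integral>\<^sup>+x. ennreal (ramp l (w + a - d + x)) * indicator {d<..} x \<partial>F) d"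
    by (rule green_interval_le_ramp[OF d w l])
  also have "\<dots> \<le> green F (\<lambda>d. ennreal \<alpha> * ?q 0 d + ennreal \<beta> * ?q 1 d + ennreal \<gamma> * ?q 2 d) d"
  proof (rule green_mono[OF _ d])
    fix d
    have "(\<integral>\<^sup>+x. ennreal (ramp l (w + a - d + x)) * indicator {d<..} x \<partial>F)
      \<le> (\<integral>\<^sup>+x. ennreal \<alpha> * (ennreal ((x - d) ^ 0) * indicator {d<..} x)
            + ennreal \<beta> * (ennreal ((x - d) ^ 1) * indicator {d<..} x)
            + ennreal \<gamma> * (ennreal ((x - d) ^ 2) * indicator {d<..} x) \<partial>F)"
    proof (rule nn_integral_mono)
      fix x
      show "ennreal (ramp l (w + a - d + x)) * indicator {d<..} x
        \<le> ennreal \<alpha> * (ennreal ((x - d) ^ 0) * indicator {d<..} x)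
            + ennreal \<beta> * (ennreal ((x - d) ^ 1) * indicator {d<..} x)
            + ennreal \<gamma> * (ennreal ((x - d) ^ 2) * indicator {d<..} x)"
      proof (cases "d < x")
        case True
        have "ennreal (ramp l (w + a - d + x)) \<le> ennreal (\<alpha> + \<beta> * (x - d) + \<gamma> * (x - d)\<^sup>2)"
          using le[of "x - d"] True by (intro ennreal_leI) (simp add: algebra_simps)
        also have "\<dots> = ennreal \<alpha> + ennreal \<beta> * ennreal (x - d) + ennreal \<gamma> * ennreal ((x - d)\<^sup>2)"
          using True nn by (simp add: ennreal_plus ennreal_mult)
        finally show ?thesis using True by simp
      qed auto
    qed
    also have "\<dots> = ennreal \<alpha> * ?q 0 d + ennreal \<beta> * ?q 1 d + ennreal \<gamma> * ?q 2 d"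
      unfolding overshoot_kernel_def by (simp add: nn_integral_add nn_integral_cmult)
    finally show "(\<integral>\<^sup>+x. ennreal (ramp l (w + a - d + x)) * indicator {d<..} x \<partial>F)
      \<le> ennreal \<alpha> * ?q 0 d + ennreal \<beta> * ?q 1 d + ennreal \<gamma> * ?q 2 d" .
  qed
  also have "\<dots> = ennreal \<alpha> * green F (?q 0) d + ennreal \<beta> * green F (?q 1) d + ennreal \<gamma> * green F (?q 2) d"
    by (simp add: green_add green_cmult)
  also have "\<dots> \<le> ennreal \<alpha> * 1 + ennreal \<beta> * ennreal L1 + ennreal \<gamma> * ennreal L2"
    unfolding L1_def L2_def by (intro add_mono mult_left_mono green_exit_probability green_overshoot_kernel_crude d) auto
  also have "\<dots> = ennreal (\<alpha> + \<beta> * L1 + \<gamma> * L2)"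
  proof -
    have "L1 \<ge> 0" "L2 \<ge> 0" using pos K by (auto simp: L1_def L2_def)
    then show ?thesis using nn by (simp add: ennreal_plus ennreal_mult)
  qed
  also have "\<alpha> + \<beta> * L1 + \<gamma> * L2
    = \<alpha> + \<beta> * (M * K / (\<eta> * s)) + \<gamma> * (2 * M * K / (\<eta> * s\<^sup>2))"
    by (simp add: L1_def L2_def fact_numeral field_simps)
  finally show ?thesis .
qed

text \<open>The ramp at \<open>w\<close> falls short of \<open>w\<close> by at least
  \<open>w / 2\<close> if \<open>w \<le> l\<close> and by \<open>l / 2\<close> otherwise. This
  margin absorbs the offset \<open>a\<close> and the overshoot: the condition on
  \<open>\<mu>\<close> makes \<open>l\<close> at least four times \<open>a + L1\<close>, the
  condition on \<open>w\<close> controls the terms without a factor \<open>w\<close>.\<close>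

lemma green_interval_large:
  assumes d: "d \<ge> 0"
    and \<mu>: "8 * (a + M * K / (\<eta> * s)) * \<mu> \<le> v"
    and w: "8 * (a\<^sup>2 + 2 * M * K / (\<eta> * s\<^sup>2)) / v * \<mu> \<le> w"
  shows "green F (indicator {0..w}) d \<le> ennreal (w / \<mu>)"
proof -
  define l where "l = v / (2 * \<mu>)"
  define L1 where "L1 = M * K / (\<eta> * s)"
  define L2 where "L2 = 2 * M * K / (\<eta> * s\<^sup>2)"
  have K: "K > 0" using trunc_le_K pos by simp
  have L: "L1 > 0" "L2 > 0" using pos K by (auto simp: L1_def L2_def)
  have l: "l > 0" "l \<ge> 4 * (a + L1)" using \<mu> pos by (auto simp: l_def L1_def field_simps)
  have wl: "4 * (a\<^sup>2 + L2) / l \<le> w" using w pos by (simp add: l_def L2_def field_simps)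
  then have w0: "w > 0" using l L pos by (smt (verit) divide_pos_pos zero_le_power2 mult_pos_pos)
  have "ennreal \<mu> * green F (indicator {0..w}) d \<le> ennreal w"
  proof (cases "w \<le> l")
    case True
    have "ennreal \<mu> * green F (indicator {0..w}) d
      \<le> ennreal ((w\<^sup>2 + 2 * w * a + 2 * a\<^sup>2) / (2 * l) + w / l * L1 + 1 / l * L2)"
      unfolding L1_def L2_def
    proof (rule green_interval_le_moments[OF d _ l_def])
      fix y :: real assume y: "y > 0"
      have "ramp l (w + a + y) \<le> (w + a + y)\<^sup>2 / (2 * l)"
        using y w0 pos l by (intro ramp_le_quadratic) auto
      \<comment> \<open>Uses \<open>2 * a * y \<le> a\<^sup>2 + y\<^sup>2\<close>, so that the
        coefficient of \<open>y\<close> is proportional to \<open>w\<close>.\<close>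
      also have "(w + a + y)\<^sup>2 \<le> w\<^sup>2 + 2 * w * a + 2 * a\<^sup>2 + 2 * w * y + 2 * y\<^sup>2"
        using zero_le_power2[of "a - y"] by (simp add: power2_eq_square algebra_simps)
      also have "(w\<^sup>2 + 2 * w * a + 2 * a\<^sup>2 + 2 * w * y + 2 * y\<^sup>2) / (2 * l)
        = (w\<^sup>2 + 2 * w * a + 2 * a\<^sup>2) / (2 * l) + w / l * y + 1 / l * y\<^sup>2"
        using l by (simp add: field_simps)
      finally show "ramp l (w + a + y) \<le> (w\<^sup>2 + 2 * w * a + 2 * a\<^sup>2) / (2 * l) + w / l * y + 1 / l * y\<^sup>2"
        using l by (simp add: divide_right_mono)
    qed (use w0 pos l in auto)
    also have "(w\<^sup>2 + 2 * w * a + 2 * a\<^sup>2) / (2 * l) + w / l * L1 + 1 / l * L2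
      = w * w / (2 * l) + w * (a + L1) / l + (a\<^sup>2 + L2) / l"
      using l by (simp add: field_simps power2_eq_square)
    also have "\<dots> \<le> w / 2 + w / 4 + w / 4"
    proof (intro add_mono)
      show "w * w / (2 * l) \<le> w / 2"
        using True w0 l by (simp add: field_simps)
      have "w * (a + L1) \<le> w * (l / 4)" using l w0 by (intro mult_left_mono) auto
      then show "w * (a + L1) / l \<le> w / 4" using l by (simp add: field_simps)
      show "(a\<^sup>2 + L2) / l \<le> w / 4" using wl by (simp add: field_simps)
    qed
    finally show ?thesis by (simp add: ennreal_leI)
  next
    case False
    have "ennreal \<mu> * green F (indicator {0..w}) d \<le> ennreal (w + a - l / 2 + 1 * L1 + 0 * L2)"
      unfolding L1_def L2_def
    proof (rule green_interval_le_moments[OF d _ l_def])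
      fix y :: real assume y: "y > 0"
      show "ramp l (w + a + y) \<le> w + a - l / 2 + 1 * y + 0 * y\<^sup>2"
        using y False pos l by (subst ramp_large) auto
    qed (use w0 pos l False in auto)
    also have "\<dots> \<le> ennreal w" using l L pos by (intro ennreal_leI) auto
    finally show ?thesis .
  qed
  then have "ennreal (1 / \<mu>) * (ennreal \<mu> * green F (indicator {0..w}) d) \<le> ennreal (1 / \<mu>) * ennreal w"
    by (rule mult_left_mono) simp
  moreover have "ennreal (1 / \<mu>) * ennreal \<mu> = 1"
    by (subst ennreal_mult[symmetric]) (use pos in auto)
  moreover have "ennreal (1 / \<mu>) * ennreal w = ennreal (w / \<mu>)"
    by (subst ennreal_mult[symmetric]) (use pos w0 in auto)
  ultimately show ?thesis by (simp add: mult.assoc[symmetric])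
qed

lemma positive_part_power_integrable: "integrable F (\<lambda>x. (max x 0) ^ k)"
proof (rule Bochner_Integration.integrable_bound)
  show "integrable F (\<lambda>x. fact k / s ^ k * exp (s * x) + 1)" using exp_integrable by auto
  have "(max x 0) ^ k \<le> fact k / s ^ k * exp (s * x) + 1" for x
  proof (cases "x \<ge> 0")
    case True
    then show ?thesis using power_le_fact_exp[of s x k] pos by (simp add: max_def)
  next
    case False
    then have "(max x 0) ^ k \<le> 1" by (simp add: max_def power_0_left)
    moreover have "0 \<le> fact k / s ^ k * exp (s * x)" using pos by simp
    ultimately show ?thesis by linarith
  qed
  then show "AE x in F. norm ((max x 0) ^ k) \<le> norm (fact k / s ^ k * exp (s * x) + 1)"
    using pos by auto
qed measurable

lemma positive_part_moment_le:
  assumes "k \<ge> 1"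
  shows "(\<integral>x. (max x 0) ^ k \<partial>F) \<le> fact k / s ^ k * M"
proof -
  have "(\<integral>x. (max x 0) ^ k \<partial>F) \<le> (\<integral>x. fact k / s ^ k * exp (s * x) \<partial>F)"
  proof (rule integral_mono)
    fix x
    show "(max x 0) ^ k \<le> fact k / s ^ k * exp (s * x)"
    proof (cases "x \<ge> 0")
      case True
      then show ?thesis using power_le_fact_exp[of s x k] pos by (simp add: max_def)
    next
      case False
      then show ?thesis using pos assms by (simp add: max_def power_0_left)
    qed
  qed (use positive_part_power_integrable exp_integrable in auto)
  also have "\<dots> \<le> fact k / s ^ k * M" using exp_moment pos by (simp add: divide_right_mono)
  finally show ?thesis .
qed

end

section \<open>Overshoot moments as Green functions\<close>

context step_law
begin

text \<open>For x > d, (x - d)^k is the integral of k (x - w)^(k - 1) over w from d to x, so the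
  kernel is a mixture of indicators of [0, w]. Integrating w against these weights from 0 to x is a
  Beta integral equal to x^(k + 1) / (k + 1); the constant \<open>E\<close> yields x^k.\<close>

lemma green_overshoot_kernel_le:
  assumes k: "k \<ge> 1" and b: "b \<ge> 0" and E: "E \<ge> 0"
    and le: "\<And>w. w > 0 \<Longrightarrow> green F (indicator {0..w}) b \<le> ennreal (w / \<mu> + E)"
  shows "green F (overshoot_kernel F k) b
    \<le> ennreal ((\<integral>x. (max x 0) ^ (k + 1) \<partial>F) / (real (k + 1) * \<mu>) + E * (\<integral>x. (max x 0) ^ k \<partial>F))"
proof -
  interpret P: pair_sigma_finite lborel F ..
  define g where "g = (\<lambda>w x. ennreal (real k * (x - w) ^ (k - 1)) * indicator {w..} x :: ennreal)"
  \<comment> \<open>This local \<open>\<kappa>\<close> is the mixing density and hides the locale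
    parameter. The point 0 is removed since \<open>le\<close> is available for \<open>w > 0\<close>
    only; it is a null set.\<close>
  define \<kappa> where "\<kappa> = (\<lambda>w. (\<integral>\<^sup>+x. g w x \<partial>F) * indicator {0<..} w)"
  have g_meas [measurable]: "(\<lambda>(w, x). g w x) \<in> borel_measurable (lborel \<Otimes>\<^sub>M F)"
    unfolding g_def by (simp add: split_beta' indicator_def atLeast_def)
  have \<kappa>_meas [measurable]: "\<kappa> \<in> borel_measurable lborel"
    unfolding \<kappa>_def by measurable
  have [measurable]: "(\<lambda>(w, d). \<kappa> w * indicator {0..w} d) \<in> borel_measurable (lborel \<Otimes>\<^sub>M borel)"
    by (simp add: split_beta' indicator_def)
  have "overshoot_kernel F k d \<le> (\<integral>\<^sup>+w. \<kappa> w * indicator {0..w} d \<partial>lborel)" if d: "d \<ge> 0" for d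
  proof -
    have "overshoot_kernel F k d \<le> (\<integral>\<^sup>+x. \<integral>\<^sup>+w. g w x * indicator {0<..} w * indicator {0..w} d \<partial>lborel \<partial>F)"
      unfolding overshoot_kernel_def
    proof (rule nn_integral_mono)
      fix x
      show "ennreal ((x - d) ^ k) * indicator {d<..} x
        \<le> (\<integral>\<^sup>+w. g w x * indicator {0<..} w * indicator {0..w} d \<partial>lborel)"
      proof (cases "d < x")
        case True
        have "(\<integral>\<^sup>+w. ennreal (real k * (x - w) ^ (k - 1)) * indicator {d..x} w \<partial>lborel)
          = ennreal (- ((x - x) ^ k) - (- ((x - d) ^ k)))"
        proof (rule nn_integral_FTC_Icc)
          fix w
          show "((\<lambda>w. - ((x - w) ^ k)) has_real_derivative real k * (x - w) ^ (k - 1)) (at w)"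
            by (auto intro!: derivative_eq_intros)
        qed (use True in auto)
        then have "ennreal ((x - d) ^ k)
          = (\<integral>\<^sup>+w. ennreal (real k * (x - w) ^ (k - 1)) * indicator {d..x} w \<partial>lborel)"
          using k by (simp add: power_0_left)
        also have "\<dots> \<le> (\<integral>\<^sup>+w. g w x * indicator {0<..} w * indicator {0..w} d \<partial>lborel)"
        proof (rule nn_integral_mono_AE)
          show "AE w in lborel. ennreal (real k * (x - w) ^ (k - 1)) * indicator {d..x} w
              \<le> g w x * indicator {0<..} w * indicator {0..w} d"
            using AE_lborel_singleton[of 0] by eventually_elim (use d in \<open>auto simp: g_def indicator_def\<close>)
        qed
        finally show ?thesis using True by simp
      qed auto
    qed
    also have "\<dots> = (\<integral>\<^sup>+w. \<integral>\<^sup>+x. g w x * indicator {0<..} w * indicator {0..w} d \<partial>F \<partial>lborel)"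
      by (rule P.Fubini') (simp add: split_beta' indicator_def greaterThan_def)
    also have "\<dots> = (\<integral>\<^sup>+w. \<kappa> w * indicator {0..w} d \<partial>lborel)"
      unfolding \<kappa>_def by (simp add: nn_integral_multc)
    finally show ?thesis .
  qed
  then have "green F (overshoot_kernel F k) b \<le> green F (\<lambda>d. \<integral>\<^sup>+w. \<kappa> w * indicator {0..w} d \<partial>lborel) b"
    by (rule green_mono[OF _ b])
  also have "\<dots> = (\<integral>\<^sup>+w. green F (\<lambda>d. \<kappa> w * indicator {0..w} d) b \<partial>lborel)"
    by (rule green_nn_integral) (auto intro: sigma_finite_lborel)
  also have "\<dots> = (\<integral>\<^sup>+w. \<kappa> w * green F (indicator {0..w}) b \<partial>lborel)"
    by (simp add: green_cmult)
  also have "\<dots> \<le> (\<integral>\<^sup>+w. \<kappa> w * ennreal (w / \<mu> + E) \<partial>lborel)"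
    using le by (intro nn_integral_mono) (auto simp: \<kappa>_def indicator_def intro!: mult_left_mono)
  also have "\<dots> = (\<integral>\<^sup>+w. \<integral>\<^sup>+x. g w x * (indicator {0<..} w * ennreal (w / \<mu> + E)) \<partial>F \<partial>lborel)"
    unfolding \<kappa>_def by (simp add: nn_integral_multc mult.assoc)
  also have "\<dots> = (\<integral>\<^sup>+x. \<integral>\<^sup>+w. g w x * (indicator {0<..} w * ennreal (w / \<mu> + E)) \<partial>lborel \<partial>F)"
    by (rule P.Fubini'[symmetric]) (simp add: split_beta' indicator_def greaterThan_def)
  also have "\<dots> \<le> (\<integral>\<^sup>+x. ennreal ((max x 0) ^ (k + 1) / (real (k + 1) * \<mu>) + E * (max x 0) ^ k) \<partial>F)"
  proof (rule nn_integral_mono)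
    fix x
    show "(\<integral>\<^sup>+w. g w x * (indicator {0<..} w * ennreal (w / \<mu> + E)) \<partial>lborel)
      \<le> ennreal ((max x 0) ^ (k + 1) / (real (k + 1) * \<mu>) + E * (max x 0) ^ k)"
    proof (cases "x > 0")
      case True
      have "(\<integral>\<^sup>+w. g w x * (indicator {0<..} w * ennreal (w / \<mu> + E)) \<partial>lborel)
        \<le> (\<integral>\<^sup>+w. ennreal (real k * (x - w) ^ (k - 1) * (w / \<mu> + E)) * indicator {0..x} w \<partial>lborel)"
        using pos E by (intro nn_integral_mono) (auto simp: g_def indicator_def ennreal_mult)
      \<comment> \<open>Antiderivative from one integration by parts. At \<open>w = x\<close> both
        powers vanish, so only the lower end contributes.\<close>
      also have "\<dots> = ennreal ((- ((x - x) ^ k * (x / \<mu> + E)) - (x - x) ^ (k + 1) / (real (k + 1) * \<mu>))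
          - (- ((x - 0) ^ k * (0 / \<mu> + E)) - (x - 0) ^ (k + 1) / (real (k + 1) * \<mu>)))"
      proof (rule nn_integral_FTC_Icc)
        fix w
        have "((\<lambda>w. - ((x - w) ^ k * (w / \<mu> + E)) - (x - w) ^ (k + 1) / (real (k + 1) * \<mu>)) has_real_derivative
          - (- real k * (x - w) ^ (k - 1) * (w / \<mu> + E) + (x - w) ^ k / \<mu>)
            - (- (real (k + 1) * (x - w) ^ k) / (real (k + 1) * \<mu>))) (at w)"
          using pos by (auto intro!: derivative_eq_intros simp del: of_nat_add power_Suc)
        also have "- (- real k * (x - w) ^ (k - 1) * (w / \<mu> + E) + (x - w) ^ k / \<mu>)
            - (- (real (k + 1) * (x - w) ^ k) / (real (k + 1) * \<mu>)) = real k * (x - w) ^ (k - 1) * (w / \<mu> + E)"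
          using pos by (simp del: of_nat_add)
        finally show "((\<lambda>w. - ((x - w) ^ k * (w / \<mu> + E)) - (x - w) ^ (k + 1) / (real (k + 1) * \<mu>))
          has_real_derivative real k * (x - w) ^ (k - 1) * (w / \<mu> + E)) (at w)" .
      qed (use True pos E in auto)
      also have "\<dots> = ennreal ((max x 0) ^ (k + 1) / (real (k + 1) * \<mu>) + E * (max x 0) ^ k)"
        using True k by (simp add: power_0_left mult.commute)
      finally show ?thesis .
    next
      case False
      then have zero: "g w x * (indicator {0<..} w * ennreal (w / \<mu> + E)) = 0" for w
        by (auto simp: g_def indicator_def)
      show ?thesis unfolding zero by simp
    qed
  qed
  also have "\<dots> = ennreal (\<integral>x. (max x 0) ^ (k + 1) / (real (k + 1) * \<mu>) + E * (max x 0) ^ k \<partial>F)"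
    using positive_part_power_integrable[of k] positive_part_power_integrable[of "k + 1"] pos E
    by (intro nn_integral_eq_integral) auto
  also have "(\<integral>x. (max x 0) ^ (k + 1) / (real (k + 1) * \<mu>) + E * (max x 0) ^ k \<partial>F)
    = (\<integral>x. (max x 0) ^ (k + 1) \<partial>F) / (real (k + 1) * \<mu>) + E * (\<integral>x. (max x 0) ^ k \<partial>F)"
    using positive_part_power_integrable[of k] positive_part_power_integrable[of "k + 1"] by simp
  finally show ?thesis .
qed

end

section \<open>The Green operator on the probability space of the walk\<close>

locale iid_walk = prob_space P for P :: "'a measure" +
  fixes X :: "nat \<Rightarrow> 'a \<Rightarrow> real" and F :: "real measure"
  assumes iid: "iid_with_law P X F"
begin

lemma rv [measurable]: "n \<ge> 1 \<Longrightarrow> X n \<in> borel_measurable P"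
  using iid unfolding iid_with_law_def indep_vars_def by auto

lemma law: "n \<ge> 1 \<Longrightarrow> distr P borel (X n) = F"
  using iid unfolding iid_with_law_def by auto

sublocale step: real_distribution F
  using prob_space_distr[OF rv[of 1]] law[of 1]
  by (intro real_distribution.intro) (auto simp: real_distribution_axioms_def)

lemma walk_measurable [measurable]: "walk X n \<in> borel_measurable P"
  unfolding walk_def[abs_def] by (intro borel_measurable_sum) auto

definition below :: "real \<Rightarrow> nat \<Rightarrow> 'a \<Rightarrow> bool" where
  "below b n \<omega> \<longleftrightarrow> (\<forall>j\<in>{1..n}. walk X j \<omega> \<le> b)"

lemma below_measurable [measurable]: "Measurable.pred P (below b n)"
  unfolding below_def[abs_def] by measurable

text \<open>\<open>X (Suc n)\<close> is independent of the first \<open>n\<close> increments, so it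
  can be integrated out with the past frozen. The integrand is rewritten as a function
  \<open>G\<close> of two disjoint blocks of coordinates, whose joint law is a product.\<close>

lemma next_step:
  assumes [measurable]: "(\<lambda>(d, x). g d x) \<in> borel_measurable (borel \<Otimes>\<^sub>M borel)"
  shows "(\<integral>\<^sup>+\<omega>. indicator {\<omega>. below b n \<omega>} \<omega> * g (b - walk X n \<omega>) (X (Suc n) \<omega>) \<partial>P)
    = (\<integral>\<^sup>+\<omega>. indicator {\<omega>. below b n \<omega>} \<omega> * (\<integral>\<^sup>+x. g (b - walk X n \<omega>) x \<partial>F) \<partial>P)"
proof -
  let ?S = "PiM {1..n} (\<lambda>_. borel :: real measure)"
  define Y where "Y = (\<lambda>\<omega>. restrict (\<lambda>i. X i \<omega>) {1..n})"
  define G where "G = (\<lambda>(y :: nat \<Rightarrow> real, x :: nat \<Rightarrow> real).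
    indicator {y. \<forall>j\<in>{1..n}. (\<Sum>i=1..j. y i) \<le> b} y * g (b - (\<Sum>i=1..n. y i)) (x (Suc n)))"
  let ?T = "PiM {Suc n} (\<lambda>_. borel :: real measure)"
  define Z where "Z = (\<lambda>\<omega>. restrict (\<lambda>i. X i \<omega>) {Suc n})"
  have ind: "indep_var ?S Y ?T Z"
    unfolding Y_def Z_def using iid unfolding iid_with_law_def
    by (intro indep_var_restrict[of _ _ "{1..}"]) auto
  have [measurable]: "Y \<in> measurable P ?S" "Z \<in> measurable P ?T"
    using ind by (auto dest: indep_var_rv1 indep_var_rv2)
  have joint: "distr P (?S \<Otimes>\<^sub>M ?T) (\<lambda>\<omega>. (Y \<omega>, Z \<omega>)) = distr P ?S Y \<Otimes>\<^sub>M distr P ?T Z"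
    using ind by (simp add: indep_var_distribution_eq)
  have [measurable]: "(\<lambda>y. \<Sum>i=1..j. y i) \<in> borel_measurable ?S" if "j \<le> n" for j
    using that by (intro borel_measurable_sum measurable_component_singleton) auto
  have pred: "Measurable.pred ?S (\<lambda>y. \<forall>j\<in>{1..n}. (\<Sum>i=1..j. y i) \<le> b)"
    by (intro pred_intros_finite) auto
  have [measurable]: "(\<lambda>y. indicator {y. \<forall>j\<in>{1..n}. (\<Sum>i=1..j. y i) \<le> b} y :: ennreal) \<in> borel_measurable ?S"
    using pred by (simp add: indicator_def)
  have "(\<lambda>p. g (b - (\<Sum>i=1..n. fst p i)) (snd p (Suc n))) \<in> borel_measurable (?S \<Otimes>\<^sub>M ?T)"
    using measurable_compose[OF _ assms, of "\<lambda>p. (b - (\<Sum>i=1..n. fst p i), snd p (Suc n))" "?S \<Otimes>\<^sub>M ?T"]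
    by simp
  then have G [measurable]: "G \<in> borel_measurable (?S \<Otimes>\<^sub>M ?T)"
    unfolding G_def by (simp add: split_beta')
  have sum_Y: "(\<Sum>i=1..j. Y \<omega> i) = walk X j \<omega>" if "j \<le> n" for j \<omega>
    unfolding walk_def Y_def using that by (intro sum.cong) auto
  have GY: "G (Y \<omega>, z) = indicator {\<omega>. below b n \<omega>} \<omega> * g (b - walk X n \<omega>) (z (Suc n))" for \<omega> z
    unfolding G_def by (auto simp: sum_Y[unfolded One_nat_def] below_def indicator_def)
  interpret T: prob_space "distr P ?T Z" by (rule prob_space_distr) measurable
  have "(\<integral>\<^sup>+\<omega>. indicator {\<omega>. below b n \<omega>} \<omega> * g (b - walk X n \<omega>) (X (Suc n) \<omega>) \<partial>P)
    = (\<integral>\<^sup>+\<omega>. G (Y \<omega>, Z \<omega>) \<partial>P)" by (simp add: GY Z_def)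
  also have "\<dots> = (\<integral>\<^sup>+p. G p \<partial>distr P (?S \<Otimes>\<^sub>M ?T) (\<lambda>\<omega>. (Y \<omega>, Z \<omega>)))"
    by (rule nn_integral_distr[symmetric]) measurable
  also have "\<dots> = (\<integral>\<^sup>+y. \<integral>\<^sup>+z. G (y, z) \<partial>distr P ?T Z \<partial>distr P ?S Y)"
    unfolding joint by (rule T.nn_integral_fst[symmetric]) measurable
  also have "\<dots> = (\<integral>\<^sup>+\<omega>. \<integral>\<^sup>+z. G (Y \<omega>, z) \<partial>distr P ?T Z \<partial>P)"
    by (rule nn_integral_distr) measurable
  also have "\<dots> = (\<integral>\<^sup>+\<omega>. indicator {\<omega>. below b n \<omega>} \<omega> * (\<integral>\<^sup>+x. g (b - walk X n \<omega>) x \<partial>F) \<partial>P)"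
  proof (rule nn_integral_cong)
    fix \<omega>
    have g: "g d \<in> borel_measurable borel" for d
      using measurable_compose[OF measurable_Pair1' assms, of d] by simp
    have "(\<integral>\<^sup>+z. G (Y \<omega>, z) \<partial>distr P ?T Z) = (\<integral>\<^sup>+\<omega>'. G (Y \<omega>, Z \<omega>') \<partial>P)"
      using measurable_compose[OF measurable_Pair1' G, of "Y \<omega>"]
      by (subst nn_integral_distr) (auto simp: space_PiM Y_def)
    also have "\<dots> = (\<integral>\<^sup>+\<omega>'. indicator {\<omega>. below b n \<omega>} \<omega> * g (b - walk X n \<omega>) (X (Suc n) \<omega>') \<partial>P)"
      by (simp add: GY Z_def)
    also have "\<dots> = indicator {\<omega>. below b n \<omega>} \<omega> * (\<integral>\<^sup>+\<omega>'. g (b - walk X n \<omega>) (X (Suc n) \<omega>') \<partial>P)"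
      using measurable_compose[OF rv[of "Suc n"] g] by (intro nn_integral_cmult) auto
    also have "(\<integral>\<^sup>+\<omega>'. g (b - walk X n \<omega>) (X (Suc n) \<omega>') \<partial>P) = (\<integral>\<^sup>+x. g (b - walk X n \<omega>) x \<partial>F)"
      using law[of "Suc n", symmetric] g by (simp add: nn_integral_distr)
    finally show "(\<integral>\<^sup>+z. G (Y \<omega>, z) \<partial>distr P ?T Z)
      = indicator {\<omega>. below b n \<omega>} \<omega> * (\<integral>\<^sup>+x. g (b - walk X n \<omega>) x \<partial>F)" .
  qed
  finally show ?thesis .
qed

text \<open>The induction peels off the last step, hence runs over all \<open>f\<close> at once;
  iterates commute, so this agrees with the recursion on the first step.\<close>

lemma killed_steps_eq:
  assumes [measurable]: "f \<in> borel_measurable borel"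
  shows "(\<integral>\<^sup>+\<omega>. indicator {\<omega>. below b n \<omega>} \<omega> * f (b - walk X n \<omega>) \<partial>P) = (killed_step F ^^ n) f b"
  using assms
proof (induction n arbitrary: f)
  case 0
  then show ?case using emeasure_space_1 by (simp add: below_def walk_def)
next
  case (Suc n)
  note [measurable] = Suc.prems
  have "(\<integral>\<^sup>+\<omega>. indicator {\<omega>. below b (Suc n) \<omega>} \<omega> * f (b - walk X (Suc n) \<omega>) \<partial>P)
    = (\<integral>\<^sup>+\<omega>. indicator {\<omega>. below b n \<omega>} \<omega> * (f (b - walk X n \<omega> - X (Suc n) \<omega>)
        * indicator {..b - walk X n \<omega>} (X (Suc n) \<omega>)) \<partial>P)"
  proof (rule nn_integral_cong)
    fix \<omega>
    have "walk X (Suc n) \<omega> = walk X n \<omega> + X (Suc n) \<omega>" by (simp add: walk_def)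
    then show "indicator {\<omega>. below b (Suc n) \<omega>} \<omega> * f (b - walk X (Suc n) \<omega>)
      = indicator {\<omega>. below b n \<omega>} \<omega> * (f (b - walk X n \<omega> - X (Suc n) \<omega>)
        * indicator {..b - walk X n \<omega>} (X (Suc n) \<omega>))"
      by (auto simp: below_def indicator_def atLeastAtMostSuc_conv algebra_simps)
  qed
  also have "\<dots> = (\<integral>\<^sup>+\<omega>. indicator {\<omega>. below b n \<omega>} \<omega> * killed_step F f (b - walk X n \<omega>) \<partial>P)"
    unfolding killed_step_def
    by (rule next_step) (simp add: split_beta' indicator_def atMost_def)
  also have "\<dots> = (killed_step F ^^ Suc n) f b"
    by (subst Suc.IH) (auto simp: funpow_swap1)
  finally show ?case .
qed

lemma passage_time_cases:
  obtains "passage_time X b \<omega> = \<infinity>" "\<And>n. below b n \<omega>"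
  | n where "passage_time X b \<omega> = enat (Suc n)" "below b n \<omega>" "walk X (Suc n) \<omega> > b"
proof (cases "\<exists>n\<ge>1. walk X n \<omega> > b")
  case False
  then have "{n. 1 \<le> n \<and> walk X n \<omega> > b} = {}" by auto
  then have "passage_time X b \<omega> = \<infinity>" unfolding passage_time_def by (simp add: Inf_enat_def)
  moreover have "below b n \<omega>" for n
    using False by (auto simp: below_def not_less)
  ultimately show ?thesis by (rule that(1))
next
  case True
  let ?A = "{n. 1 \<le> n \<and> walk X n \<omega> > b}"
  define n where "n = (LEAST n. 1 \<le> n \<and> walk X n \<omega> > b)"
  have n: "n \<ge> 1" "walk X n \<omega> > b"
    using LeastI_ex[of "\<lambda>n. 1 \<le> n \<and> walk X n \<omega> > b"] True unfolding n_def by auto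
  have least: "n \<le> j" if "j \<ge> 1" "walk X j \<omega> > b" for j
    unfolding n_def using that by (intro Least_le) auto
  have "Inf (enat ` ?A) = enat n"
    using n least by (intro antisym Inf_lower Inf_greatest) auto
  then have "passage_time X b \<omega> = enat (Suc (n - 1))"
    unfolding passage_time_def using n by simp
  moreover have "below b (n - 1) \<omega>" unfolding below_def
  proof
    fix j assume "j \<in> {1..n - 1}"
    then show "walk X j \<omega> \<le> b" using least[of j] n by (cases "walk X j \<omega> > b") auto
  qed
  ultimately show ?thesis using n by (intro that(2)) auto
qed

text \<open>Decomposition by the number of steps before the crossing: once the level is exceeded,
  exactly one summand is nonzero. The hypothesis \<open>surv\<close> makes the event of no crossing,
  on which the overshoot is infinite, a null set.\<close>

lemma overshoot_moment_eq_green: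
  assumes surv: "(\<lambda>n. (killed_step F ^^ n) (\<lambda>_. 1) b) \<longlonglongrightarrow> 0"
  shows "overshoot_moment P X b k = green F (overshoot_kernel F k) b"
proof -
  define Z where "Z = {\<omega> \<in> space P. \<forall>n. below b n \<omega>}"
  have [measurable]: "Z \<in> sets P" unfolding Z_def by measurable
  have "emeasure P Z \<le> (killed_step F ^^ n) (\<lambda>_. 1) b" for n
  proof -
    have "emeasure P Z \<le> emeasure P {\<omega> \<in> space P. below b n \<omega>}"
      by (rule emeasure_mono) (auto simp: Z_def)
    also have "\<dots> = (\<integral>\<^sup>+\<omega>. indicator {\<omega>. below b n \<omega>} \<omega> * 1 \<partial>P)"
      by (subst nn_integral_indicator[symmetric]) (simp, intro nn_integral_cong, auto simp: indicator_def)
    also have "\<dots> = (killed_step F ^^ n) (\<lambda>_. 1) b"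
      by (rule killed_steps_eq[of "\<lambda>_. 1"]) auto
    finally show ?thesis .
  qed
  then have "emeasure P Z \<le> 0"
    by (intro LIMSEQ_le_const[OF surv]) auto
  then have AE: "AE \<omega> in P. \<omega> \<notin> Z" by (intro AE_not_in) (auto simp: null_sets_def)
  define g where "g = (\<lambda>d x :: real. ennreal ((x - d) ^ k) * indicator {d<..} x)"
  have "AE \<omega> in P. overshoot X b \<omega> ^ k
      = (\<Sum>n. indicator {\<omega>. below b n \<omega>} \<omega> * g (b - walk X n \<omega>) (X (Suc n) \<omega>))"
    using AE AE_space
  proof eventually_elim
    fix \<omega> assume \<omega>: "\<omega> \<notin> Z" "\<omega> \<in> space P"
    have Suc: "walk X (Suc n) \<omega> = walk X n \<omega> + X (Suc n) \<omega>" for n by (simp add: walk_def)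
    show "overshoot X b \<omega> ^ k = (\<Sum>n. indicator {\<omega>. below b n \<omega>} \<omega> * g (b - walk X n \<omega>) (X (Suc n) \<omega>))"
    proof (cases rule: passage_time_cases[of b \<omega>])
      case 1
      then show ?thesis using \<omega> by (auto simp: Z_def)
    next
      case (2 n)
      have "indicator {\<omega>. below b j \<omega>} \<omega> * g (b - walk X j \<omega>) (X (Suc j) \<omega>) = 0" if "j \<noteq> n" for j
      proof (cases "j < n")
        case True
        then have "walk X (Suc j) \<omega> \<le> b" using 2(2) by (auto simp: below_def)
        then show ?thesis by (simp add: g_def Suc)
      next
        case False
        then have "\<not> below b j \<omega>" using 2(3) that by (auto simp: below_def intro!: bexI[of _ "Suc n"])
        then show ?thesis by simp
      qed
      then have "(\<Sum>n. indicator {\<omega>. below b n \<omega>} \<omega> * g (b - walk X n \<omega>) (X (Suc n) \<omega>))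
        = (\<Sum>j\<in>{n}. indicator {\<omega>. below b j \<omega>} \<omega> * g (b - walk X j \<omega>) (X (Suc j) \<omega>))"
        by (intro suminf_finite) auto
      also have "\<dots> = overshoot X b \<omega> ^ k"
        using 2 by (simp add: overshoot_def g_def Suc ennreal_power algebra_simps)
      finally show ?thesis by simp
    qed
  qed
  then have "overshoot_moment P X b k
    = (\<integral>\<^sup>+\<omega>. (\<Sum>n. indicator {\<omega>. below b n \<omega>} \<omega> * g (b - walk X n \<omega>) (X (Suc n) \<omega>)) \<partial>P)"
    unfolding overshoot_moment_def by (rule nn_integral_cong_AE)
  also have "\<dots> = (\<Sum>n. \<integral>\<^sup>+\<omega>. indicator {\<omega>. below b n \<omega>} \<omega> * g (b - walk X n \<omega>) (X (Suc n) \<omega>) \<partial>P)"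
    unfolding g_def by (rule nn_integral_suminf) (measurable, simp)
  also have "\<dots> = (\<Sum>n. \<integral>\<^sup>+\<omega>. indicator {\<omega>. below b n \<omega>} \<omega> * overshoot_kernel F k (b - walk X n \<omega>) \<partial>P)"
  proof -
    have "(\<lambda>(d, x). g d x) \<in> borel_measurable (borel \<Otimes>\<^sub>M borel)"
      unfolding g_def by (simp add: split_beta' indicator_def greaterThan_def)
    then show ?thesis by (subst next_step) (auto simp: overshoot_kernel_def g_def)
  qed
  also have "\<dots> = green F (overshoot_kernel F k) b"
  proof -
    have "overshoot_kernel F k \<in> borel_measurable borel"
      unfolding overshoot_kernel_def[abs_def]
      by (rule step.borel_measurable_nn_integral) (simp add: split_beta' indicator_def greaterThan_def)
    then show ?thesis unfolding green_def by (simp add: killed_steps_eq)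
  qed
  finally show ?thesis .
qed

end

section \<open>Gaussian smoothing\<close>

lemma (in real_distribution) integral_cos_eq_char:
  "(\<integral>x. cos (t * x + \<alpha>) \<partial>M) = Re (iexp \<alpha> * char M t)"
proof -
  have int: "integrable M (\<lambda>x. iexp (t * x))" by (rule integrable_iexp) auto
  have "Re (iexp \<alpha> * char M t) = (\<integral>x. Re (iexp \<alpha> * iexp (t * x)) \<partial>M)"
    unfolding char_def using int by (subst integral_Re) (auto simp del: of_real_mult)
  also have "\<dots> = (\<integral>x. cos (t * x + \<alpha>) \<partial>M)"
    by (intro Bochner_Integration.integral_cong refl) (simp add: Re_exp Im_exp cos_add)
  finally show ?thesis by simp
qed

text \<open>Self-duality of the Gaussian under the Fourier transform, read off from the
  characteristic function of the standard normal law by rescaling.\<close>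

lemma normal_density_fourier:
  fixes w y :: real
  assumes w: "w > 0"
  shows "integrable lborel (\<lambda>t. cos (t * y) * exp (- (w\<^sup>2 * t\<^sup>2) / 2))"
    and "normal_density 0 w y = 1 / (2 * pi) * (\<integral>t. cos (t * y) * exp (- (w\<^sup>2 * t\<^sup>2) / 2) \<partial>lborel)"
proof -
  interpret N: real_distribution std_normal_distribution by (rule real_dist_normal_dist)
  have exp_eq: "exp (- (w\<^sup>2 * t\<^sup>2) / 2) = sqrt (2 * pi) / w * normal_density 0 (1 / w) t" for t
    using w by (simp add: normal_density_def real_sqrt_divide power_divide field_simps)
  have int0: "integrable lborel (\<lambda>t. exp (- (w\<^sup>2 * t\<^sup>2) / 2))"
    unfolding exp_eq using w by (intro integrable_mult_right integrable_normal_density) auto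
  show int: "integrable lborel (\<lambda>t. cos (t * y) * exp (- (w\<^sup>2 * t\<^sup>2) / 2))"
    by (rule Bochner_Integration.integrable_bound[OF int0]) (auto simp: abs_mult mult_left_le_one_le)
  have "exp (- ((y / w)\<^sup>2) / 2) = Re (char std_normal_distribution (y / w))"
    by (simp add: char_std_normal_distribution)
  also have "\<dots> = (\<integral>x. cos (y / w * x) \<partial>std_normal_distribution)"
    using N.integral_cos_eq_char[of "y / w" 0] by simp
  also have "\<dots> = (\<integral>x. std_normal_density x * cos (y / w * x) \<partial>lborel)"
    by (subst integral_density) auto
  also have "\<dots> = \<bar>w\<bar> *\<^sub>R (\<integral>t. std_normal_density (0 + w * t) * cos (y / w * (0 + w * t)) \<partial>lborel)"
    using w by (intro lborel_integral_real_affine) auto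
  also have "(\<lambda>t. std_normal_density (0 + w * t) * cos (y / w * (0 + w * t)))
      = (\<lambda>t. 1 / sqrt (2 * pi) * (cos (t * y) * exp (- (w\<^sup>2 * t\<^sup>2) / 2)))"
    using w by (auto simp: std_normal_density_def power_mult_distrib mult.commute)
  also have "\<bar>w\<bar> *\<^sub>R (\<integral>t. 1 / sqrt (2 * pi) * (cos (t * y) * exp (- (w\<^sup>2 * t\<^sup>2) / 2)) \<partial>lborel)
      = w / sqrt (2 * pi) * (\<integral>t. cos (t * y) * exp (- (w\<^sup>2 * t\<^sup>2) / 2) \<partial>lborel)"
    using w by simp
  finally have eq: "exp (- ((y / w)\<^sup>2) / 2)
      = w / sqrt (2 * pi) * (\<integral>t. cos (t * y) * exp (- (w\<^sup>2 * t\<^sup>2) / 2) \<partial>lborel)" .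
  have "normal_density 0 w y = 1 / (w * sqrt (2 * pi)) * exp (- ((y / w)\<^sup>2) / 2)"
    using w by (simp add: normal_density_def real_sqrt_mult power_divide mult.commute mult.left_commute)
  also have "\<dots> = 1 / (2 * pi) * (\<integral>t. cos (t * y) * exp (- (w\<^sup>2 * t\<^sup>2) / 2) \<partial>lborel)"
    unfolding eq using w by (simp add: field_simps)
  finally show "normal_density 0 w y = 1 / (2 * pi) * (\<integral>t. cos (t * y) * exp (- (w\<^sup>2 * t\<^sup>2) / 2) \<partial>lborel)" .
qed

lemma gaussian_integral:
  fixes w :: real
  assumes "w > 0"
  shows "integrable lborel (\<lambda>t. exp (- (w\<^sup>2 * t\<^sup>2) / 2))"
    and "(\<integral>t. exp (- (w\<^sup>2 * t\<^sup>2) / 2) \<partial>lborel) = sqrt (2 * pi) / w"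
proof -
  show "integrable lborel (\<lambda>t. exp (- (w\<^sup>2 * t\<^sup>2) / 2))"
    using normal_density_fourier(1)[OF assms, of 0] by simp
  have "1 / (sqrt (2 * pi) * w) = 1 / (2 * pi) * (\<integral>t. exp (- (w\<^sup>2 * t\<^sup>2) / 2) \<partial>lborel)"
    using normal_density_fourier(2)[OF assms, of 0] assms
    by (simp add: normal_density_def real_sqrt_mult)
  then have "(\<integral>t. exp (- (w\<^sup>2 * t\<^sup>2) / 2) \<partial>lborel) = 2 * pi / (sqrt (2 * pi) * w)"
    by (simp add: field_simps)
  also have "2 * pi / (sqrt (2 * pi) * w) = (2 * pi / sqrt (2 * pi)) / w" by (simp add: mult.commute)
  also have "2 * pi / sqrt (2 * pi) = sqrt (2 * pi)" by (rule real_div_sqrt) simp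
  finally show "(\<integral>t. exp (- (w\<^sup>2 * t\<^sup>2) / 2) \<partial>lborel) = sqrt (2 * pi) / w" .
qed

text \<open>Subtracting both translates produces the weight \<open>1 - cos (t * u)\<close>, which
  vanishes to second order at frequency 0.\<close>

lemma normal_density_second_difference:
  fixes w y u :: real
  assumes w: "w > 0"
  shows "2 * normal_density 0 w y - normal_density 0 w (y - u) - normal_density 0 w (y + u)
    = 1 / pi * (\<integral>t. cos (t * y) * (1 - cos (t * u)) * exp (- (w\<^sup>2 * t\<^sup>2) / 2) \<partial>lborel)"
proof -
  let ?e = "\<lambda>t. exp (- (w\<^sup>2 * t\<^sup>2) / 2)"
  have "(\<integral>t. cos (t * y) * (1 - cos (t * u)) * ?e t \<partial>lborel)
    = (\<integral>t. cos (t * y) * ?e t - (cos (t * (y - u)) * ?e t) / 2 - (cos (t * (y + u)) * ?e t) / 2 \<partial>lborel)"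
    by (intro Bochner_Integration.integral_cong refl)
       (simp add: algebra_simps cos_add cos_diff flip: add_divide_distrib diff_divide_distrib)
  also have "\<dots> = (\<integral>t. cos (t * y) * ?e t \<partial>lborel) - (\<integral>t. cos (t * (y - u)) * ?e t \<partial>lborel) / 2
      - (\<integral>t. cos (t * (y + u)) * ?e t \<partial>lborel) / 2"
    using normal_density_fourier(1)[OF w] by simp
  finally show ?thesis
    using normal_density_fourier(2)[OF w, of y] normal_density_fourier(2)[OF w, of "y - u"]
      normal_density_fourier(2)[OF w, of "y + u"]
    by (simp add: field_simps)
qed

lemma (in real_distribution) integral_cos_le_char: "(\<integral>x. cos (t * x + \<alpha>) \<partial>M) \<le> cmod (char M t)"
  unfolding integral_cos_eq_char using complex_Re_le_cmod[of "iexp \<alpha> * char M t"]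
  by (simp add: norm_mult del: of_real_mult)

text \<open>Density of \<open>Q\<close> convolved with a centred Gaussian of standard deviation
  \<open>w\<close>.\<close>

definition smoothed_density :: "real measure \<Rightarrow> real \<Rightarrow> real \<Rightarrow> real" where
  "smoothed_density Q w x = (\<integral>z. normal_density 0 w (x - z) \<partial>Q)"

context real_distribution
begin

lemma normal_density_shift_integrable:
  assumes w: "w > 0"
  shows "integrable M (\<lambda>z. normal_density 0 w (x - z))"
proof (rule integrable_const_bound[where B = "1 / (sqrt (2 * pi * w\<^sup>2))"])
  show "AE z in M. norm (normal_density 0 w (x - z)) \<le> 1 / (sqrt (2 * pi * w\<^sup>2))"
    by (auto simp: normal_density_def divide_right_mono)
qed measurable

text \<open>The Gaussian factor makes the double integral absolutely convergent, so Fubini applies.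
  Discarding the phase of the characteristic function makes the bound independent of
  \<open>x\<close>.\<close>

lemma smoothed_density_second_difference:
  assumes w: "w > 0"
  shows "2 * smoothed_density M w x - smoothed_density M w (x - u) - smoothed_density M w (x + u)
    \<le> 1 / pi * (\<integral>t. (1 - cos (t * u)) * exp (- (w\<^sup>2 * t\<^sup>2) / 2) * cmod (char M t) \<partial>lborel)"
proof -
  interpret P: pair_sigma_finite M lborel ..
  let ?e = "\<lambda>t. exp (- (w\<^sup>2 * t\<^sup>2) / 2)"
  define f where "f = (\<lambda>z t. cos (t * (x - z)) * (1 - cos (t * u)) * ?e t)"
  note int_e = gaussian_integral(1)[OF w]
  have bound: "\<bar>cos a * (1 - cos b)\<bar> \<le> 2" for a b :: real
  proof -
    have "\<bar>cos a\<bar> * \<bar>1 - cos b\<bar> \<le> 1 * 2"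
      using cos_le_one[of b] cos_ge_minus_one[of b] by (intro mult_mono) (auto simp: abs_le_iff)
    then show ?thesis by (simp add: abs_mult)
  qed
  have f_bound: "norm (f z t) \<le> 2 * ?e t" for z t
    unfolding f_def using bound[of "t * (x - z)" "t * u"] by (simp add: abs_mult mult_right_mono)
  have f_int: "integrable lborel (f z)" for z
    by (rule Bochner_Integration.integrable_bound[of _ "\<lambda>t. 2 * ?e t"]) (use int_e f_bound in \<open>auto simp: f_def\<close>)
  have int_f: "integrable (M \<Otimes>\<^sub>M lborel) (case_prod f)"
  proof (rule P.Fubini_integrable)
    show "case_prod f \<in> borel_measurable (M \<Otimes>\<^sub>M lborel)" unfolding f_def by measurable
    have meas: "(\<lambda>z. \<integral>t. norm (f z t) \<partial>lborel) \<in> borel_measurable M"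
      unfolding f_def by measurable
    show "integrable M (\<lambda>z. \<integral>t. norm (case (z, t) of (z, t) \<Rightarrow> f z t) \<partial>lborel)"
    proof (rule integrable_const_bound)
      show "AE z in M. norm (\<integral>t. norm (case (z, t) of (z, t) \<Rightarrow> f z t) \<partial>lborel) \<le> (\<integral>t. 2 * ?e t \<partial>lborel)"
      proof (rule AE_I2)
        fix z
        have "(\<integral>t. norm (f z t) \<partial>lborel) \<le> (\<integral>t. 2 * ?e t \<partial>lborel)"
          by (rule integral_mono) (use f_bound int_e f_int in auto)
        then show "norm (\<integral>t. norm (case (z, t) of (z, t) \<Rightarrow> f z t) \<partial>lborel) \<le> (\<integral>t. 2 * ?e t \<partial>lborel)"
          by (simp only: prod.case real_norm_def abs_of_nonneg integral_nonneg_AE AE_I2 norm_ge_zero)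
      qed
    qed (use meas in simp)
    show "AE z in M. integrable lborel (\<lambda>t. case (z, t) of (z, t) \<Rightarrow> f z t)" using f_int by simp
  qed
  have "2 * smoothed_density M w x - smoothed_density M w (x - u) - smoothed_density M w (x + u)
    = (\<integral>z. 2 * normal_density 0 w (x - z) - normal_density 0 w (x - z - u) - normal_density 0 w (x - z + u) \<partial>M)"
    using normal_density_shift_integrable[OF w, of x] normal_density_shift_integrable[OF w, of "x - u"]
      normal_density_shift_integrable[OF w, of "x + u"]
    unfolding smoothed_density_def by (simp add: algebra_simps)
  also have "\<dots> = (\<integral>z. 1 / pi * (\<integral>t. f z t \<partial>lborel) \<partial>M)"
    unfolding normal_density_second_difference[OF w] f_def ..
  also have "\<dots> = 1 / pi * (\<integral>z. (\<integral>t. f z t \<partial>lborel) \<partial>M)" by simp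
  also have "(\<integral>z. (\<integral>t. f z t \<partial>lborel) \<partial>M) = (\<integral>t. (\<integral>z. f z t \<partial>M) \<partial>lborel)"
    by (rule P.Fubini_integral[symmetric]) (use int_f in simp)
  also have "1 / pi * \<dots> \<le> 1 / pi * (\<integral>t. (1 - cos (t * u)) * ?e t * cmod (char M t) \<partial>lborel)"
  proof (intro mult_left_mono integral_mono)
    show "integrable lborel (\<lambda>t. \<integral>z. f z t \<partial>M)" by (rule P.integrable_snd[OF int_f])
    show "integrable lborel (\<lambda>t. (1 - cos (t * u)) * ?e t * cmod (char M t))"
    proof (rule Bochner_Integration.integrable_bound[of _ "\<lambda>t. 2 * ?e t"])
      show "AE t in lborel. norm ((1 - cos (t * u)) * ?e t * cmod (char M t)) \<le> norm (2 * ?e t)"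
      proof (rule AE_I2)
        fix t
        have "norm ((1 - cos (t * u)) * ?e t * cmod (char M t)) \<le> 2 * ?e t * 1"
          unfolding norm_mult using bound[of 0 "t * u"] cmod_char_le_1[of t] by (intro mult_mono) auto
        then show "norm ((1 - cos (t * u)) * ?e t * cmod (char M t)) \<le> norm (2 * ?e t)" by simp
      qed
    qed (use int_e in auto)
    fix t
    have "cos (t * (x - z)) = cos (t * z + - (t * x))" for z
      by (metis cos_minus minus_diff_eq right_diff_distrib uminus_add_conv_diff add.commute)
    then have "(\<integral>z. f z t \<partial>M) = (1 - cos (t * u)) * ?e t * (\<integral>z. cos (t * z + - (t * x)) \<partial>M)"
      unfolding f_def by (simp add: mult_ac)
    also have "\<dots> \<le> (1 - cos (t * u)) * ?e t * cmod (char M t)"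
      by (intro mult_left_mono integral_cos_le_char) auto
    finally show "(\<integral>z. f z t \<partial>M) \<le> (1 - cos (t * u)) * ?e t * cmod (char M t)" .
  qed auto
  finally show ?thesis .
qed

lemma smoothed_density_measurable [measurable]: "smoothed_density M w \<in> borel_measurable borel"
proof -
  have "(\<lambda>x. \<integral>z. normal_density 0 w (x - z) \<partial>M) \<in> borel_measurable borel"
    by (rule borel_measurable_lebesgue_integral) (simp add: split_beta')
  then show ?thesis by (simp add: smoothed_density_def[abs_def])
qed

lemma smoothed_density_nonneg: "0 \<le> smoothed_density M w x"
  unfolding smoothed_density_def by (intro integral_nonneg_AE) auto

lemma ennreal_smoothed_density:
  assumes "w > 0"
  shows "ennreal (smoothed_density M w x) = (\<integral>\<^sup>+z. normal_density 0 w (x - z) \<partial>M)"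
  unfolding smoothed_density_def
  by (rule nn_integral_eq_integral[symmetric]) (use normal_density_shift_integrable[OF assms] in auto)

lemma nn_integral_smoothed_density:
  assumes w: "w > 0"
  shows "(\<integral>\<^sup>+x. smoothed_density M w x \<partial>lborel) = 1"
proof -
  interpret P: pair_sigma_finite M lborel ..
  have "(\<integral>\<^sup>+x. smoothed_density M w x \<partial>lborel) = (\<integral>\<^sup>+x. \<integral>\<^sup>+z. normal_density 0 w (x - z) \<partial>M \<partial>lborel)"
    by (simp add: ennreal_smoothed_density[OF w])
  also have "\<dots> = (\<integral>\<^sup>+z. \<integral>\<^sup>+x. normal_density 0 w (x - z) \<partial>lborel \<partial>M)"
    by (rule P.Fubini') (simp add: split_beta')
  also have "\<dots> = (\<integral>\<^sup>+z. 1 \<partial>M)"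
  proof (rule nn_integral_cong)
    fix z
    have "(\<integral>\<^sup>+x. normal_density 0 w (x - z) \<partial>lborel) = (\<integral>\<^sup>+x. normal_density z w x \<partial>lborel)"
      by (simp add: normal_density_def)
    also have "\<dots> = ennreal (\<integral>x. normal_density z w x \<partial>lborel)"
      by (rule nn_integral_eq_integral) (use w in auto)
    finally show "(\<integral>\<^sup>+x. normal_density 0 w (x - z) \<partial>lborel) = 1" using w by simp
  qed
  also have "\<dots> = 1" using emeasure_space_1 by simp
  finally show ?thesis .
qed

end

section \<open>Smoothness of the law after many steps\<close>

primrec walk_law :: "real measure \<Rightarrow> nat \<Rightarrow> real measure" where
  "walk_law F 0 = return borel 0"
| "walk_law F (Suc n) = (F \<star> walk_law F n)"

context real_distribution
begin

lemma real_distribution_walk_law: "real_distribution (walk_law M n)"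
proof (induction n)
  case 0
  show ?case
    by (intro real_distribution.intro) (auto simp: real_distribution_axioms_def intro!: prob_space_return)
next
  case (Suc n)
  interpret N: real_distribution "walk_law M n" by fact
  interpret P: pair_prob_space M "walk_law M n" ..
  have "prob_space (M \<star> walk_law M n)"
    unfolding convolution_def by (rule P.prob_space_distr) simp
  then show ?case by (intro real_distribution.intro) (auto simp: real_distribution_axioms_def)
qed

lemma nn_integral_walk_law_Suc:
  assumes "f \<in> borel_measurable borel"
  shows "(\<integral>\<^sup>+z. f z \<partial>walk_law M (Suc n)) = (\<integral>\<^sup>+x. \<integral>\<^sup>+z. f (x + z) \<partial>walk_law M n \<partial>M)"
proof -
  interpret N: real_distribution "walk_law M n" by (rule real_distribution_walk_law)
  show ?thesis
    unfolding walk_law.simps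
    by (rule nn_integral_convolution) (auto simp: assms intro: finite_measure_axioms N.finite_measure_axioms)
qed

lemma char_walk_law: "char (walk_law M n) t = char M t ^ n"
proof (induction n)
  case 0
  show ?case by (simp add: char_def integral_return)
next
  case (Suc n)
  interpret N: real_distribution "walk_law M n" by (rule real_distribution_walk_law)
  interpret P: pair_prob_space M "walk_law M n" ..
  have int: "integrable M (\<lambda>x. iexp (t * x))" "integrable (walk_law M n) (\<lambda>x. iexp (t * x))"
    by (rule integrable_iexp N.integrable_iexp; auto)+
  have "char (walk_law M (Suc n)) t = (\<integral>p. iexp (t * (fst p + snd p)) \<partial>(M \<Otimes>\<^sub>M walk_law M n))"
    unfolding walk_law.simps convolution_def char_def
    by (subst integral_distr) (auto simp: split_beta')
  also have "\<dots> = (\<integral>p. (case p of (x, z) \<Rightarrow> iexp (t * x) * iexp (t * z)) \<partial>(M \<Otimes>\<^sub>M walk_law M n))"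
    by (intro Bochner_Integration.integral_cong refl)
       (auto simp: split_beta' algebra_simps exp_add[symmetric])
  also have "\<dots> = (\<integral>x. \<integral>z. iexp (t * x) * iexp (t * z) \<partial>walk_law M n \<partial>M)"
  proof (rule P.integral_fst[symmetric])
    show "integrable (M \<Otimes>\<^sub>M walk_law M n) (\<lambda>(x, z). iexp (t * x) * iexp (t * z))"
      by (rule P.integrable_const_bound[where B = 1])
         (auto simp: split_beta' norm_mult simp del: of_real_mult)
  qed
  also have "\<dots> = char M t * char (walk_law M n) t"
    unfolding char_def by (simp del: of_real_mult)
  finally show ?case by (simp add: Suc)
qed

text \<open>Killing before time \<open>n\<close> is forgotten; only the condition on the endpoint
  remains.\<close>

lemma killed_steps_le_walk_law:
  assumes [measurable]: "f \<in> borel_measurable borel"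
  shows "d \<ge> 0 \<Longrightarrow> (killed_step M ^^ n) f d \<le> (\<integral>\<^sup>+z. f (d - z) * indicator {..d} z \<partial>walk_law M n)"
proof (induction n arbitrary: d)
  case 0
  then show ?case by (simp add: nn_integral_return)
next
  case (Suc n)
  interpret N: real_distribution "walk_law M n" by (rule real_distribution_walk_law)
  have "(killed_step M ^^ Suc n) f d
    = (\<integral>\<^sup>+x. (killed_step M ^^ n) f (d - x) * indicator {..d} x \<partial>M)"
    by (simp add: killed_step_def[of _ _ d])
  also have "\<dots> \<le> (\<integral>\<^sup>+x. \<integral>\<^sup>+z. f (d - (x + z)) * indicator {..d} (x + z) \<partial>walk_law M n \<partial>M)"
  proof (rule nn_integral_mono)
    fix x
    show "(killed_step M ^^ n) f (d - x) * indicator {..d} x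
      \<le> (\<integral>\<^sup>+z. f (d - (x + z)) * indicator {..d} (x + z) \<partial>walk_law M n)"
    proof (cases "x \<le> d")
      case True
      have "(killed_step M ^^ n) f (d - x)
        \<le> (\<integral>\<^sup>+z. f (d - x - z) * indicator {..d - x} z \<partial>walk_law M n)"
        using True by (intro Suc) auto
      also have "\<dots> = (\<integral>\<^sup>+z. f (d - (x + z)) * indicator {..d} (x + z) \<partial>walk_law M n)"
        by (intro nn_integral_cong) (auto simp: indicator_def algebra_simps)
      finally show ?thesis using True by simp
    qed auto
  qed
  also have "\<dots> = (\<integral>\<^sup>+z. f (d - z) * indicator {..d} z \<partial>walk_law M (Suc n))"
    by (subst nn_integral_walk_law_Suc) auto
  finally show ?case .
qed

end

text \<open>A change of variables moves the translation from \<open>g\<close> to \<open>V\<close>;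
  Tonelli then uses only averages of \<open>V\<close> over unit windows. The values 1 and -1 of
  \<open>\<epsilon>\<close> give the two directions.\<close>

lemma average_translate:
  fixes V g :: "real \<Rightarrow> ennreal"
  assumes [measurable]: "V \<in> borel_measurable borel" "g \<in> borel_measurable borel"
    and J: "\<And>x. (\<integral>\<^sup>+u. indicator {0..1} u * V (x + \<epsilon> * u) \<partial>lborel) \<le> J"
  shows "(\<integral>\<^sup>+u. indicator {0..1} u * (\<integral>\<^sup>+y. V y * g (y - \<epsilon> * u) \<partial>lborel) \<partial>lborel)
    \<le> J * (\<integral>\<^sup>+x. g x \<partial>lborel)"
proof -
  have "(\<integral>\<^sup>+y. V y * g (y - \<epsilon> * u) \<partial>lborel) = (\<integral>\<^sup>+x. V (x + \<epsilon> * u) * g x \<partial>lborel)" for u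
    by (subst nn_integral_real_affine[where c = 1 and t = "\<epsilon> * u"]) (auto simp: add.commute)
  then have "(\<integral>\<^sup>+u. indicator {0..1} u * (\<integral>\<^sup>+y. V y * g (y - \<epsilon> * u) \<partial>lborel) \<partial>lborel)
    = (\<integral>\<^sup>+u. \<integral>\<^sup>+x. indicator {0..1} u * (V (x + \<epsilon> * u) * g x) \<partial>lborel \<partial>lborel)"
    by (simp add: nn_integral_cmult)
  also have "\<dots> = (\<integral>\<^sup>+x. \<integral>\<^sup>+u. indicator {0..1} u * (V (x + \<epsilon> * u) * g x) \<partial>lborel \<partial>lborel)"
    by (rule lborel_pair.Fubini') (simp add: split_beta' indicator_def)
  also have "\<dots> = (\<integral>\<^sup>+x. (\<integral>\<^sup>+u. indicator {0..1} u * V (x + \<epsilon> * u) \<partial>lborel) * g x \<partial>lborel)"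
    by (simp add: nn_integral_multc[symmetric] mult.assoc)
  also have "\<dots> \<le> (\<integral>\<^sup>+x. J * g x \<partial>lborel)"
    by (intro nn_integral_mono mult_right_mono J) auto
  finally show ?thesis by (simp add: nn_integral_cmult)
qed

context step_law
begin

text \<open>The growth \<open>M ^ n\<close> is affordable as long as \<open>n\<close> is a small
  multiple of \<open>d\<close>.\<close>

lemma exp_killed_steps:
  "(killed_step F ^^ n) (\<lambda>d. ennreal (exp (- s * d))) d \<le> ennreal (M ^ n * exp (- s * d))"
proof (induction n arbitrary: d)
  case (Suc n)
  have "(killed_step F ^^ Suc n) (\<lambda>d. ennreal (exp (- s * d))) d
    \<le> (\<integral>\<^sup>+x. ennreal (M ^ n * exp (- s * d) * exp (s * x)) \<partial>F)"
    unfolding funpow.simps o_def killed_step_def[of F _ d]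
  proof (rule nn_integral_mono)
    fix x
    have "M ^ n * exp (- s * (d - x)) = M ^ n * exp (- s * d) * exp (s * x)"
      by (simp add: algebra_simps mult_exp_exp)
    then show "(killed_step F ^^ n) (\<lambda>d. ennreal (exp (- s * d))) (d - x) * indicator {..d} x
      \<le> ennreal (M ^ n * exp (- s * d) * exp (s * x))"
      using Suc[of "d - x"] unfolding \<open>M ^ n * exp (- s * (d - x)) = _\<close>
      by (cases "x \<le> d") (simp_all only: indicator_simps atMost_iff mult_1_right mult_zero_right not_False_eq_True zero_le)
  qed
  also have "\<dots> = ennreal (M ^ n * exp (- s * d) * (\<integral>x. exp (s * x) \<partial>F))"
    by (subst nn_integral_eq_integral) (use exp_integrable pos in auto)
  also have "\<dots> \<le> ennreal (M ^ n * exp (- s * d) * M)"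
    using pos exp_moment by (intro ennreal_leI mult_left_mono) auto
  finally show ?case by (simp add: mult_ac)
qed simp

lemma nn_integral_abs_walk_law: "(\<integral>\<^sup>+z. ennreal \<bar>z\<bar> \<partial>walk_law F n) \<le> ennreal (n * m)"
proof (induction n)
  case 0
  show ?case by (simp add: nn_integral_return)
next
  case (Suc n)
  interpret N: real_distribution "walk_law F n" by (rule real_distribution_walk_law)
  have "(\<integral>\<^sup>+z. ennreal \<bar>z\<bar> \<partial>walk_law F (Suc n))
    = (\<integral>\<^sup>+x. \<integral>\<^sup>+z. ennreal \<bar>x + z\<bar> \<partial>walk_law F n \<partial>F)"
    by (rule nn_integral_walk_law_Suc) simp
  also have "\<dots> \<le> (\<integral>\<^sup>+x. \<integral>\<^sup>+z. ennreal \<bar>x\<bar> + ennreal \<bar>z\<bar> \<partial>walk_law F n \<partial>F)"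
    by (intro nn_integral_mono) (auto simp: ennreal_plus[symmetric] simp del: ennreal_plus intro!: ennreal_leI)
  also have "\<dots> = (\<integral>\<^sup>+x. ennreal \<bar>x\<bar> + (\<integral>\<^sup>+z. ennreal \<bar>z\<bar> \<partial>walk_law F n) \<partial>F)"
    using N.emeasure_space_1 by (intro nn_integral_cong) (simp add: nn_integral_add)
  also have "\<dots> = (\<integral>\<^sup>+x. ennreal \<bar>x\<bar> \<partial>F) + (\<integral>\<^sup>+z. ennreal \<bar>z\<bar> \<partial>walk_law F n)"
    using emeasure_space_1 by (simp add: nn_integral_add)
  also have "(\<integral>\<^sup>+x. ennreal \<bar>x\<bar> \<partial>F) = ennreal (\<integral>x. \<bar>x\<bar> \<partial>F)"
    by (rule nn_integral_eq_integral) (use integrable in auto)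
  also have "ennreal (\<integral>x. \<bar>x\<bar> \<partial>F) + (\<integral>\<^sup>+z. ennreal \<bar>z\<bar> \<partial>walk_law F n) \<le> ennreal m + ennreal (n * m)"
    using Suc abs_moment by (intro add_mono ennreal_leI)
  also have "\<dots> = ennreal (Suc n * m)"
    using pos by (subst ennreal_plus[symmetric]) (auto simp: algebra_simps)
  finally show ?case .
qed

text \<open>Markov's inequality with the first absolute moment. A bound strictly below 1 suffices to
  absorb the supremum later.\<close>

lemma walk_law_left_tail:
  assumes b: "b > 0" and n: "2 * m * n \<le> b"
  shows "emeasure (walk_law F n) {..< -b} \<le> ennreal (1 / 2)"
proof -
  interpret N: real_distribution "walk_law F n" by (rule real_distribution_walk_law)
  have "emeasure (walk_law F n) {..< -b} = (\<integral>\<^sup>+z. indicator {..< -b} z \<partial>walk_law F n)" by simp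
  also have "\<dots> \<le> (\<integral>\<^sup>+z. ennreal (1 / b) * ennreal \<bar>z\<bar> \<partial>walk_law F n)"
  proof (rule nn_integral_mono)
    fix z :: real
    have "1 \<le> ennreal (1 / b) * ennreal \<bar>z\<bar>" if "z < -b"
      using that b by (simp add: ennreal_mult[symmetric] field_simps)
    then show "indicator {..< -b} z \<le> ennreal (1 / b) * ennreal \<bar>z\<bar>" by (auto simp: indicator_def)
  qed
  also have "\<dots> = ennreal (1 / b) * (\<integral>\<^sup>+z. ennreal \<bar>z\<bar> \<partial>walk_law F n)" by (simp add: nn_integral_cmult)
  also have "\<dots> \<le> ennreal (1 / b) * ennreal (n * m)"
    by (intro mult_left_mono nn_integral_abs_walk_law) simp
  also have "\<dots> = ennreal (n * m / b)" using b pos by (simp add: ennreal_mult[symmetric])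
  also have "\<dots> \<le> ennreal (1 / 2)" using n b by (intro ennreal_leI) (simp add: field_simps)
  finally show ?thesis .
qed

text \<open>Half of the second-difference bound: the first summand comes from frequencies in
  \<open>[-T, T]\<close>, the second from the larger ones, with \<open>sqrt (2 * pi) / w\<close> the
  Gaussian integral.\<close>

definition smoothing_error :: "nat \<Rightarrow> real \<Rightarrow> real" where
  "smoothing_error n w = (2 * T / (c * n) + 2 * \<rho> ^ n * (sqrt (2 * pi) / w)) / (2 * pi)"

text \<open>At low frequencies the factor t^2 / 2 from the cosine meets the decay exp(- c n t^2 /
  2), and y exp(- y) <= 1 turns the product into 1 / (c n). At high frequencies the power of
  \<open>\<rho>\<close> remains.\<close>

lemma char_walk_law_weight_le:
  assumes n: "n \<ge> 1" and u: "\<bar>u\<bar> \<le> 1"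
  shows "(1 - cos (t * u)) * cmod (char (walk_law F n) t)
    \<le> 1 / (c * n) * indicator {-T..T} t + 2 * \<rho> ^ n"
proof -
  have cos: "0 \<le> 1 - cos (t * u)" "1 - cos (t * u) \<le> 2"
    using cos_le_one[of "t * u"] cos_ge_minus_one[of "t * u"] by auto
  show ?thesis
  proof (cases "\<bar>t\<bar> \<le> T")
    case True
    define r where "r = cmod (char F t)"
    have "r\<^sup>2 \<le> 1 - c * t\<^sup>2" using char_small[OF True] by (simp add: r_def)
    also have "\<dots> \<le> exp (- (c * t\<^sup>2))" using exp_ge_add_one_self[of "- (c * t\<^sup>2)"] by simp
    also have "\<dots> = (exp (- (c * t\<^sup>2) / 2))\<^sup>2" by (simp add: power2_eq_square mult_exp_exp)
    finally have "r \<le> exp (- (c * t\<^sup>2) / 2)" by (rule power2_le_imp_le) simp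
    then have "r ^ n \<le> exp (- (c * t\<^sup>2) / 2) ^ n" by (rule power_mono) (simp add: r_def)
    also have "\<dots> = exp (- (c * n * t\<^sup>2 / 2))" by (simp add: exp_of_nat_mult[symmetric] mult_ac)
    finally have r: "r ^ n \<le> exp (- (c * n * t\<^sup>2 / 2))" .
    have "1 - cos (t * u) \<le> t\<^sup>2 / 2"
    proof -
      have "(sin (t * u / 2))\<^sup>2 \<le> (t * u / 2)\<^sup>2"
        using abs_sin_x_le_abs_x[of "t * u / 2"] by (subst abs_le_square_iff[symmetric])
      then have "1 - (t * u)\<^sup>2 / 2 \<le> cos (t * u)"
        using cos_double_sin[of "t * u / 2"] by (simp add: power_divide)
      moreover have "(t * u)\<^sup>2 \<le> t\<^sup>2"
        using u by (simp add: power_mult_distrib mult_left_le abs_square_le_1)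
      ultimately show ?thesis by simp
    qed
    then have "(1 - cos (t * u)) * r ^ n \<le> t\<^sup>2 / 2 * exp (- (c * n * t\<^sup>2 / 2))"
      using r cos by (intro mult_mono) (auto simp: r_def)
    also have "\<dots> = 1 / (c * n) * (c * n * t\<^sup>2 / 2 * exp (- (c * n * t\<^sup>2 / 2)))"
      using pos n by simp
    also have "\<dots> \<le> 1 / (c * n) * 1"
    proof (rule mult_left_mono)
      have "y * exp (- y) \<le> 1" for y :: real
      proof -
        have "y \<le> exp y" using exp_ge_add_one_self[of y] by linarith
        then show ?thesis by (simp add: exp_minus field_simps)
      qed
      then show "c * n * t\<^sup>2 / 2 * exp (- (c * n * t\<^sup>2 / 2)) \<le> 1" .
    qed (use pos in auto)
    also have "\<dots> \<le> 1 / (c * n) * indicator {-T..T} t + 2 * \<rho> ^ n"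
      using True pos by (auto simp: indicator_def)
    finally show ?thesis by (simp add: char_walk_law norm_power r_def)
  next
    case False
    have "(1 - cos (t * u)) * cmod (char F t) ^ n \<le> 2 * \<rho> ^ n"
      using cos char_large[of t] False by (intro mult_mono power_mono) auto
    then show ?thesis using pos by (simp add: char_walk_law norm_power add_increasing indicator_def)
  qed
qed

text \<open>Almost a mean-value inequality: a value of the density is traded for the values at
  distance \<open>u\<close> on both sides, which may then be averaged over \<open>u\<close>.\<close>

lemma smoothed_density_average:
  assumes n: "n \<ge> 1" and w: "w > 0" and u: "\<bar>u\<bar> \<le> 1"
  defines "q \<equiv> smoothed_density (walk_law F n) w"
  shows "q x \<le> (q (x - u) + q (x + u)) / 2 + smoothing_error n w"
proof -
  interpret N: real_distribution "walk_law F n" by (rule real_distribution_walk_law)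
  let ?e = "\<lambda>t. exp (- (w\<^sup>2 * t\<^sup>2) / 2)"
  note e = gaussian_integral[OF w]
  have int: "integrable lborel (\<lambda>t. 1 / (c * n) * indicator {-T..T} t + 2 * \<rho> ^ n * ?e t)"
    using e(1) by (intro Bochner_Integration.integrable_add integrable_mult_right integrable_real_indicator)
       (auto simp: emeasure_lborel_Icc_eq)
  have le: "(1 - cos (t * u)) * ?e t * cmod (char (walk_law F n) t)
    \<le> 1 / (c * n) * indicator {-T..T} t + 2 * \<rho> ^ n * ?e t" for t
  proof -
    have "(1 - cos (t * u)) * ?e t * cmod (char (walk_law F n) t)
      = (1 - cos (t * u)) * cmod (char (walk_law F n) t) * ?e t" by simp
    also have "\<dots> \<le> (1 / (c * n) * indicator {-T..T} t + 2 * \<rho> ^ n) * ?e t"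
      by (intro mult_right_mono char_walk_law_weight_le n u) simp
    also have "\<dots> \<le> 1 / (c * n) * indicator {-T..T} t + 2 * \<rho> ^ n * ?e t"
    proof -
      have "1 / (c * n) * indicator {-T..T} t * ?e t \<le> 1 / (c * n) * indicator {-T..T} t * 1"
        using pos by (intro mult_left_mono) auto
      then show ?thesis by (simp add: distrib_right)
    qed
    finally show ?thesis .
  qed
  have "2 * q x - q (x - u) - q (x + u)
    \<le> 1 / pi * (\<integral>t. (1 - cos (t * u)) * ?e t * cmod (char (walk_law F n) t) \<partial>lborel)"
    unfolding q_def by (rule N.smoothed_density_second_difference[OF w])
  also have "\<dots> \<le> 1 / pi * (\<integral>t. 1 / (c * n) * indicator {-T..T} t + 2 * \<rho> ^ n * ?e t \<partial>lborel)"
  proof (intro mult_left_mono integral_mono le int)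
    show "integrable lborel (\<lambda>t. (1 - cos (t * u)) * ?e t * cmod (char (walk_law F n) t))"
      by (rule Bochner_Integration.integrable_bound[OF int])
         (use le in \<open>auto simp: abs_mult intro!: AE_I2 order_trans[OF _ abs_ge_self]\<close>)
  qed auto
  also have "(\<integral>t. 1 / (c * n) * indicator {-T..T} t + 2 * \<rho> ^ n * ?e t \<partial>lborel)
    = 2 * T / (c * n) + 2 * \<rho> ^ n * (sqrt (2 * pi) / w)"
    using e pos by (subst Bochner_Integration.integral_add) auto
  also have "1 / pi * (2 * T / (c * n) + 2 * \<rho> ^ n * (sqrt (2 * pi) / w)) = 2 * smoothing_error n w"
    unfolding smoothing_error_def by (simp only: times_divide_eq_right mult_1_left mult_divide_mult_cancel_left_if) simp
  finally show ?thesis by (simp add: field_simps)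
qed

section \<open>Averaging the starting point over unit windows\<close>

definition block_const :: real where
  "block_const = exp (3 * s) * (K / \<eta>)"

lemma block_const_pos: "block_const > 0"
  using trunc_le_K pos by (simp add: block_const_def)

text \<open>Length 3 accommodates \<open>[0, 2 * w]\<close> with \<open>w \<le> 1\<close>, moved by
  at most 1.\<close>

lemma green_interval_le_block_const:
  assumes "w \<le> 3" "d \<ge> 0"
  shows "green F (indicator {0..w}) d \<le> ennreal block_const"
proof -
  have "green F (indicator {0..w}) d \<le> green F (indicator {0..3}) d"
    using assms by (intro green_mono) (auto simp: indicator_def)
  also have "\<dots> \<le> ennreal block_const"
    using green_interval_crude[OF assms(2), of 3] by (simp add: block_const_def mult.commute)
  finally show ?thesis .
qed

text \<open>The origin of linearity in \<open>w\<close>: while the target interval moves through a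
  unit range, it covers each point for a set of shifts of measure at most
  \<open>2 * w\<close>.\<close>

lemma green_interval_moving_average:
  assumes w: "0 \<le> w" "w \<le> 1" and x: "x \<ge> 0"
  shows "(\<integral>\<^sup>+u. indicator {0..1} u * green F (\<lambda>d. indicator {0..2 * w} (d - u)) x \<partial>lborel)
    \<le> ennreal (2 * w * block_const)"
proof -
  have "(\<integral>\<^sup>+u. indicator {0..1} u * green F (\<lambda>d. indicator {0..2 * w} (d - u)) x \<partial>lborel)
    = (\<integral>\<^sup>+u. green F (\<lambda>d. indicator {0..1} u * indicator {0..2 * w} (d - u)) x \<partial>lborel)"
    by (simp add: green_cmult)
  also have "\<dots> = green F (\<lambda>d. \<integral>\<^sup>+u. indicator {0..1} u * indicator {0..2 * w} (d - u) \<partial>lborel) x"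
    by (rule green_nn_integral[symmetric]) (auto intro: sigma_finite_lborel simp: split_beta' indicator_def)
  also have "\<dots> \<le> green F (\<lambda>d. ennreal (2 * w) * indicator {0..3} d) x"
  proof (rule green_mono[OF _ x])
    fix d :: real assume d: "d \<ge> 0"
    have "(\<integral>\<^sup>+u. indicator {0..1} u * indicator {0..2 * w} (d - u) \<partial>lborel)
      \<le> (\<integral>\<^sup>+u. indicator {0..3} d * indicator {d - 2 * w..d} u \<partial>lborel)"
      using d w by (intro nn_integral_mono) (auto simp: indicator_def)
    also have "\<dots> = indicator {0..3} d * ennreal (2 * w)"
      using w by (simp add: nn_integral_cmult)
    finally show "(\<integral>\<^sup>+u. indicator {0..1} u * indicator {0..2 * w} (d - u) \<partial>lborel)
      \<le> ennreal (2 * w) * indicator {0..3} d" by (simp add: mult.commute)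
  qed
  also have "\<dots> = ennreal (2 * w) * green F (indicator {0..3}) x" by (simp add: green_cmult)
  also have "\<dots> \<le> ennreal (2 * w) * ennreal block_const"
    by (intro mult_left_mono green_interval_le_block_const x) auto
  finally show ?thesis using w by (simp add: ennreal_mult')
qed

text \<open>The killed walk may start at a negative distance and jump back, so the restriction to
  \<open>y \<ge> 0\<close> is not automatic.\<close>

definition visits :: "real \<Rightarrow> real \<Rightarrow> ennreal" where
  "visits w y = green F (indicator {0..w}) y * indicator {0..} y"

lemma visits_measurable [measurable]: "visits w \<in> borel_measurable borel"
  unfolding visits_def[abs_def] by measurable

text \<open>By \<open>green_shift\<close>, a start at \<open>x - u\<close> is replaced by a start at
  \<open>x\<close> with a moved target, so the target is averaged instead of the start.\<close>

lemma visits_average_left: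
  assumes w: "0 \<le> w" "w \<le> 1"
  shows "(\<integral>\<^sup>+u. indicator {0..1} u * visits (2 * w) (x + (-1) * u) \<partial>lborel) \<le> ennreal (2 * w * block_const)"
proof (cases "x \<ge> 0")
  case True
  have "(\<integral>\<^sup>+u. indicator {0..1} u * visits (2 * w) (x + (-1) * u) \<partial>lborel)
    \<le> (\<integral>\<^sup>+u. indicator {0..1} u * green F (\<lambda>d. indicator {0..2 * w} (d - u)) x \<partial>lborel)"
  proof (rule nn_integral_mono)
    fix u
    show "indicator {0..1} u * visits (2 * w) (x + (-1) * u)
      \<le> indicator {0..1} u * green F (\<lambda>d. indicator {0..2 * w} (d - u)) x"
      using green_shift[of u "indicator {0..2 * w}" "x - u"] by (auto simp: indicator_def visits_def)
  qed
  also note green_interval_moving_average[OF w True]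
  finally show ?thesis .
next
  case False
  then have z: "indicator {0..1} u * visits (2 * w) (x + (-1) * u) = 0" for u
    by (auto simp: visits_def indicator_def)
  show ?thesis unfolding z by simp
qed

text \<open>Reflecting \<open>u\<close> to \<open>1 - u\<close> turns the window to the right of
  \<open>x\<close> into the one to the left of \<open>x + 1\<close>.\<close>

lemma visits_average_right:
  assumes w: "0 \<le> w" "w \<le> 1"
  shows "(\<integral>\<^sup>+u. indicator {0..1} u * visits (2 * w) (x + 1 * u) \<partial>lborel) \<le> ennreal (2 * w * block_const)"
proof -
  have "(\<integral>\<^sup>+u. indicator {0..1} u * visits (2 * w) (x + 1 * u) \<partial>lborel)
    = (\<integral>\<^sup>+u. indicator {0..1} (1 + (-1) * u) * visits (2 * w) (x + 1 * (1 + (-1) * u)) \<partial>lborel)"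
    by (subst nn_integral_real_affine[where c = "-1" and t = 1]) auto
  also have "\<dots> = (\<integral>\<^sup>+u. indicator {0..1} u * visits (2 * w) ((x + 1) + (-1) * u) \<partial>lborel)"
    by (intro nn_integral_cong) (auto simp: indicator_def algebra_simps)
  also note visits_average_left[OF w]
  finally show ?thesis .
qed

text \<open>Extending the block by 1 on the left makes it cover the original block after every shift
  \<open>u\<close> in \<open>[0, 1]\<close>; averaging over \<open>u\<close> then leaves unit
  windows only.\<close>

lemma visits_block:
  assumes w: "0 \<le> w" "w \<le> 1" and b: "b \<ge> 0"
  shows "(\<integral>\<^sup>+y. visits (2 * w) y * indicator {0..2 * b + 1} y \<partial>lborel)
    \<le> ennreal (2 * w * block_const * (2 * b + 2))"
proof -
  let ?g = "indicator {-1..2 * b + 1} :: real \<Rightarrow> ennreal"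
  have "(\<integral>\<^sup>+y. visits (2 * w) y * indicator {0..2 * b + 1} y \<partial>lborel)
    = (\<integral>\<^sup>+u. indicator {0..1::real} u * (\<integral>\<^sup>+y. visits (2 * w) y * indicator {0..2 * b + 1} y \<partial>lborel) \<partial>lborel)"
    by (simp add: nn_integral_multc)
  also have "\<dots> \<le> (\<integral>\<^sup>+u. indicator {0..1} u * (\<integral>\<^sup>+y. visits (2 * w) y * ?g (y - 1 * u) \<partial>lborel) \<partial>lborel)"
  proof (rule nn_integral_mono)
    fix u :: real
    show "indicator {0..1} u * (\<integral>\<^sup>+y. visits (2 * w) y * indicator {0..2 * b + 1} y \<partial>lborel)
      \<le> indicator {0..1} u * (\<integral>\<^sup>+y. visits (2 * w) y * ?g (y - 1 * u) \<partial>lborel)"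
      by (cases "u \<in> {0..1}") (auto intro!: nn_integral_mono mult_left_mono simp: indicator_def)
  qed
  also have "\<dots> \<le> ennreal (2 * w * block_const) * (\<integral>\<^sup>+y. ?g y \<partial>lborel)"
    by (rule average_translate) (use visits_average_right[OF w] in auto)
  also have "(\<integral>\<^sup>+y. ?g y \<partial>lborel) = ennreal (2 * b + 2)" using b by simp
  also have "ennreal (2 * w * block_const) * ennreal (2 * b + 2) = ennreal (2 * w * block_const * (2 * b + 2))"
    using w block_const_pos by (intro ennreal_mult'[symmetric]) simp
  finally show ?thesis .
qed

text \<open>The density is replaced by its values at shifts \<open>u\<close> and \<open>- u\<close>
  plus an error. After averaging over \<open>u\<close> the shifts pass to \<open>V\<close>, whose
  unit averages are at most \<open>J\<close>, while the total mass 1 of the density is kept. The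
  cutoff at \<open>2 * b + 1\<close> confines the error to a block of length of order
  \<open>b\<close>.\<close>

lemma visits_smoothed:
  assumes n: "n \<ge> 1" and w: "0 < w" "w \<le> 1" and b: "b \<ge> 0"
  shows "(\<integral>\<^sup>+y. visits (2 * w) y * indicator {0..2 * b + 1} y
          * ennreal (smoothed_density (walk_law F n) w (b - y)) \<partial>lborel)
    \<le> ennreal (2 * w * block_const * (1 + smoothing_error n w * (2 * b + 2)))"
proof -
  interpret N: real_distribution "walk_law F n" by (rule real_distribution_walk_law)
  define q where "q = smoothed_density (walk_law F n) w"
  define V where "V = visits (2 * w)"
  define J where "J = 2 * w * block_const"
  have J0: "J \<ge> 0" using w block_const_pos by (simp add: J_def)
  define E where "E = smoothing_error n w"
  have E0: "E \<ge> 0" using pos w by (simp add: E_def smoothing_error_def)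
  have q0: "q x \<ge> 0" for x unfolding q_def by (rule N.smoothed_density_nonneg)
  have [measurable]: "V \<in> borel_measurable borel" "q \<in> borel_measurable borel"
    unfolding V_def q_def by measurable
  define g where "g = (\<lambda>y. ennreal (q (b - y)))"
  have [measurable]: "g \<in> borel_measurable borel" unfolding g_def by measurable
  have "(\<integral>\<^sup>+y. g y \<partial>lborel) = (\<integral>\<^sup>+x. q x \<partial>lborel)"
    unfolding g_def by (subst nn_integral_real_affine[where c = "-1" and t = b]) auto
  then have g1: "(\<integral>\<^sup>+y. g y \<partial>lborel) = 1"
    unfolding q_def using N.nn_integral_smoothed_density[OF w(1)] by simp
  let ?I = "indicator {0..1} :: real \<Rightarrow> ennreal"
  have V_block: "(\<integral>\<^sup>+y. V y * indicator {0..2 * b + 1} y \<partial>lborel) \<le> ennreal (J * (2 * b + 2))"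
    unfolding V_def J_def using w by (intro visits_block b) auto
  have half: "ennreal (1 / 2) + ennreal (1 / 2) = 1" by (subst ennreal_plus[symmetric]) auto
  have "(\<integral>\<^sup>+y. V y * indicator {0..2 * b + 1} y * g y \<partial>lborel)
    = (\<integral>\<^sup>+u. ?I u * (\<integral>\<^sup>+y. V y * indicator {0..2 * b + 1} y * g y \<partial>lborel) \<partial>lborel)"
    by (simp add: nn_integral_multc)
  also have "\<dots> \<le> (\<integral>\<^sup>+u. ennreal (1 / 2) * (?I u * (\<integral>\<^sup>+y. V y * g (y - 1 * u) \<partial>lborel))
      + ennreal (1 / 2) * (?I u * (\<integral>\<^sup>+y. V y * g (y - (-1) * u) \<partial>lborel))
      + ?I u * ennreal (E * (J * (2 * b + 2))) \<partial>lborel)"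
  proof (rule nn_integral_mono)
    fix u :: real
    show "?I u * (\<integral>\<^sup>+y. V y * indicator {0..2 * b + 1} y * g y \<partial>lborel)
      \<le> ennreal (1 / 2) * (?I u * (\<integral>\<^sup>+y. V y * g (y - 1 * u) \<partial>lborel))
      + ennreal (1 / 2) * (?I u * (\<integral>\<^sup>+y. V y * g (y - (-1) * u) \<partial>lborel))
      + ?I u * ennreal (E * (J * (2 * b + 2)))"
    proof (cases "u \<in> {0..1}")
      case True
      have "(\<integral>\<^sup>+y. V y * indicator {0..2 * b + 1} y * g y \<partial>lborel)
        \<le> (\<integral>\<^sup>+y. ennreal (1 / 2) * (V y * g (y - u)) + ennreal (1 / 2) * (V y * g (y + u))
            + ennreal E * (V y * indicator {0..2 * b + 1} y) \<partial>lborel)"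
      proof (rule nn_integral_mono)
        fix y
        have "g y \<le> ennreal ((q (b - y - u) + q (b - y + u)) / 2 + E)"
          unfolding g_def q_def E_def using True w n
          by (intro ennreal_leI smoothed_density_average) auto
        also have "\<dots> = ennreal (1 / 2 * q (b - (y - u)) + 1 / 2 * q (b - (y + u)) + E)"
          by (simp add: algebra_simps add_divide_distrib)
        also have "\<dots> = ennreal (1 / 2) * g (y - u) + ennreal (1 / 2) * g (y + u) + ennreal E"
          unfolding g_def using q0 E0 by (simp add: ennreal_plus ennreal_mult' del: times_divide_eq_left)
        finally have gy: "g y \<le> ennreal (1 / 2) * g (y - u) + ennreal (1 / 2) * g (y + u) + ennreal E" .
        show "V y * indicator {0..2 * b + 1} y * g y
          \<le> ennreal (1 / 2) * (V y * g (y - u)) + ennreal (1 / 2) * (V y * g (y + u))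
            + ennreal E * (V y * indicator {0..2 * b + 1} y)"
        proof (cases "y \<in> {0..2 * b + 1}")
          case True
          then show ?thesis using mult_left_mono[OF gy, of "V y"] by (simp add: algebra_simps)
        qed auto
      qed
      also have "\<dots> = ennreal (1 / 2) * (\<integral>\<^sup>+y. V y * g (y - u) \<partial>lborel)
          + ennreal (1 / 2) * (\<integral>\<^sup>+y. V y * g (y + u) \<partial>lborel)
          + ennreal E * (\<integral>\<^sup>+y. V y * indicator {0..2 * b + 1} y \<partial>lborel)"
        by (simp add: nn_integral_add nn_integral_cmult)
      also have "\<dots> \<le> ennreal (1 / 2) * (\<integral>\<^sup>+y. V y * g (y - u) \<partial>lborel)
          + ennreal (1 / 2) * (\<integral>\<^sup>+y. V y * g (y + u) \<partial>lborel)
          + ennreal E * ennreal (J * (2 * b + 2))"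
        by (intro add_left_mono mult_left_mono V_block) auto
      also have "ennreal E * ennreal (J * (2 * b + 2)) = ennreal (E * (J * (2 * b + 2)))"
        using E0 by (simp add: ennreal_mult')
      finally show ?thesis using True by simp
    qed auto
  qed
  also have "\<dots> = ennreal (1 / 2) * (\<integral>\<^sup>+u. ?I u * (\<integral>\<^sup>+y. V y * g (y - 1 * u) \<partial>lborel) \<partial>lborel)
      + ennreal (1 / 2) * (\<integral>\<^sup>+u. ?I u * (\<integral>\<^sup>+y. V y * g (y - (-1) * u) \<partial>lborel) \<partial>lborel)
      + ennreal (E * (J * (2 * b + 2)))"
    by (simp add: nn_integral_add nn_integral_cmult nn_integral_multc)
  also have "\<dots> \<le> ennreal (1 / 2) * (ennreal J * (\<integral>\<^sup>+x. g x \<partial>lborel))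
      + ennreal (1 / 2) * (ennreal J * (\<integral>\<^sup>+x. g x \<partial>lborel)) + ennreal (E * (J * (2 * b + 2)))"
    unfolding V_def J_def using w visits_average_left[of w] visits_average_right[of w]
    by (intro add_mono mult_left_mono average_translate) auto
  also have "\<dots> = ennreal J + ennreal (E * (J * (2 * b + 2)))"
    by (simp only: g1 mult_1_right distrib_right[symmetric] half mult_1_left)
  also have "\<dots> = ennreal (J * (1 + E * (2 * b + 2)))"
    using J0 E0 b by (subst ennreal_plus[symmetric]) (auto simp: algebra_simps)
  finally show ?thesis by (simp add: V_def g_def q_def J_def E_def)
qed

text \<open>The reciprocal of the standard normal density at one standard deviation.\<close>

definition smoothing_const :: real where
  "smoothing_const = sqrt (2 * pi) * exp (1 / 2)"

lemma smoothing_const: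
  assumes "w > 0" "\<bar>x\<bar> \<le> w"
  shows "1 / w \<le> smoothing_const * normal_density 0 w x"
proof -
  have "x\<^sup>2 \<le> w\<^sup>2" using assms by (simp add: abs_le_square_iff[symmetric])
  then have "exp (- (1 / 2)) \<le> exp (- x\<^sup>2 / (2 * w\<^sup>2))" using assms by (simp add: field_simps)
  then have "exp (1 / 2) * exp (- (1 / 2)) \<le> exp (1 / 2) * exp (- x\<^sup>2 / (2 * w\<^sup>2))"
    by (intro mult_left_mono) auto
  then have "1 \<le> exp (1 / 2) * exp (- x\<^sup>2 / (2 * w\<^sup>2))" by (simp add: mult_exp_exp)
  then have "1 / w \<le> exp (1 / 2) * exp (- x\<^sup>2 / (2 * w\<^sup>2)) / w" using assms by (intro divide_right_mono) auto
  also have "\<dots> = smoothing_const * normal_density 0 w x"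
    using assms by (simp add: smoothing_const_def normal_density_def real_sqrt_mult)
  finally show ?thesis .
qed

text \<open>The smoothing is inserted by hand: by \<open>green_shift\<close>, the value at distance
  \<open>D\<close> is at most the value at any \<open>y\<close> in \<open>[D, D + w]\<close> with
  the interval doubled. The uniform average over these \<open>y\<close> is dominated by a Gaussian
  one, and integrating over \<open>z\<close> produces the smoothed density of the walk.\<close>

lemma green_interval_middle:
  assumes n: "n \<ge> 1" and w: "0 < w" "w \<le> 1" and b: "b \<ge> 0"
  shows "(\<integral>\<^sup>+z. green F (indicator {0..w}) (b - z) * indicator {-b..b} z \<partial>walk_law F n)
    \<le> ennreal (smoothing_const * (2 * w * block_const * (1 + smoothing_error n w * (2 * b + 2))))"
proof -
  interpret N: real_distribution "walk_law F n" by (rule real_distribution_walk_law)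
  interpret P: pair_sigma_finite "walk_law F n" lborel ..
  have S0: "smoothing_const \<ge> 0" by (simp add: smoothing_const_def)
  let ?V = "\<lambda>y. visits (2 * w) y * indicator {0..2 * b + 1} y"
  have "(\<integral>\<^sup>+z. green F (indicator {0..w}) (b - z) * indicator {-b..b} z \<partial>walk_law F n)
    \<le> (\<integral>\<^sup>+z. \<integral>\<^sup>+y. ?V y * (ennreal smoothing_const * ennreal (normal_density 0 w (b - y - z))) \<partial>lborel \<partial>walk_law F n)"
  proof (rule nn_integral_mono)
    fix z
    show "green F (indicator {0..w}) (b - z) * indicator {-b..b} z
      \<le> (\<integral>\<^sup>+y. ?V y * (ennreal smoothing_const * ennreal (normal_density 0 w (b - y - z))) \<partial>lborel)"
    proof (cases "z \<in> {-b..b}")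
      case True
      define D where "D = b - z"
      have D: "0 \<le> D" "D \<le> 2 * b" using True by (auto simp: D_def)
      have "green F (indicator {0..w}) D = (\<integral>\<^sup>+y. green F (indicator {0..w}) D * ennreal (1 / w) * indicator {D..D + w} y \<partial>lborel)"
        using w by (subst nn_integral_cmult) (auto simp: mult.assoc ennreal_mult'[symmetric])
      also have "\<dots> \<le> (\<integral>\<^sup>+y. ?V y * (ennreal smoothing_const * ennreal (normal_density 0 w (b - y - z))) \<partial>lborel)"
      proof (rule nn_integral_mono)
        fix y
        show "green F (indicator {0..w}) D * ennreal (1 / w) * indicator {D..D + w} y
          \<le> ?V y * (ennreal smoothing_const * ennreal (normal_density 0 w (b - y - z)))"
        proof (cases "y \<in> {D..D + w}")
          case y: True
          have "green F (indicator {0..w}) D \<le> green F (\<lambda>d. indicator {0..w} (d - (y - D))) (D + (y - D))"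
            using y by (intro green_shift) auto
          also have "\<dots> \<le> green F (indicator {0..2 * w}) (D + (y - D))"
            using y D by (intro green_mono) (auto simp: indicator_def)
          also have "\<dots> = ?V y" using y D w by (simp add: visits_def)
          finally have "green F (indicator {0..w}) D \<le> ?V y" .
          moreover have "ennreal (1 / w) \<le> ennreal (smoothing_const * normal_density 0 w (b - y - z))"
            using y w by (intro ennreal_leI smoothing_const) (auto simp: D_def)
          ultimately show ?thesis using y S0
            by (simp add: ennreal_mult') (intro mult_mono, auto)
        qed auto
      qed
      finally show ?thesis using True by (simp add: D_def)
    qed auto
  qed
  also have "\<dots> = (\<integral>\<^sup>+y. \<integral>\<^sup>+z. ?V y * (ennreal smoothing_const * ennreal (normal_density 0 w (b - y - z))) \<partial>walk_law F n \<partial>lborel)"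
    by (rule P.Fubini'[symmetric]) (simp add: split_beta' indicator_def)
  also have "\<dots> = (\<integral>\<^sup>+y. ennreal smoothing_const * (?V y * ennreal (smoothed_density (walk_law F n) w (b - y))) \<partial>lborel)"
  proof (rule nn_integral_cong)
    fix y
    have "(\<integral>\<^sup>+z. ?V y * (ennreal smoothing_const * ennreal (normal_density 0 w (b - y - z))) \<partial>walk_law F n)
      = ?V y * (ennreal smoothing_const * (\<integral>\<^sup>+z. ennreal (normal_density 0 w (b - y - z)) \<partial>walk_law F n))"
      by (subst nn_integral_cmult, measurable) (subst nn_integral_cmult, measurable)
    then show "(\<integral>\<^sup>+z. ?V y * (ennreal smoothing_const * ennreal (normal_density 0 w (b - y - z))) \<partial>walk_law F n)
      = ennreal smoothing_const * (?V y * ennreal (smoothed_density (walk_law F n) w (b - y)))"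
      unfolding N.ennreal_smoothed_density[OF w(1)] by (simp only: mult.left_commute)
  qed
  also have "\<dots> = ennreal smoothing_const * (\<integral>\<^sup>+y. ?V y * ennreal (smoothed_density (walk_law F n) w (b - y)) \<partial>lborel)"
    by (rule nn_integral_cmult) measurable
  also have "\<dots> \<le> ennreal smoothing_const * ennreal (2 * w * block_const * (1 + smoothing_error n w * (2 * b + 2)))"
    by (intro mult_left_mono visits_smoothed n w b) auto
  finally show ?thesis using S0 by (simp add: ennreal_mult')
qed

section \<open>Splitting at a time proportional to the distance\<close>

lemma early_visits:
  assumes w: "w \<le> 1" and "b \<ge> 0"
  shows "(\<Sum>i<n. (killed_step F ^^ i) (indicator {0..w}) b) \<le> ennreal (n * (exp s * (M ^ n * exp (- s * b))))"
proof -
  have "(killed_step F ^^ i) (indicator {0..w}) b \<le> ennreal (exp s * (M ^ n * exp (- s * b)))" if i: "i < n" for i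
  proof -
    have "(killed_step F ^^ i) (indicator {0..w}) b
      \<le> (killed_step F ^^ i) (\<lambda>d. ennreal (exp s) * ennreal (exp (- s * d))) b"
    proof (rule killed_steps_mono[OF _ \<open>b \<ge> 0\<close>])
      fix d :: real
      have "1 \<le> ennreal (exp s) * ennreal (exp (- s * d))" if "d \<le> w"
      proof -
        have "s * d \<le> s * 1" using that w pos by (intro mult_left_mono) auto
        then show ?thesis by (simp add: ennreal_mult[symmetric] mult_exp_exp)
      qed
      then show "indicator {0..w} d \<le> ennreal (exp s) * ennreal (exp (- s * d))"
        by (auto simp: indicator_def)
    qed
    also have "\<dots> = ennreal (exp s) * (killed_step F ^^ i) (\<lambda>d. ennreal (exp (- s * d))) b"
      by (subst killed_steps_cmult) auto
    also have "\<dots> \<le> ennreal (exp s) * ennreal (M ^ i * exp (- s * b))"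
      by (intro mult_left_mono exp_killed_steps) auto
    also have "\<dots> = ennreal (exp s * (M ^ i * exp (- s * b)))" by (simp add: ennreal_mult')
    also have "\<dots> \<le> ennreal (exp s * (M ^ n * exp (- s * b)))"
      using i pos by (intro ennreal_leI mult_left_mono mult_right_mono power_increasing) auto
    finally show ?thesis .
  qed
  then have "(\<Sum>i<n. (killed_step F ^^ i) (indicator {0..w}) b)
    \<le> (\<Sum>i<n. ennreal (exp s * (M ^ n * exp (- s * b))))" by (intro sum_mono) auto
  also have "\<dots> = ennreal (n * (exp s * (M ^ n * exp (- s * b))))"
    using pos by (simp add: ennreal_mult ennreal_of_nat_eq_real_of_nat)
  finally show ?thesis .
qed

text \<open>The left tail of the law after \<open>n\<close> steps may be heavy; started from there, the walk is even
  further away from the boundary, so this part is absorbed into the supremum on the left.\<close>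

lemma green_interval_recursion:
  assumes n: "n \<ge> 1" "2 * m * n \<le> b" and w: "0 < w" "w \<le> 1" and b: "b > 0"
    and S: "\<And>d. d \<ge> b \<Longrightarrow> green F (indicator {0..w}) d \<le> S"
  shows "green F (indicator {0..w}) b \<le> ennreal (1 / 2) * S
    + ennreal (smoothing_const * (2 * w * block_const * (1 + smoothing_error n w * (2 * b + 2)))
        + n * (exp s * (M ^ n * exp (- s * b))))"
proof -
  let ?v = "green F (indicator {0..w})"
  let ?X = "smoothing_const * (2 * w * block_const * (1 + smoothing_error n w * (2 * b + 2)))"
  let ?Y = "n * (exp s * (M ^ n * exp (- s * b)))"
  have X0: "?X \<ge> 0" using w b block_const_pos pos by (simp add: smoothing_const_def smoothing_error_def)
  have "(killed_step F ^^ n) ?v b \<le> (\<integral>\<^sup>+z. ?v (b - z) * indicator {..b} z \<partial>walk_law F n)"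
    using b by (intro killed_steps_le_walk_law) auto
  also have "\<dots> \<le> (\<integral>\<^sup>+z. S * indicator {..< -b} z + ?v (b - z) * indicator {-b..b} z \<partial>walk_law F n)"
    by (rule nn_integral_mono) (auto simp: indicator_def intro!: S)
  also have "\<dots> = S * emeasure (walk_law F n) {..< -b} + (\<integral>\<^sup>+z. ?v (b - z) * indicator {-b..b} z \<partial>walk_law F n)"
  proof -
    interpret N: real_distribution "walk_law F n" by (rule real_distribution_walk_law)
    show ?thesis by (subst nn_integral_add) (auto simp: nn_integral_cmult)
  qed
  also have "\<dots> \<le> S * ennreal (1 / 2) + ennreal ?X"
    using b n w by (intro add_mono mult_left_mono walk_law_left_tail green_interval_middle) auto
  finally have "(killed_step F ^^ n) ?v b \<le> S * ennreal (1 / 2) + ennreal ?X" .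
  moreover have "?v b = (\<Sum>i<n. (killed_step F ^^ i) (indicator {0..w}) b) + (killed_step F ^^ n) ?v b"
    by (rule green_split) simp
  moreover have "(\<Sum>i<n. (killed_step F ^^ i) (indicator {0..w}) b) \<le> ennreal ?Y"
    using w b by (intro early_visits) auto
  ultimately have "?v b \<le> ennreal ?Y + (S * ennreal (1 / 2) + ennreal ?X)"
    by (simp add: add_mono)
  also have "\<dots> = ennreal (1 / 2) * S + ennreal (?X + ?Y)"
    using X0 pos by (subst ennreal_plus) (auto simp: ac_simps)
  finally show ?thesis .
qed

text \<open>Number of early steps per unit of distance. The first entry makes the left tail at most
  one half, the second keeps \<open>M ^ n\<close> below \<open>exp (s * b / 2)\<close>.\<close>

definition step_fraction :: real where
  "step_fraction = min (1 / (2 * m)) (s / (2 * ln M))"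

text \<open>Half of each of the two available exponents; the other half absorbs prefactors growing
  linearly in \<open>b\<close>.\<close>

definition rate :: real where
  "rate = min (s / 4) (- (step_fraction * ln \<rho>) / 2)"

definition lebesgue_const :: real where
  "lebesgue_const = smoothing_const * (2 * block_const * (1 + T / (pi * c) * (4 / step_fraction + 4)))"

definition tail_const :: real where
  "tail_const = smoothing_const * (2 * block_const * (sqrt (2 * pi) / (pi * \<rho>) * (2 / rate + 2)))
     + step_fraction * exp s / rate"

lemma step_fraction_pos: "step_fraction > 0"
  using pos by (simp add: step_fraction_def)

lemma rate_pos: "rate > 0"
  using pos step_fraction_pos ln_less_zero[of \<rho>] by (simp add: rate_def mult_pos_neg)

lemma smoothing_const_pos: "smoothing_const > 0"
  by (simp add: smoothing_const_def)

lemma lebesgue_const_pos: "lebesgue_const > 0"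
  using pos step_fraction_pos smoothing_const_pos block_const_pos
  by (auto simp: lebesgue_const_def intro!: mult_pos_pos add_pos_nonneg)

lemma tail_const_pos: "tail_const > 0"
  using pos step_fraction_pos smoothing_const_pos block_const_pos rate_pos
  unfolding tail_const_def by (intro add_pos_pos mult_pos_pos divide_pos_pos) auto

text \<open>The number of steps is comparable to \<open>b\<close>, so the low-frequency error 1 / n
  times the block length \<open>2 * b + 2\<close> is bounded and contributes to the term linear in
  \<open>w\<close>; all other errors decay exponentially in \<open>b\<close>.\<close>

lemma recursion_error_le:
  assumes b: "step_fraction * b \<ge> 1" and w: "0 < w" "w \<le> 1"
  defines "n \<equiv> nat \<lfloor>step_fraction * b\<rfloor>"
  shows "n \<ge> 1" "2 * m * n \<le> b"
    and "smoothing_const * (2 * w * block_const * (1 + smoothing_error n w * (2 * b + 2)))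
        + n * (exp s * (M ^ n * exp (- s * b))) \<le> lebesgue_const * w + tail_const * exp (- rate * b)"
proof -
  note e = step_fraction_pos
  have b0: "b > 0" using b e by (metis less_le_trans zero_less_mult_pos zero_less_one)
  have fl: "\<lfloor>step_fraction * b\<rfloor> \<ge> 1" using b by linarith
  show n1: "n \<ge> 1" unfolding n_def using fl by linarith
  have n_eq: "real n = of_int \<lfloor>step_fraction * b\<rfloor>" using fl by (simp add: n_def)
  have n_le: "real n \<le> step_fraction * b" unfolding n_eq by linarith
  have n_ge: "real n \<ge> step_fraction * b - 1" unfolding n_eq by linarith
  \<comment> \<open>Rounding down costs at most a factor 2, because \<open>n\<close> is at least
    1.\<close>
  have n_half: "2 * real n \<ge> step_fraction * b" using n1 n_ge by linarith
  have "2 * m * n \<le> 2 * m * (step_fraction * b)" using n_le pos by (intro mult_left_mono) auto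
  also have "\<dots> \<le> 2 * m * (1 / (2 * m) * b)"
    using pos b0 by (intro mult_left_mono mult_right_mono) (auto simp: step_fraction_def)
  finally show "2 * m * n \<le> b" using pos by simp
  have b_exp: "b * exp (- 2 * rate * b) \<le> 1 / rate * exp (- rate * b)"
  proof -
    have "rate * b \<le> exp (rate * b)" using exp_ge_add_one_self[of "rate * b"] by linarith
    then have "b \<le> 1 / rate * exp (rate * b)" using rate_pos by (simp add: field_simps)
    then have "b * exp (- 2 * rate * b) \<le> 1 / rate * exp (rate * b) * exp (- 2 * rate * b)"
      by (rule mult_right_mono) simp
    also have "\<dots> = 1 / rate * (exp (rate * b) * exp (- 2 * rate * b))" by simp
    also have "exp (rate * b) * exp (- 2 * rate * b) = exp (- rate * b)" by (simp add: mult_exp_exp)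
    finally show ?thesis .
  qed
  have one_exp: "exp (- 2 * rate * b) \<le> exp (- rate * b)" using rate_pos b0 by simp
  \<comment> \<open>The factor \<open>1 / \<rho>\<close> pays for rounding \<open>n\<close>
    down.\<close>
  have rho: "\<rho> ^ n \<le> 1 / \<rho> * exp (- 2 * rate * b)"
  proof -
    have "\<rho> ^ n = exp (real n * ln \<rho>)" using pos by (simp add: exp_of_nat_mult)
    also have "\<dots> \<le> exp ((step_fraction * b - 1) * ln \<rho>)"
      using n_ge pos by (simp add: mult_right_mono_neg)
    also have "(step_fraction * b - 1) * ln \<rho> \<le> - 2 * rate * b - ln \<rho>"
    proof -
      have "2 * rate * b \<le> 2 * (- (step_fraction * ln \<rho>) / 2) * b"
        using b0 by (intro mult_right_mono mult_left_mono) (auto simp: rate_def)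
      then show ?thesis by (simp add: algebra_simps)
    qed
    also have "exp (- 2 * rate * b - ln \<rho>) = 1 / \<rho> * exp (- 2 * rate * b)"
      using pos by (simp add: exp_diff)
    finally show ?thesis by simp
  qed
  have err: "w * (1 + smoothing_error n w * (2 * b + 2))
      \<le> (1 + T / (pi * c) * (4 / step_fraction + 4)) * w
        + sqrt (2 * pi) / (pi * \<rho>) * (2 / rate + 2) * exp (- rate * b)"
  proof -
    \<comment> \<open>The factor \<open>w\<close> cancels the \<open>1 / w\<close> of the
      high-frequency error, so the last summand is free of \<open>w\<close>.\<close>
    have "w * (1 + smoothing_error n w * (2 * b + 2))
      = w + w * (T / (pi * c)) * ((2 * b + 2) / n) + sqrt (2 * pi) / pi * (\<rho> ^ n * (2 * b + 2))"
      using w pos n1 by (simp add: smoothing_error_def field_simps)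
    also have "\<dots> \<le> w + w * (T / (pi * c)) * (4 / step_fraction + 4)
        + sqrt (2 * pi) / pi * (1 / \<rho> * ((2 / rate + 2) * exp (- rate * b)))"
    proof (intro add_mono mult_left_mono order_refl)
      have "(2 * b + 2) / n \<le> (2 * b + 2) / (step_fraction * b / 2)"
        using n_half b0 e n1 by (intro divide_left_mono) auto
      also have "\<dots> = 4 / step_fraction + 4 / (step_fraction * b)"
        using b0 e by (simp add: field_simps)
      also have "4 / (step_fraction * b) \<le> 4" using b b0 e by (simp add: field_simps)
      finally show "(2 * b + 2) / n \<le> 4 / step_fraction + 4" by simp
      have "\<rho> ^ n * (2 * b + 2) \<le> 1 / \<rho> * exp (- 2 * rate * b) * (2 * b + 2)"
        using rho b0 by (intro mult_right_mono) auto
      also have "\<dots> = 1 / \<rho> * (2 * (b * exp (- 2 * rate * b)) + 2 * exp (- 2 * rate * b))"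
        by (simp add: algebra_simps add_divide_distrib)
      also have "\<dots> \<le> 1 / \<rho> * (2 * (1 / rate * exp (- rate * b)) + 2 * exp (- rate * b))"
        using b_exp one_exp pos by (intro mult_left_mono add_mono) auto
      also have "\<dots> = 1 / \<rho> * ((2 / rate + 2) * exp (- rate * b))" by (simp add: algebra_simps)
      finally show "\<rho> ^ n * (2 * b + 2) \<le> 1 / \<rho> * ((2 / rate + 2) * exp (- rate * b))" .
    qed (use w pos in auto)
    also have "\<dots> = (1 + T / (pi * c) * (4 / step_fraction + 4)) * w
        + sqrt (2 * pi) / (pi * \<rho>) * (2 / rate + 2) * exp (- rate * b)"
      by (simp add: algebra_simps)
    finally show ?thesis .
  qed
  have "smoothing_const * (2 * w * block_const * (1 + smoothing_error n w * (2 * b + 2)))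
    = smoothing_const * 2 * block_const * (w * (1 + smoothing_error n w * (2 * b + 2)))" by simp
  also have "\<dots> \<le> smoothing_const * 2 * block_const * ((1 + T / (pi * c) * (4 / step_fraction + 4)) * w
        + sqrt (2 * pi) / (pi * \<rho>) * (2 / rate + 2) * exp (- rate * b))"
    using err smoothing_const_pos block_const_pos by (intro mult_left_mono) auto
  finally have X: "smoothing_const * (2 * w * block_const * (1 + smoothing_error n w * (2 * b + 2)))
    \<le> smoothing_const * 2 * block_const * ((1 + T / (pi * c) * (4 / step_fraction + 4)) * w
        + sqrt (2 * pi) / (pi * \<rho>) * (2 / rate + 2) * exp (- rate * b))" .
  have "M ^ n * exp (- s * b) \<le> exp (- 2 * rate * b)"
  proof -
    have lnM: "ln M > 0" using pos by simp
    have "M ^ n = exp (real n * ln M)" using pos by (simp add: exp_of_nat_mult)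
    also have "\<dots> \<le> exp (step_fraction * b * ln M)" using n_le lnM by simp
    finally have "M ^ n * exp (- s * b) \<le> exp (step_fraction * b * ln M) * exp (- s * b)"
      by (rule mult_right_mono) simp
    also have "\<dots> = exp (step_fraction * b * ln M - s * b)" by (simp add: mult_exp_exp)
    also have "step_fraction * b * ln M - s * b \<le> - 2 * rate * b"
    proof -
      have "step_fraction * b * ln M \<le> s / (2 * ln M) * b * ln M"
        using lnM b0 by (intro mult_right_mono) (auto simp: step_fraction_def)
      also have "\<dots> = s / 2 * b" using lnM by simp
      finally have 1: "step_fraction * b * ln M \<le> s / 2 * b" .
      have "2 * rate * b \<le> s / 2 * b" using b0 by (intro mult_right_mono) (auto simp: rate_def)
      with 1 show ?thesis by simp
    qed
    finally show ?thesis by simp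
  qed
  then have "n * (exp s * (M ^ n * exp (- s * b))) \<le> (step_fraction * b) * (exp s * exp (- 2 * rate * b))"
    using n_le pos e b0 by (intro mult_mono) auto
  also have "\<dots> = step_fraction * exp s * (b * exp (- 2 * rate * b))" by simp
  also have "\<dots> \<le> step_fraction * exp s * (1 / rate * exp (- rate * b))"
    using b_exp e by (intro mult_left_mono) auto
  finally have Y: "n * (exp s * (M ^ n * exp (- s * b)))
    \<le> step_fraction * exp s * (1 / rate * exp (- rate * b))" .
  have "smoothing_const * (2 * w * block_const * (1 + smoothing_error n w * (2 * b + 2)))
        + n * (exp s * (M ^ n * exp (- s * b)))
    \<le> smoothing_const * 2 * block_const * ((1 + T / (pi * c) * (4 / step_fraction + 4)) * w
        + sqrt (2 * pi) / (pi * \<rho>) * (2 / rate + 2) * exp (- rate * b))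
      + step_fraction * exp s * (1 / rate * exp (- rate * b))"
    using X Y by (rule add_mono)
  also have "\<dots> = lebesgue_const * w + tail_const * exp (- rate * b)"
    unfolding lebesgue_const_def tail_const_def by (simp add: algebra_simps)
  finally show "smoothing_const * (2 * w * block_const * (1 + smoothing_error n w * (2 * b + 2)))
        + n * (exp s * (M ^ n * exp (- s * b))) \<le> lebesgue_const * w + tail_const * exp (- rate * b)" .
qed

text \<open>Passing to the supremum \<open>S\<close> over all distances at least \<open>b\<close>
  closes the recursion to \<open>S \<le> S / 2 + Z\<close>. The crude bound makes \<open>S\<close>
  finite, which is what permits subtracting \<open>S / 2\<close>.\<close>

lemma green_interval_small:
  assumes b: "step_fraction * b \<ge> 1" and w: "0 < w" "w \<le> 1"
  shows "green F (indicator {0..w}) b \<le> ennreal (2 * (lebesgue_const * w + tail_const * exp (- rate * b)))"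
proof -
  let ?v = "green F (indicator {0..w})"
  define S where "S = (SUP d\<in>{b..}. ?v d)"
  define Z where "Z = lebesgue_const * w + tail_const * exp (- rate * b)"
  have b0: "b > 0" using b step_fraction_pos by (metis less_le_trans zero_less_mult_pos zero_less_one)
  have Z0: "Z \<ge> 0" using lebesgue_const_pos tail_const_pos w by (simp add: Z_def)
  have "S \<le> ennreal (1 / 2) * S + ennreal Z"
    unfolding S_def
  proof (rule SUP_least, fold S_def)
    fix d assume "d \<in> {b..}"
    then have d: "d \<ge> b" by simp
    have fd: "step_fraction * d \<ge> 1"
      using b d step_fraction_pos by (meson mult_left_mono less_imp_le order_trans)
    have le: "?v x \<le> S" if "x \<ge> d" for x
      unfolding S_def using that d by (intro SUP_upper) auto
    have "?v d \<le> ennreal (1 / 2) * S + ennreal (lebesgue_const * w + tail_const * exp (- rate * d))"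
      by (rule order_trans[OF green_interval_recursion[OF recursion_error_le(1,2)[OF fd w] w _ le]
            add_left_mono[OF ennreal_leI[OF recursion_error_le(3)[OF fd w]]]]) (use d b0 in auto)
    also have "\<dots> \<le> ennreal (1 / 2) * S + ennreal Z"
      unfolding Z_def using d rate_pos tail_const_pos
      by (intro add_left_mono ennreal_leI mult_left_mono) auto
    finally show "?v d \<le> ennreal (1 / 2) * S + ennreal Z" .
  qed
  moreover have "S \<le> ennreal block_const"
    unfolding S_def using w b0 by (intro SUP_least green_interval_le_block_const) auto
  then obtain x where x: "S = ennreal x" "x \<ge> 0"
    by (cases S) (auto simp: top_unique)
  moreover have "ennreal (1 / 2 * x + Z) = ennreal (1 / 2) * ennreal x + ennreal Z"
    using Z0 x(2) by (simp add: ennreal_plus ennreal_mult' del: times_divide_eq_left)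
  ultimately have "ennreal x \<le> ennreal (1 / 2 * x + Z)" by metis
  then have "x \<le> 2 * Z" using x Z0 by (subst (asm) ennreal_le_iff) auto
  moreover have "?v b \<le> S" unfolding S_def by (intro SUP_upper) auto
  ultimately show ?thesis using x unfolding Z_def by (meson ennreal_leI order_trans order.trans eq_refl)
qed

text \<open>The second summand covers \<open>b < 1 / step_fraction\<close>, where rounding down
  leaves no early step.\<close>

definition interval_const :: real where
  "interval_const = 2 * tail_const + block_const * exp (rate / step_fraction)"

text \<open>The first entry is the drift condition of \<open>green_interval_large\<close>; the
  second makes the intervals not covered there shorter than 1; the third puts
  \<open>2 * lebesgue_const\<close> below \<open>1 / \<mu>\<close>.\<close>

definition drift_threshold :: real where
  "drift_threshold = min (v / (8 * (a + M * K / (\<eta> * s))))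
     (min (v / (8 * (a\<^sup>2 + 2 * M * K / (\<eta> * s\<^sup>2)))) (1 / (2 * lebesgue_const)))"

lemma drift_threshold_pos: "drift_threshold > 0"
proof -
  have K: "K > 0" using trunc_le_K pos by simp
  have "a + M * K / (\<eta> * s) > 0" "a\<^sup>2 + 2 * M * K / (\<eta> * s\<^sup>2) > 0"
    using pos K by (auto intro!: add_pos_pos)
  then show ?thesis using pos lebesgue_const_pos by (simp add: drift_threshold_def)
qed

lemma green_interval:
  assumes \<mu>: "\<mu> \<le> drift_threshold" and w: "w > 0" and b: "b \<ge> 0"
  shows "green F (indicator {0..w}) b \<le> ennreal (w / \<mu> + interval_const * exp (- rate * b))"
proof -
  have K: "K > 0" using trunc_le_K pos by simp
  define A1 where "A1 = a + M * K / (\<eta> * s)"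
  define A2 where "A2 = a\<^sup>2 + 2 * M * K / (\<eta> * s\<^sup>2)"
  have A: "A1 > 0" "A2 > 0" using pos K by (auto simp: A1_def A2_def intro!: add_pos_pos)
  have "\<mu> \<le> v / (8 * A1)" "\<mu> \<le> v / (8 * A2)" "\<mu> \<le> 1 / (2 * lebesgue_const)"
    using \<mu> by (auto simp: drift_threshold_def A1_def A2_def)
  then have \<mu>': "8 * A1 * \<mu> \<le> v" "8 * A2 / v * \<mu> \<le> 1" "2 * lebesgue_const \<le> 1 / \<mu>"
    using A pos lebesgue_const_pos by (auto simp: field_simps)
  have I0: "interval_const * exp (- rate * b) \<ge> 0"
    using tail_const_pos block_const_pos by (simp add: interval_const_def)
  consider "8 * A2 / v * \<mu> \<le> w" | "w < 8 * A2 / v * \<mu>" "step_fraction * b \<ge> 1"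
    | "w < 8 * A2 / v * \<mu>" "step_fraction * b < 1" by linarith
  then show ?thesis
  proof cases
    case 1
    have "green F (indicator {0..w}) b \<le> ennreal (w / \<mu>)"
      using 1 \<mu>' unfolding A1_def A2_def by (intro green_interval_large b) auto
    also have "\<dots> \<le> ennreal (w / \<mu> + interval_const * exp (- rate * b))"
      using I0 by (intro ennreal_leI) auto
    finally show ?thesis .
  next
    case 2
    have "green F (indicator {0..w}) b \<le> ennreal (2 * (lebesgue_const * w + tail_const * exp (- rate * b)))"
      using 2 \<mu>' w by (intro green_interval_small) auto
    also have "\<dots> \<le> ennreal (w / \<mu> + interval_const * exp (- rate * b))"
    proof (rule ennreal_leI)
      have "2 * lebesgue_const * w \<le> 1 / \<mu> * w" using \<mu>' w by (intro mult_right_mono) auto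
      moreover have "2 * tail_const * exp (- rate * b) \<le> interval_const * exp (- rate * b)"
        using block_const_pos by (intro mult_right_mono) (auto simp: interval_const_def)
      ultimately have "2 * lebesgue_const * w + 2 * tail_const * exp (- rate * b)
        \<le> 1 / \<mu> * w + interval_const * exp (- rate * b)" by (rule add_mono)
      then show "2 * (lebesgue_const * w + tail_const * exp (- rate * b))
        \<le> w / \<mu> + interval_const * exp (- rate * b)" by (simp add: distrib_left mult.assoc)
    qed
    finally show ?thesis .
  next
    case 3
    have "green F (indicator {0..w}) b \<le> ennreal block_const"
      using 3 \<mu>' b by (intro green_interval_le_block_const) auto
    also have "\<dots> \<le> ennreal (w / \<mu> + interval_const * exp (- rate * b))"
    proof (rule ennreal_leI)
      have "b < 1 / step_fraction" using 3 step_fraction_pos by (simp add: field_simps)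
      then have "rate * b \<le> rate / step_fraction"
        using rate_pos mult_left_mono[of b "1 / step_fraction" rate] by simp
      then have "block_const * 1 \<le> block_const * (exp (rate / step_fraction) * exp (- rate * b))"
        using block_const_pos by (intro mult_left_mono) (auto simp: mult_exp_exp)
      also have "\<dots> \<le> interval_const * exp (- rate * b)"
        using tail_const_pos by (simp add: interval_const_def distrib_right)
      also have "\<dots> \<le> w / \<mu> + interval_const * exp (- rate * b)" using w pos by simp
      finally show "block_const \<le> w / \<mu> + interval_const * exp (- rate * b)" by simp
    qed
    finally show ?thesis .
  qed
qed

lemma interval_const_pos: "interval_const > 0"
  using tail_const_pos block_const_pos by (simp add: interval_const_def add_pos_pos)

lemma overshoot_bound:
  assumes \<mu>: "\<mu> \<le> drift_threshold" and k: "k \<ge> 1" and b: "b \<ge> 0"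
  shows "green F (overshoot_kernel F k) b
    \<le> ennreal (1 / real (k + 1) * ((\<integral>x. (max x 0) ^ (k + 1) \<partial>F) / \<mu>)
        + interval_const * M * (real k * Gamma (real k) / rate ^ k) * exp (- rate * b))"
proof -
  let ?E = "interval_const * exp (- rate * b)"
  have E0: "?E \<ge> 0" using interval_const_pos by simp
  have "green F (overshoot_kernel F k) b
    \<le> ennreal ((\<integral>x. (max x 0) ^ (k + 1) \<partial>F) / (real (k + 1) * \<mu>) + ?E * (\<integral>x. (max x 0) ^ k \<partial>F))"
    by (intro green_overshoot_kernel_le k b E0 green_interval \<mu>)
  also have "\<dots> \<le> ennreal (1 / real (k + 1) * ((\<integral>x. (max x 0) ^ (k + 1) \<partial>F) / \<mu>)
        + interval_const * M * (real k * Gamma (real k) / rate ^ k) * exp (- rate * b))"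
  proof (intro ennreal_leI add_mono)
    have Gam: "real k * Gamma (real k) = fact k"
      using k Gamma_fact[of "k - 1", where 'a = real] by (simp add: fact_reduce)
    have "(\<integral>x. (max x 0) ^ k \<partial>F) \<le> fact k / s ^ k * M" by (rule positive_part_moment_le[OF k])
    \<comment> \<open>Weakened from \<open>s\<close> to \<open>rate \<le> s\<close>, so that one
      constant serves both in the power and as the decay rate.\<close>
    also have "\<dots> \<le> fact k / rate ^ k * M"
      using rate_pos pos by (intro mult_right_mono divide_left_mono power_mono) (auto simp: rate_def)
    finally have "?E * (\<integral>x. (max x 0) ^ k \<partial>F) \<le> ?E * (fact k / rate ^ k * M)"
      using E0 by (rule mult_left_mono)
    then show "?E * (\<integral>x. (max x 0) ^ k \<partial>F)
      \<le> interval_const * M * (real k * Gamma (real k) / rate ^ k) * exp (- rate * b)"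
      unfolding Gam by (simp add: mult_ac)
  qed simp
  finally show ?thesis .
qed

end

section \<open>Exponential tilting\<close>

text \<open>With \<open>\<alpha>\<close> cancelling the argument of the characteristic function, the
  mean of \<open>cos (t * x + \<alpha>)\<close> is its modulus \<open>r\<close>. Nonnegativity of
  the variance bounds r^2 by the mean of the squared cosine, and the double-angle formula converts
  this into a lower bound at \<open>2 * t\<close>.\<close>

lemma (in real_distribution) char_doubling:
  "1 - (cmod (char M (2 * t)))\<^sup>2 \<le> 4 * (1 - (cmod (char M t))\<^sup>2)"
proof -
  define r where "r = cmod (char M t)"
  define \<alpha> where "\<alpha> = - Arg (char M t)"
  have "iexp \<alpha> * char M t = iexp \<alpha> * (of_real r * iexp (Arg (char M t)))"
    using Arg_eq[of "char M t"] by (cases "char M t = 0") (auto simp: r_def)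
  also have "\<dots> = of_real r" by (simp add: \<alpha>_def exp_minus)
  finally have r: "(\<integral>x. cos (t * x + \<alpha>) \<partial>M) = r" by (simp add: integral_cos_eq_char)
  have int: "integrable M (\<lambda>x. cos (t * x + \<alpha>))" "integrable M (\<lambda>x. (cos (t * x + \<alpha>))\<^sup>2)"
    "integrable M (\<lambda>x. cos (2 * t * x + 2 * \<alpha>))"
    by (auto intro!: integrable_const_bound[where B = 1] simp: abs_square_le_1)
  have "0 \<le> (\<integral>x. (cos (t * x + \<alpha>) - r)\<^sup>2 \<partial>M)" by simp
  also have "\<dots> = (\<integral>x. (cos (t * x + \<alpha>))\<^sup>2 - 2 * r * cos (t * x + \<alpha>) + r\<^sup>2 \<partial>M)"
    by (simp add: power2_diff algebra_simps)
  also have "\<dots> = (\<integral>x. (cos (t * x + \<alpha>))\<^sup>2 \<partial>M) - r\<^sup>2"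
    using int r prob_space by (simp add: power2_eq_square)
  finally have "r\<^sup>2 \<le> (\<integral>x. (cos (t * x + \<alpha>))\<^sup>2 \<partial>M)" by simp
  then have "2 * r\<^sup>2 - 1 \<le> (\<integral>x. 2 * (cos (t * x + \<alpha>))\<^sup>2 - 1 \<partial>M)"
    using int prob_space by simp
  also have "\<dots> = (\<integral>x. cos (2 * t * x + 2 * \<alpha>) \<partial>M)"
  proof (intro Bochner_Integration.integral_cong refl)
    fix x
    show "2 * (cos (t * x + \<alpha>))\<^sup>2 - 1 = cos (2 * t * x + 2 * \<alpha>)"
      using cos_double_cos[of "t * x + \<alpha>"] by (simp add: distrib_left mult.assoc)
  qed
  also have "\<dots> \<le> cmod (char M (2 * t))"
    by (rule integral_cos_le_char)
  finally have *: "1 - cmod (char M (2 * t)) \<le> 2 * (1 - r\<^sup>2)" by simp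
  have "1 - (cmod (char M (2 * t)))\<^sup>2 = (1 - cmod (char M (2 * t))) * (1 + cmod (char M (2 * t)))"
    by (simp add: power2_eq_square algebra_simps)
  also have "\<dots> \<le> (2 * (1 - r\<^sup>2)) * 2"
    using * cmod_char_le_1[of "2 * t"] cmod_char_le_1[of t]
    by (intro mult_mono) (auto simp: r_def power_le_one)
  finally show ?thesis by (simp add: r_def)
qed

text \<open>A nonzero \<open>t\<close> is doubled until its modulus lies in
  \<open>[T, 2 * T]\<close>. Each doubling costs a factor 4, exactly the growth of t^2. The constant
  involves only \<open>T\<close> and \<open>\<rho>\<close>, hence is common to all laws that share
  them.\<close>

lemma (in real_distribution) char_near_0:
  assumes T: "T > 0" and \<rho>: "0 \<le> \<rho>" "\<rho> < 1" and large: "\<And>t. \<bar>t\<bar> \<ge> T \<Longrightarrow> cmod (char M t) \<le> \<rho>"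
    and t: "\<bar>t\<bar> \<le> T"
  shows "(cmod (char M t))\<^sup>2 \<le> 1 - (1 - \<rho>\<^sup>2) / (4 * T\<^sup>2) * t\<^sup>2"
proof (cases "t = 0")
  case True
  then show ?thesis using cmod_char_le_1[of 0] by (simp add: power_le_one)
next
  case False
  have iter: "1 - (cmod (char M (2 ^ j * t)))\<^sup>2 \<le> 4 ^ j * (1 - (cmod (char M t))\<^sup>2)" for j
  proof (induction j)
    case (Suc j)
    then show ?case using char_doubling[of "2 ^ j * t"] by (simp add: mult.assoc)
  qed simp
  obtain j0 where "T / \<bar>t\<bar> < 2 ^ j0" using real_arch_pow[of 2 "T / \<bar>t\<bar>"] by auto
  then have ex: "T \<le> 2 ^ j0 * \<bar>t\<bar>" using False by (simp add: field_simps)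
  define j where "j = (LEAST j. T \<le> 2 ^ j * \<bar>t\<bar>)"
  have j: "T \<le> 2 ^ j * \<bar>t\<bar>" unfolding j_def by (rule LeastI[of _ j0]) (use ex in auto)
  have j2: "2 ^ j * \<bar>t\<bar> \<le> 2 * T"
  proof (cases j)
    case 0
    then show ?thesis using t T by simp
  next
    case (Suc i)
    then have "\<not> T \<le> 2 ^ i * \<bar>t\<bar>" using not_less_Least[of i "\<lambda>j. T \<le> 2 ^ j * \<bar>t\<bar>"] by (simp add: j_def)
    then show ?thesis using Suc by simp
  qed
  have "cmod (char M (2 ^ j * t)) \<le> \<rho>" using j by (intro large) (simp add: abs_mult)
  then have "(cmod (char M (2 ^ j * t)))\<^sup>2 \<le> \<rho>\<^sup>2" by (intro power_mono) auto
  then have *: "1 - \<rho>\<^sup>2 \<le> 4 ^ j * (1 - (cmod (char M t))\<^sup>2)" using iter[of j] by linarith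
  have "(4 :: real) ^ j = (2 ^ j)\<^sup>2" by (simp add: power2_eq_square flip: power_mult_distrib)
  then have "4 ^ j * t\<^sup>2 = (2 ^ j * \<bar>t\<bar>)\<^sup>2" by (simp add: power_mult_distrib)
  also have "\<dots> \<le> (2 * T)\<^sup>2" using j2 by (intro power_mono) auto
  finally have 4: "4 ^ j * t\<^sup>2 \<le> 4 * T\<^sup>2" by (simp add: power_mult_distrib)
  have nn: "0 \<le> 1 - (cmod (char M t))\<^sup>2" using cmod_char_le_1[of t] by (simp add: power_le_one)
  have "(1 - \<rho>\<^sup>2) * t\<^sup>2 \<le> 4 ^ j * (1 - (cmod (char M t))\<^sup>2) * t\<^sup>2"
    using * by (rule mult_right_mono) simp
  also have "\<dots> = (4 ^ j * t\<^sup>2) * (1 - (cmod (char M t))\<^sup>2)" by simp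
  also have "\<dots> \<le> (4 * T\<^sup>2) * (1 - (cmod (char M t))\<^sup>2)"
    using 4 nn by (rule mult_right_mono)
  finally show ?thesis using T by (simp add: field_simps)
qed

lemma (in real_distribution) integral_pos_of_support:
  fixes f :: "real \<Rightarrow> real"
  assumes int: "integrable M f" and nn: "\<And>x. f x \<ge> 0" and zero: "\<And>x. f x = 0 \<Longrightarrow> x = 0"
    and nondeg: "\<not> (AE x in M. x = 0)"
  shows "(\<integral>x. f x \<partial>M) > 0"
proof -
  have "(\<integral>x. f x \<partial>M) \<noteq> 0"
  proof
    assume "(\<integral>x. f x \<partial>M) = 0"
    then have "AE x in M. f x = 0" using integral_nonneg_eq_0_iff_AE[OF int] nn by auto
    then have "AE x in M. x = 0" by eventually_elim (rule zero)
    then show False using nondeg by simp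
  qed
  moreover have "(\<integral>x. f x \<partial>M) \<ge> 0" using nn by (intro integral_nonneg_AE) auto
  ultimately show ?thesis by simp
qed

text \<open>The exponent \<open>2 * h\<close> is split in two: one half for the tilt,
  \<open>\<theta> \<le> h\<close>, the other for an exponential moment of order \<open>h\<close>
  under the tilted law.\<close>

locale tilting = real_distribution F for F :: "real measure" +
  fixes h :: real
  assumes h: "h > 0"
    and exp_int: "integrable F (\<lambda>x. exp (2 * h * x))"
    and id_int: "integrable F (\<lambda>x. x)" and mean_0: "(\<integral>x. x \<partial>F) = 0"
    and nondeg: "\<not> (AE x in F. x = 0)"
begin

definition mgf :: "real \<Rightarrow> real" where
  "mgf \<theta> = (\<integral>x. exp (\<theta> * x) \<partial>F)"

lemma exp_le: "0 \<le> u \<Longrightarrow> u \<le> w \<Longrightarrow> exp (u * x) \<le> 1 + exp (w * x)" for u w x :: real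
proof (cases "x \<ge> 0")
  case True
  assume "0 \<le> u" "u \<le> w"
  then have "exp (u * x) \<le> exp (w * x)" using True by (simp add: mult_right_mono)
  then show ?thesis by linarith
next
  case False
  assume "0 \<le> u" "u \<le> w"
  then have "exp (u * x) \<le> 1" using False by (simp add: mult_nonneg_nonpos)
  then show ?thesis by (simp add: add_increasing2)
qed

lemma exp_integrable: "0 \<le> u \<Longrightarrow> u \<le> 2 * h \<Longrightarrow> integrable F (\<lambda>x. exp (u * x))"
  by (rule Bochner_Integration.integrable_bound[of _ "\<lambda>x. 1 + exp (2 * h * x)"])
     (use exp_int exp_le[of u "2 * h"] in auto)

text \<open>Strict Jensen inequality at mean 0: exp(y) - 1 - y is nonnegative and vanishes only at y
  = 0.\<close>

lemma mgf_gt_1: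
  assumes "0 < u" "u \<le> 2 * h"
  shows "mgf u > 1"
proof -
  have int: "integrable F (\<lambda>x. exp (u * x))" using assms by (intro exp_integrable) auto
  have "0 < (\<integral>x. exp (u * x) - 1 - u * x \<partial>F)"
  proof (rule integral_pos_of_support[OF _ _ _ nondeg])
    show "integrable F (\<lambda>x. exp (u * x) - 1 - u * x)" using int id_int by auto
    fix x :: real
    show "0 \<le> exp (u * x) - 1 - u * x" using exp_ge_add_one_self[of "u * x"] by linarith
    show "x = 0" if "exp (u * x) - 1 - u * x = 0"
    proof (rule ccontr)
      assume "x \<noteq> 0"
      then have y: "(u * x)\<^sup>2 > 0" using assms by simp
      show False
      \<comment> \<open>Squaring 1 + y / 2 <= exp(y / 2) gains y^2 / 4 but requires a nonnegative
        left side; for y < -2 the number 1 + y is negative.\<close>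
      proof (cases "u * x \<ge> - 2")
        case True
        have "(1 + u * x / 2)\<^sup>2 \<le> (exp (u * x / 2))\<^sup>2"
          using exp_ge_add_one_self[of "u * x / 2"] True by (intro power_mono) auto
        also have "\<dots> = exp (u * x)" by (simp add: power2_eq_square mult_exp_exp)
        finally show False using that y by (simp add: power2_eq_square field_simps)
      next
        case False
        then show False using that exp_gt_zero[of "u * x"] by linarith
      qed
    qed
  qed
  also have "\<dots> = mgf u - 1" using int id_int mean_0 prob_space by (simp add: mgf_def)
  finally show ?thesis by simp
qed

lemma tilted_eq:
  assumes "0 < \<theta>" "\<theta> \<le> h"
  shows "tilted F \<theta> = density F (\<lambda>x. ennreal (exp (\<theta> * x) / mgf \<theta>))"
proof -
  have "mgf \<theta> > 0" using mgf_gt_1[of \<theta>] assms h by simp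
  then show ?thesis unfolding tilted_def cumulant_def mgf_def[symmetric] by (simp add: exp_diff)
qed

lemma real_distribution_tilted:
  assumes "0 < \<theta>" "\<theta> \<le> h"
  shows "real_distribution (tilted F \<theta>)"
proof -
  have Z: "mgf \<theta> > 1" using mgf_gt_1[of \<theta>] assms h by simp
  have int: "integrable F (\<lambda>x. exp (\<theta> * x))" using assms by (intro exp_integrable) auto
  have "prob_space (density F (\<lambda>x. ennreal (exp (\<theta> * x) / mgf \<theta>)))"
  proof (rule prob_spaceI)
    have "emeasure (density F (\<lambda>x. ennreal (exp (\<theta> * x) / mgf \<theta>))) (space F)
      = (\<integral>\<^sup>+x. ennreal (exp (\<theta> * x) / mgf \<theta>) \<partial>F)"
      by (subst emeasure_density) (auto intro!: nn_integral_cong)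
    also have "\<dots> = ennreal (\<integral>x. exp (\<theta> * x) / mgf \<theta> \<partial>F)"
      by (rule nn_integral_eq_integral) (use int Z in auto)
    also have "(\<integral>x. exp (\<theta> * x) / mgf \<theta> \<partial>F) = 1" using int Z by (simp add: mgf_def)
    finally show "emeasure (density F (\<lambda>x. ennreal (exp (\<theta> * x) / mgf \<theta>)))
      (space (density F (\<lambda>x. ennreal (exp (\<theta> * x) / mgf \<theta>)))) = 1" by simp
  qed
  then show ?thesis
    unfolding tilted_eq[OF assms] by (intro real_distribution.intro) (auto simp: real_distribution_axioms_def)
qed

lemma integrable_tilted:
  fixes f :: "real \<Rightarrow> 'b :: {banach, second_countable_topology}"
  assumes "0 < \<theta>" "\<theta> \<le> h" and [measurable]: "f \<in> borel_measurable borel"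
  shows "integrable (tilted F \<theta>) f \<longleftrightarrow> integrable F (\<lambda>x. (exp (\<theta> * x) / mgf \<theta>) *\<^sub>R f x)"
proof -
  have Z: "mgf \<theta> > 1" using mgf_gt_1[of \<theta>] assms h by simp
  show ?thesis unfolding tilted_eq[OF assms(1,2)]
    by (rule integrable_density) (use Z in auto)
qed

lemma integral_tilted:
  fixes f :: "real \<Rightarrow> 'b :: {banach, second_countable_topology}"
  assumes "0 < \<theta>" "\<theta> \<le> h" and [measurable]: "f \<in> borel_measurable borel"
  shows "(\<integral>x. f x \<partial>tilted F \<theta>) = (\<integral>x. (exp (\<theta> * x) / mgf \<theta>) *\<^sub>R f x \<partial>F)"
proof -
  have Z: "mgf \<theta> > 1" using mgf_gt_1[of \<theta>] assms h by simp
  show ?thesis unfolding tilted_eq[OF assms(1,2)]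
    by (rule integral_density) (use Z in auto)
qed

section \<open>Convergence of tilted integrals as \<theta> decreases to 0\<close>

abbreviation near_0 :: "real filter" where
  "near_0 \<equiv> at 0 within {0<..h}"

text \<open>\<open>exp (\<theta> * x) \<le> 1 + exp (h * x)\<close> yields a dominating function
  free of \<open>\<theta>\<close>.\<close>

lemma tilt_dominated:
  assumes [measurable]: "f \<in> borel_measurable borel"
    and int: "integrable F f" "integrable F (\<lambda>x. f x * exp (h * x))"
    and \<theta>: "0 \<le> \<theta>" "\<theta> \<le> h"
  shows "\<bar>f x * exp (\<theta> * x)\<bar> \<le> \<bar>f x\<bar> + \<bar>f x * exp (h * x)\<bar>"
    and "integrable F (\<lambda>x. f x * exp (\<theta> * x))"
proof -
  have le: "\<bar>f x * exp (\<theta> * x)\<bar> \<le> \<bar>f x\<bar> + \<bar>f x * exp (h * x)\<bar>" for x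
  proof -
    have "\<bar>f x\<bar> * exp (\<theta> * x) \<le> \<bar>f x\<bar> * (1 + exp (h * x))"
      using exp_le[OF \<theta>] by (intro mult_left_mono) auto
    then show ?thesis by (simp add: abs_mult distrib_left)
  qed
  then show "\<bar>f x * exp (\<theta> * x)\<bar> \<le> \<bar>f x\<bar> + \<bar>f x * exp (h * x)\<bar>" .
  show "integrable F (\<lambda>x. f x * exp (\<theta> * x))"
    by (rule Bochner_Integration.integrable_bound[of _ "\<lambda>x. \<bar>f x\<bar> + \<bar>f x * exp (h * x)\<bar>"])
       (use int le in auto)
qed

lemma tendsto_integral_exp:
  assumes [measurable]: "f \<in> borel_measurable borel"
    and int: "integrable F f" "integrable F (\<lambda>x. f x * exp (h * x))"
  shows "((\<lambda>\<theta>. \<integral>x. f x * exp (\<theta> * x) \<partial>F) \<longlongrightarrow> (\<integral>x. f x \<partial>F)) near_0"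
  unfolding tendsto_at_iff_sequentially comp_def
proof (intro allI impI)
  fix X :: "nat \<Rightarrow> real" assume X: "\<forall>i. X i \<in> {0<..h} - {0}" "X \<longlonglongrightarrow> 0"
  show "(\<lambda>i. \<integral>x. f x * exp (X i * x) \<partial>F) \<longlonglongrightarrow> (\<integral>x. f x \<partial>F)"
  proof (rule integral_dominated_convergence[where w = "\<lambda>x. \<bar>f x\<bar> + \<bar>f x * exp (h * x)\<bar>"])
    show "AE x in F. (\<lambda>i. f x * exp (X i * x)) \<longlonglongrightarrow> f x"
    proof (rule AE_I2)
      fix x
      have "(\<lambda>i. f x * exp (X i * x)) \<longlonglongrightarrow> f x * exp (0 * x)"
        by (intro tendsto_intros X)
      then show "(\<lambda>i. f x * exp (X i * x)) \<longlonglongrightarrow> f x" by simp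
    qed
    show "AE x in F. norm (f x * exp (X i * x)) \<le> \<bar>f x\<bar> + \<bar>f x * exp (h * x)\<bar>" for i
      using tilt_dominated(1)[OF assms, of "X i"] X(1)[rule_format, of i] by auto
  qed (use int in auto)
qed

lemma tendsto_mgf: "(mgf \<longlongrightarrow> 1) near_0"
  using tendsto_integral_exp[of "\<lambda>_. 1"] exp_integrable[of h] h prob_space
  by (simp add: mgf_def[abs_def])

lemma eventually_near_0: "eventually (\<lambda>\<theta>. 0 < \<theta> \<and> \<theta> \<le> h) near_0"
  by (simp add: eventually_at_filter)

lemma tendsto_tilted:
  fixes f :: "real \<Rightarrow> real"
  assumes [measurable]: "f \<in> borel_measurable borel"
    and int: "integrable F f" "integrable F (\<lambda>x. f x * exp (h * x))"
  shows "((\<lambda>\<theta>. \<integral>x. f x \<partial>tilted F \<theta>) \<longlongrightarrow> (\<integral>x. f x \<partial>F)) near_0"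
proof -
  have "((\<lambda>\<theta>. (\<integral>x. f x * exp (\<theta> * x) \<partial>F) / mgf \<theta>) \<longlongrightarrow> (\<integral>x. f x \<partial>F) / 1) near_0"
    by (intro tendsto_divide tendsto_integral_exp assms tendsto_mgf) simp
  then have "((\<lambda>\<theta>. (\<integral>x. f x * exp (\<theta> * x) \<partial>F) / mgf \<theta>) \<longlongrightarrow> (\<integral>x. f x \<partial>F)) near_0" by simp
  moreover have "eventually (\<lambda>\<theta>. (\<integral>x. f x * exp (\<theta> * x) \<partial>F) / mgf \<theta> = (\<integral>x. f x \<partial>tilted F \<theta>)) near_0"
    using eventually_near_0
  proof eventually_elim
    case (elim \<theta>)
    then have "(\<integral>x. f x \<partial>tilted F \<theta>) = (\<integral>x. f x * exp (\<theta> * x) / mgf \<theta> \<partial>F)"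
      by (subst integral_tilted) (auto simp: mult.commute)
    then show ?case by simp
  qed
  ultimately show ?thesis by (rule Lim_transform_eventually)
qed

lemma tendsto_tilted_bounded:
  fixes f :: "real \<Rightarrow> real"
  assumes [measurable]: "f \<in> borel_measurable borel" and B: "\<And>x. \<bar>f x\<bar> \<le> B"
  shows "((\<lambda>\<theta>. \<integral>x. f x \<partial>tilted F \<theta>) \<longlongrightarrow> (\<integral>x. f x \<partial>F)) near_0"
proof (rule tendsto_tilted)
  show "integrable F f" using B by (intro integrable_const_bound[where B = B]) auto
  have "integrable F (\<lambda>x. B * exp (h * x))" using exp_integrable[of h] h by simp
  then show "integrable F (\<lambda>x. f x * exp (h * x))"
  proof (rule Bochner_Integration.integrable_bound)
    have "\<bar>f x\<bar> * exp (h * x) \<le> \<bar>B\<bar> * exp (h * x)" for x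
      using B[of x] by (intro mult_right_mono) auto
    then show "AE x in F. norm (f x * exp (h * x)) \<le> norm (B * exp (h * x))" by (simp add: abs_mult)
  qed simp
qed simp

text \<open>On the right, linear growth is absorbed by the spare half of the exponent; on the left
  the exponential is at most 1 and the first moment suffices.\<close>

lemma id_exp_integrable: "integrable F (\<lambda>x. x * exp (h * x))"
proof (rule Bochner_Integration.integrable_bound[of _ "\<lambda>x. \<bar>x\<bar> + 1 / h * exp (2 * h * x)"])
  show "integrable F (\<lambda>x. \<bar>x\<bar> + 1 / h * exp (2 * h * x))" using id_int exp_int by auto
  have le: "\<bar>x * exp (h * x)\<bar> \<le> \<bar>x\<bar> + 1 / h * exp (2 * h * x)" for x
  proof (cases "x \<ge> 0")
    case True
    have "h * x \<le> exp (h * x)" using exp_ge_add_one_self[of "h * x"] by linarith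
    then have "h * x * exp (h * x) \<le> exp (h * x) * exp (h * x)" by (rule mult_right_mono) simp
    also have "\<dots> = exp (2 * h * x)" by (simp add: mult_exp_exp)
    finally have "x * exp (h * x) \<le> 1 / h * exp (2 * h * x)" using h by (simp add: field_simps)
    then show ?thesis using True by simp
  next
    case False
    then have "exp (h * x) \<le> 1" using h by (simp add: mult_nonneg_nonpos)
    then have "\<bar>x\<bar> * exp (h * x) \<le> \<bar>x\<bar> * 1" by (intro mult_left_mono) auto
    moreover have "0 \<le> 1 / h * exp (2 * h * x)" using h by simp
    ultimately show ?thesis by (simp add: abs_mult)
  qed
  show "AE x in F. norm (x * exp (h * x)) \<le> norm (\<bar>x\<bar> + 1 / h * exp (2 * h * x))"
  proof (rule AE_I2)
    fix x
    show "norm (x * exp (h * x)) \<le> norm (\<bar>x\<bar> + 1 / h * exp (2 * h * x))"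
      unfolding real_norm_def using le[of x] by (rule order_trans) (rule abs_ge_self)
  qed
qed simp

definition tilted_mean :: "real \<Rightarrow> real" where
  "tilted_mean \<theta> = (\<integral>x. x \<partial>tilted F \<theta>)"

lemma tendsto_tilted_mean: "(tilted_mean \<longlongrightarrow> 0) near_0"
proof -
  have "((\<lambda>\<theta>. \<integral>x. x \<partial>tilted F \<theta>) \<longlongrightarrow> (\<integral>x. x \<partial>F)) near_0"
    by (rule tendsto_tilted[OF _ id_int id_exp_integrable]) measurable
  then show ?thesis unfolding mean_0 tilted_mean_def[abs_def] .
qed

text \<open>Since the untilted mean is 0, \<open>mgf \<theta> * tilted_mean \<theta>\<close> is the
  integral of \<open>x * (exp (\<theta> * x) - 1)\<close>, which is positive off 0.\<close>

lemma tilted_mean_pos: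
  assumes \<theta>: "0 < \<theta>" "\<theta> \<le> h"
  shows "tilted_mean \<theta> > 0" "integrable (tilted F \<theta>) (\<lambda>x. x)"
proof -
  have Z: "mgf \<theta> > 1" using mgf_gt_1[of \<theta>] assms h by simp
  have int: "integrable F (\<lambda>x. x * exp (\<theta> * x))"
    by (rule tilt_dominated(2)[OF _ id_int id_exp_integrable]) (use \<theta> in auto)
  have "0 < (\<integral>x. x * (exp (\<theta> * x) - 1) \<partial>F)"
  proof (rule integral_pos_of_support[OF _ _ _ nondeg])
    show "integrable F (\<lambda>x. x * (exp (\<theta> * x) - 1))"
      using Bochner_Integration.integrable_diff[OF int id_int] by (simp add: right_diff_distrib)
    fix x :: real
    show "0 \<le> x * (exp (\<theta> * x) - 1)"
    proof (cases "x \<ge> 0")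
      case True
      then show ?thesis using \<theta> by simp
    next
      case False
      then have "exp (\<theta> * x) \<le> 1" using \<theta> by (simp add: mult_nonneg_nonpos)
      then show ?thesis using False by (intro mult_nonpos_nonpos) auto
    qed
    show "x * (exp (\<theta> * x) - 1) = 0 \<Longrightarrow> x = 0" using \<theta> by auto
  qed
  also have "\<dots> = (\<integral>x. x * exp (\<theta> * x) \<partial>F)"
    using Bochner_Integration.integral_diff[OF int id_int] by (simp add: right_diff_distrib mean_0)
  also have "\<dots> = mgf \<theta> * tilted_mean \<theta>"
    unfolding tilted_mean_def using \<theta> Z by (subst integral_tilted) (auto simp: mult.commute)
  finally show "tilted_mean \<theta> > 0" using Z by (simp add: zero_less_mult_iff)
  show "integrable (tilted F \<theta>) (\<lambda>x. x)"
  proof (subst integrable_tilted[OF \<theta>])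
    have "integrable F (\<lambda>x. x * exp (\<theta> * x) / mgf \<theta>)" by (intro integrable_divide int)
    then show "integrable F (\<lambda>x. (exp (\<theta> * x) / mgf \<theta>) *\<^sub>R x)" by (simp add: mult.commute)
  qed measurable
qed

text \<open>The right side, an L^1 distance of densities, does not involve \<open>t\<close>;
  pointwise convergence in \<open>t\<close> would not control all high frequencies at once.\<close>

lemma char_tilted_diff:
  assumes \<theta>: "0 < \<theta>" "\<theta> \<le> h"
  shows "cmod (char (tilted F \<theta>) t - char F t) \<le> (\<integral>x. \<bar>exp (\<theta> * x) / mgf \<theta> - 1\<bar> \<partial>F)"
proof -
  have Z: "mgf \<theta> > 1" using mgf_gt_1[of \<theta>] assms h by simp
  have int: "integrable F (\<lambda>x. exp (\<theta> * x))" using \<theta> by (intro exp_integrable) auto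
  have c: "complex_integrable F (\<lambda>x. iexp (t * x))" by (rule integrable_iexp) auto
  interpret T: real_distribution "tilted F \<theta>" by (rule real_distribution_tilted[OF \<theta>])
  have "complex_integrable (tilted F \<theta>) (\<lambda>x. iexp (t * x))" by (rule T.integrable_iexp) auto
  then have ct: "complex_integrable F (\<lambda>x. (exp (\<theta> * x) / mgf \<theta>) *\<^sub>R iexp (t * x))"
    using \<theta> by (subst (asm) integrable_tilted) auto
  have "char (tilted F \<theta>) t - char F t
    = (\<integral>x. (exp (\<theta> * x) / mgf \<theta>) *\<^sub>R iexp (t * x) \<partial>F) - (\<integral>x. iexp (t * x) \<partial>F)"
    unfolding char_def using \<theta> by (subst integral_tilted) auto
  also have "\<dots> = (\<integral>x. (exp (\<theta> * x) / mgf \<theta>) *\<^sub>R iexp (t * x) - iexp (t * x) \<partial>F)"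
    by (rule Bochner_Integration.integral_diff[OF ct c, symmetric])
  also have "\<dots> = (\<integral>x. (exp (\<theta> * x) / mgf \<theta> - 1) *\<^sub>R iexp (t * x) \<partial>F)"
    by (simp add: scaleR_diff_left del: of_real_mult)
  also have "cmod \<dots> \<le> (\<integral>x. cmod ((exp (\<theta> * x) / mgf \<theta> - 1) *\<^sub>R iexp (t * x)) \<partial>F)"
    by (rule integral_norm_bound)
  also have "\<dots> = (\<integral>x. \<bar>exp (\<theta> * x) / mgf \<theta> - 1\<bar> \<partial>F)"
    by (simp del: of_real_mult)
  finally show ?thesis .
qed

lemma tendsto_total_variation: "((\<lambda>\<theta>. \<integral>x. \<bar>exp (\<theta> * x) / mgf \<theta> - 1\<bar> \<partial>F) \<longlongrightarrow> 0) near_0"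
  unfolding tendsto_at_iff_sequentially comp_def
proof (intro allI impI)
  fix X :: "nat \<Rightarrow> real" assume X: "\<forall>i. X i \<in> {0<..h} - {0}" "X \<longlonglongrightarrow> 0"
  have mgf: "(\<lambda>i. mgf (X i)) \<longlonglongrightarrow> 1"
    using tendsto_mgf[unfolded tendsto_at_iff_sequentially, rule_format, of X] X by (simp add: comp_def)
  have "(\<lambda>i. \<integral>x. \<bar>exp (X i * x) / mgf (X i) - 1\<bar> \<partial>F) \<longlonglongrightarrow> (\<integral>x. 0 \<partial>F)"
  proof (rule integral_dominated_convergence[where w = "\<lambda>x. 2 + exp (h * x)"])
    show "integrable F (\<lambda>x. 2 + exp (h * x))" using exp_integrable[of h] h by auto
    show "AE x in F. (\<lambda>i. \<bar>exp (X i * x) / mgf (X i) - 1\<bar>) \<longlonglongrightarrow> 0"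
    proof (rule AE_I2)
      fix x
      have "(\<lambda>i. \<bar>exp (X i * x) / mgf (X i) - 1\<bar>) \<longlonglongrightarrow> \<bar>exp (0 * x) / 1 - 1\<bar>"
        by (intro tendsto_intros X mgf) simp
      then show "(\<lambda>i. \<bar>exp (X i * x) / mgf (X i) - 1\<bar>) \<longlonglongrightarrow> 0" by simp
    qed
    fix i
    have Xi: "0 < X i" "X i \<le> h" using X(1)[rule_format, of i] by auto
    then have Z: "mgf (X i) > 1" using mgf_gt_1[of "X i"] h by simp
    have "\<bar>exp (X i * x) / mgf (X i) - 1\<bar> \<le> 2 + exp (h * x)" for x
    proof -
      have "exp (X i * x) / mgf (X i) \<le> exp (X i * x) / 1" using Z by (intro divide_left_mono) auto
      moreover have "exp (X i * x) \<le> 1 + exp (h * x)" using Xi by (intro exp_le) auto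
      moreover have "0 \<le> exp (X i * x) / mgf (X i)" using Z by simp
      ultimately show ?thesis by (simp add: abs_le_iff)
    qed
    then show "AE x in F. norm \<bar>exp (X i * x) / mgf (X i) - 1\<bar> \<le> 2 + exp (h * x)" by simp
  qed auto
  then show "(\<lambda>i. \<integral>x. \<bar>exp (X i * x) / mgf (X i) - 1\<bar> \<partial>F) \<longlonglongrightarrow> 0" by simp
qed

section \<open>Constants valid for all small \<theta>\<close>

lemma obtain_truncation:
  obtains K where "(\<integral>x. min (exp (h * x)) K \<partial>F) > 1" "K > 0"
proof -
  have int: "integrable F (\<lambda>x. exp (h * x))" using h by (intro exp_integrable) auto
  have "(\<lambda>n. \<integral>x. min (exp (h * x)) (real n) \<partial>F) \<longlonglongrightarrow> (\<integral>x. exp (h * x) \<partial>F)"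
  proof (rule integral_dominated_convergence[where w = "\<lambda>x. exp (h * x)"])
    show "AE x in F. (\<lambda>n. min (exp (h * x)) (real n)) \<longlonglongrightarrow> exp (h * x)"
    proof (rule AE_I2)
      fix x
      obtain N where "exp (h * x) \<le> real N" using real_arch_simple by blast
      then have "eventually (\<lambda>n. min (exp (h * x)) (real n) = exp (h * x)) sequentially"
        by (auto simp: eventually_sequentially min_def intro!: exI[of _ N])
      then show "(\<lambda>n. min (exp (h * x)) (real n)) \<longlonglongrightarrow> exp (h * x)"
        by (rule tendsto_eventually)
    qed
  qed (use int in auto)
  moreover have "(\<integral>x. exp (h * x) \<partial>F) > 1" using mgf_gt_1[of h] h by (simp add: mgf_def)
  ultimately have "eventually (\<lambda>n. (\<integral>x. min (exp (h * x)) (real n) \<partial>F) > 1) sequentially"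
    by (rule order_tendstoD)
  then have "eventually (\<lambda>n. (\<integral>x. min (exp (h * x)) (real n) \<partial>F) > 1 \<and> n > 0) sequentially"
    using eventually_gt_at_top[of 0] by eventually_elim auto
  then obtain n where "(\<integral>x. min (exp (h * x)) (real n) \<partial>F) > 1" "n > 0"
    unfolding eventually_sequentially by blast
  then show ?thesis by (intro that[of "real n"]) auto
qed

text \<open>Without mass on the negative axis the law would be nonnegative with mean 0, hence
  degenerate.\<close>

lemma obtain_left_variance:
  assumes sq: "integrable F (\<lambda>x. x\<^sup>2)"
  obtains a where "a > 0" "(\<integral>x. x\<^sup>2 * indicator {-a..0} x \<partial>F) > 0"
proof -
  have int: "integrable F (\<lambda>x. x\<^sup>2 * indicator {..0} x)"
    by (rule Bochner_Integration.integrable_bound[OF sq]) (auto simp: indicator_def)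
  have "(\<lambda>n. \<integral>x. x\<^sup>2 * indicator {- real n..0} x \<partial>F) \<longlonglongrightarrow> (\<integral>x. x\<^sup>2 * indicator {..0} x \<partial>F)"
  proof (rule integral_dominated_convergence[where w = "\<lambda>x. x\<^sup>2"])
    show "AE x in F. (\<lambda>n. x\<^sup>2 * indicator {- real n..0} x) \<longlonglongrightarrow> x\<^sup>2 * indicator {..0} x"
    proof (rule AE_I2)
      fix x :: real
      obtain N where N: "- x \<le> real N" using real_arch_simple by blast
      have "x\<^sup>2 * indicator {- real n..0} x = (x\<^sup>2 * indicator {..0} x :: real)" if "n \<ge> N" for n
      proof -
        have "- real n \<le> x" using N that by linarith
        then show ?thesis by (simp add: indicator_def)
      qed
      then have "eventually (\<lambda>n. x\<^sup>2 * indicator {- real n..0} x = (x\<^sup>2 * indicator {..0} x :: real)) sequentially"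
        unfolding eventually_sequentially by blast
      then show "(\<lambda>n. x\<^sup>2 * indicator {- real n..0} x) \<longlonglongrightarrow> (x\<^sup>2 * indicator {..0} x :: real)"
        by (rule tendsto_eventually)
    qed
  qed (use sq int in \<open>auto simp: indicator_def\<close>)
  moreover have "(\<integral>x. x\<^sup>2 * indicator {..0} x \<partial>F) > 0"
  proof (rule ccontr)
    assume "\<not> (\<integral>x. x\<^sup>2 * indicator {..0} x \<partial>F) > 0"
    moreover have "(\<integral>x. x\<^sup>2 * indicator {..0} x \<partial>F) \<ge> 0" by (intro integral_nonneg_AE) auto
    ultimately have "(\<integral>x. x\<^sup>2 * indicator {..0} x \<partial>F) = 0" by linarith
    then have "AE x in F. x\<^sup>2 * indicator {..0} x = (0 :: real)"
      by (subst (asm) integral_nonneg_eq_0_iff_AE[OF int]) auto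
    then have nn: "AE x in F. 0 \<le> x" by eventually_elim (auto simp: indicator_def split: if_splits)
    have "AE x in F. x = 0"
      using mean_0 by (subst (asm) integral_nonneg_eq_0_iff_AE[OF id_int nn])
    then show False using nondeg by simp
  qed
  ultimately have "eventually (\<lambda>n. (\<integral>x. x\<^sup>2 * indicator {- real n..0} x \<partial>F) > 0) sequentially"
    by (rule order_tendstoD)
  then have "eventually (\<lambda>n. (\<integral>x. x\<^sup>2 * indicator {- real n..0} x \<partial>F) > 0 \<and> n > 0) sequentially"
    using eventually_gt_at_top[of 0] by eventually_elim auto
  then obtain n where "(\<integral>x. x\<^sup>2 * indicator {- real n..0} x \<partial>F) > 0" "n > 0"
    unfolding eventually_sequentially by blast
  then show ?thesis by (intro that[of "real n"]) auto
qed

lemma obtain_char_bound: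
  assumes "strongly_nonlattice F"
  obtains T \<rho> where "T > 0" "0 < \<rho>" "\<rho> < 1" "\<And>t. \<bar>t\<bar> \<ge> T \<Longrightarrow> cmod (char F t) \<le> \<rho>"
proof -
  obtain r where r: "Limsup at_infinity (\<lambda>t. ereal (cmod (char F t))) < ereal r" "ereal r < 1"
    using assms unfolding strongly_nonlattice_def by (metis ereal_dense2)
  then have "eventually (\<lambda>t. ereal (cmod (char F t)) < ereal r) at_infinity"
    by (intro Limsup_lessD) auto
  then obtain B where B: "\<And>t. norm t \<ge> B \<Longrightarrow> cmod (char F t) < r"
    by (auto simp: eventually_at_infinity)
  define T where "T = max B 1"
  have T: "cmod (char F t) < r" if "\<bar>t\<bar> \<ge> T" for t using that B[of t] by (auto simp: T_def)
  have "0 \<le> cmod (char F T)" by simp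
  also have "\<dots> < r" by (rule T) (auto simp: T_def)
  finally have "r > 0" .
  then show ?thesis using r T by (intro that[of T r]) (auto simp: T_def less_imp_le)
qed

text \<open>The constants come from the untilted law, with room to spare and before
  \<open>\<theta>\<close> is chosen; convergence of the tilted integrals then preserves the strict
  inequalities.\<close>

lemma eventually_step_law:
  assumes sq: "integrable F (\<lambda>x. x\<^sup>2)" and nonlattice: "strongly_nonlattice F"
  obtains M K \<eta> a v m T c \<rho> where
    "eventually (\<lambda>\<theta>. step_law (tilted F \<theta>) (tilted_mean \<theta>) \<theta> h M K \<eta> a v m T c \<rho>) near_0"
proof -
  obtain K where K: "(\<integral>x. min (exp (h * x)) K \<partial>F) > 1" "K > 0" by (rule obtain_truncation)
  obtain a where a: "a > 0" "(\<integral>x. x\<^sup>2 * indicator {-a..0} x \<partial>F) > 0" by (rule obtain_left_variance[OF sq])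
  obtain T r where T: "T > 0" and r: "0 < r" "r < 1" and large: "\<And>t. \<bar>t\<bar> \<ge> T \<Longrightarrow> cmod (char F t) \<le> r"
    using obtain_char_bound[OF nonlattice] by blast
  define \<eta> where "\<eta> = ((\<integral>x. min (exp (h * x)) K \<partial>F) - 1) / 2"
  define v where "v = (\<integral>x. x\<^sup>2 * indicator {-a..0} x \<partial>F) / 2"
  define m where "m = (\<integral>x. \<bar>x\<bar> \<partial>F) + 1"
  \<comment> \<open>Midpoint of \<open>r\<close> and 1: the tilt will move the characteristic
    function by less than \<open>(1 - r) / 2\<close>.\<close>
  define \<rho> where "\<rho> = (1 + r) / 2"
  define c where "c = (1 - \<rho>\<^sup>2) / (4 * T\<^sup>2)"
  \<comment> \<open>The tilted moment is at most the mean of \<open>1 + exp (2 * h * x)\<close>; the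
    further unit gives \<open>M > 1\<close>, so that \<open>ln M\<close> is positive.\<close>
  define M where "M = 2 + (\<integral>x. exp (2 * h * x) \<partial>F)"
  have \<rho>: "0 < \<rho>" "\<rho> < 1" using r by (auto simp: \<rho>_def)
  have "\<rho>\<^sup>2 < 1" using \<rho> by (simp add: power_less_one_iff)
  then have c: "c > 0" using T by (simp add: c_def)
  have m: "m > 0" unfolding m_def by (intro add_nonneg_pos integral_nonneg_AE) auto
  have "0 \<le> (\<integral>x. exp (2 * h * x) \<partial>F)" by (intro integral_nonneg_AE) auto
  then have M: "M > 1" unfolding M_def by linarith
  have 1: "eventually (\<lambda>\<theta>. 1 + \<eta> < (\<integral>x. min (exp (h * x)) K \<partial>tilted F \<theta>)) near_0"
  proof (rule order_tendstoD(1))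
    show "((\<lambda>\<theta>. \<integral>x. min (exp (h * x)) K \<partial>tilted F \<theta>) \<longlongrightarrow> (\<integral>x. min (exp (h * x)) K \<partial>F)) near_0"
      by (rule tendsto_tilted_bounded[where B = K]) (use K in auto)
    show "1 + \<eta> < (\<integral>x. min (exp (h * x)) K \<partial>F)" using K by (simp add: \<eta>_def field_simps)
  qed
  have 2: "eventually (\<lambda>\<theta>. (\<integral>x. \<bar>x\<bar> \<partial>tilted F \<theta>) < m) near_0"
  proof (rule order_tendstoD(2))
    have "integrable F (\<lambda>x. \<bar>x * exp (h * x)\<bar>)" by (rule integrable_abs[OF id_exp_integrable])
    then have "integrable F (\<lambda>x. \<bar>x\<bar> * exp (h * x))" by (simp add: abs_mult)
    then show "((\<lambda>\<theta>. \<integral>x. \<bar>x\<bar> \<partial>tilted F \<theta>) \<longlongrightarrow> (\<integral>x. \<bar>x\<bar> \<partial>F)) near_0"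
      by (intro tendsto_tilted integrable_abs[OF id_int]) auto
    show "(\<integral>x. \<bar>x\<bar> \<partial>F) < m" by (simp add: m_def)
  qed
  have 3: "eventually (\<lambda>\<theta>. v < (\<integral>x. x\<^sup>2 * indicator {-a..0} x \<partial>tilted F \<theta>)) near_0"
  proof (rule order_tendstoD(1))
    have "\<bar>x\<^sup>2 * indicator {-a..0} x\<bar> \<le> a\<^sup>2" for x
      using power_mono[of "- x" a 2] by (auto simp: indicator_def)
    then show "((\<lambda>\<theta>. \<integral>x. x\<^sup>2 * indicator {-a..0} x \<partial>tilted F \<theta>) \<longlongrightarrow> (\<integral>x. x\<^sup>2 * indicator {-a..0} x \<partial>F)) near_0"
      by (intro tendsto_tilted_bounded[where B = "a\<^sup>2"]) auto
    show "v < (\<integral>x. x\<^sup>2 * indicator {-a..0} x \<partial>F)" using a by (simp add: v_def)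
  qed
  have 4: "eventually (\<lambda>\<theta>. (\<integral>x. \<bar>exp (\<theta> * x) / mgf \<theta> - 1\<bar> \<partial>F) < (1 - r) / 2) near_0"
    by (rule order_tendstoD(2)[OF tendsto_total_variation]) (use r in simp)
  have "eventually (\<lambda>\<theta>. step_law (tilted F \<theta>) (tilted_mean \<theta>) \<theta> h M K \<eta> a v m T c \<rho>) near_0"
    using 1 2 3 4 eventually_near_0
  proof eventually_elim
    case (elim \<theta>)
    then have \<theta>: "0 < \<theta>" "\<theta> \<le> h" by auto
    interpret T: real_distribution "tilted F \<theta>" by (rule real_distribution_tilted[OF \<theta>])
    have Z: "mgf \<theta> > 1" using mgf_gt_1[of \<theta>] \<theta> h by simp
    have e: "integrable F (\<lambda>x. exp ((\<theta> + h) * x))" using \<theta> by (intro exp_integrable) auto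
    have eq: "(exp (\<theta> * x) / mgf \<theta>) *\<^sub>R exp (h * x) = exp ((\<theta> + h) * x) / mgf \<theta>" for x
      by (simp add: distrib_right exp_add)
    have large_tilted: "cmod (char (tilted F \<theta>) t) \<le> \<rho>" if "\<bar>t\<bar> \<ge> T" for t
    proof -
      have "cmod (char (tilted F \<theta>) t) \<le> cmod (char F t) + cmod (char (tilted F \<theta>) t - char F t)"
        by (metis add.commute diff_add_cancel norm_triangle_ineq)
      also have "\<dots> \<le> r + (1 - r) / 2"
        using large[OF that] char_tilted_diff[OF \<theta>, of t] elim by linarith
      finally show ?thesis by (simp add: \<rho>_def field_simps)
    qed
    show ?case
    proof unfold_locales
      show "tilted_mean \<theta> > 0" by (rule tilted_mean_pos(1)[OF \<theta>])
      show "\<eta> > 0" "v > 0" using K a by (auto simp: \<eta>_def v_def)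
      show "integrable (tilted F \<theta>) (\<lambda>x. exp (h * x))"
        using integrable_divide[OF e, of "mgf \<theta>"] by (subst integrable_tilted[OF \<theta>]) (simp_all only: eq, measurable)
      have "(\<integral>x. exp (h * x) \<partial>tilted F \<theta>) = (\<integral>x. exp ((\<theta> + h) * x) \<partial>F) / mgf \<theta>"
        by (subst integral_tilted[OF \<theta>]) (measurable, simp only: eq Bochner_Integration.integral_divide_zero)
      also have "\<dots> \<le> (\<integral>x. exp ((\<theta> + h) * x) \<partial>F) / 1"
        using Z by (intro divide_left_mono integral_nonneg_AE) auto
      also have "\<dots> \<le> (\<integral>x. 1 + exp (2 * h * x) \<partial>F) / 1"
        using \<theta> e exp_int by (intro divide_right_mono integral_mono exp_le) auto
      also have "\<dots> \<le> M" using exp_int prob_space by (simp add: M_def)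
      finally show "(\<integral>x. exp (h * x) \<partial>tilted F \<theta>) \<le> M" .
      show "integrable (tilted F \<theta>) (\<lambda>x. x)" by (rule tilted_mean_pos(2)[OF \<theta>])
      show "(\<integral>x. x \<partial>tilted F \<theta>) = tilted_mean \<theta>" by (simp add: tilted_mean_def)
      show "cmod (char (tilted F \<theta>) t) \<le> \<rho>" if "\<bar>t\<bar> \<ge> T" for t by (rule large_tilted[OF that])
      show "(cmod (char (tilted F \<theta>) t))\<^sup>2 \<le> 1 - c * t\<^sup>2" if "\<bar>t\<bar> \<le> T" for t
        unfolding c_def by (rule T.char_near_0) (use T \<rho> that large_tilted in auto)
      \<comment> \<open>The exponent cancels the tilt and leaves only the normalisation.\<close>
      have "(\<integral>\<^sup>+x. ennreal (exp (- \<theta> * x)) \<partial>tilted F \<theta>)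
        = (\<integral>\<^sup>+x. ennreal (exp (\<theta> * x) / mgf \<theta>) * ennreal (exp (- \<theta> * x)) \<partial>F)"
        unfolding tilted_eq[OF \<theta>] by (rule nn_integral_density) auto
      also have "\<dots> = (\<integral>\<^sup>+x. ennreal (1 / mgf \<theta>) \<partial>F)"
        using Z by (intro nn_integral_cong) (simp add: ennreal_mult[symmetric] mult_exp_exp)
      also have "\<dots> = ennreal (1 / mgf \<theta>)" using emeasure_space_1 by simp
      also have "\<dots> < 1" using Z by (simp add: ennreal_less_one_iff)
      finally show "(\<integral>\<^sup>+x. ennreal (exp (- \<theta> * x)) \<partial>tilted F \<theta>) < 1" .
    qed (use h M a m T c \<rho> \<theta> elim in \<open>auto\<close>)
  qed
  then show ?thesis by (rule that)
qed

end

section \<open>The bound for the exponential family\<close>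

lemma standard_exponential_family_tilting:
  assumes "standard_exponential_family F0 \<theta>max"
  obtains h where "tilting F0 h" "{0..h} \<subseteq> param_set \<theta>max"
    "integrable F0 (\<lambda>x. x\<^sup>2)" "strongly_nonlattice F0"
proof -
  have F0: "prob_space F0" "sets F0 = sets borel" "0 < \<theta>max"
    "\<And>\<theta>. \<theta> \<in> param_set \<theta>max \<Longrightarrow> integrable F0 (\<lambda>x. exp (\<theta> * x))"
    "integrable F0 (\<lambda>x. x)" "integrable F0 (\<lambda>x. x\<^sup>2)" "(\<integral>x. x \<partial>F0) = 0"
    "prob_space.variance F0 (\<lambda>x. x) = 1" "strongly_nonlattice F0"
    using assms unfolding standard_exponential_family_def by auto
  obtain t where t: "ereal 0 < ereal t" "ereal t < \<theta>max"
    using F0(3) ereal_dense2[of 0 \<theta>max] by (auto simp: zero_ereal_def)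
  define h where "h = t / 2"
  have h: "h > 0" "2 * h = t" using t by (auto simp: h_def)
  have sub: "{0..2 * h} \<subseteq> param_set \<theta>max"
    unfolding param_set_def using h le_less_trans[OF _ t(2)] by auto
  have nondeg: "\<not> (AE x in F0. x = 0)"
  proof
    assume "AE x in F0. x = 0"
    then have "AE x in F0. x\<^sup>2 = 0" by eventually_elim simp
    then have "(\<integral>x. x\<^sup>2 \<partial>F0) = (\<integral>x. 0 \<partial>F0)" using F0(6) by (intro integral_cong_AE) auto
    then show False using F0(7,8) by simp
  qed
  have "tilting F0 h"
    using F0 h nondeg sub
    by (intro tilting.intro real_distribution.intro) (auto simp: real_distribution_axioms_def tilting_axioms_def subset_eq)
  moreover have "{0..h} \<subseteq> param_set \<theta>max" using sub h by (auto simp: subset_eq)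
  ultimately show ?thesis using F0 by (intro that) auto
qed

text \<open>From the threshold on, the exponential term is at most
  \<open>real k * A / real (k + 1)\<close>, the gap between \<open>1 / real (k + 1) * A\<close> and
  \<open>A\<close>. Truncating the logarithm at 0 gives \<open>b \<ge> 0\<close>.\<close>

lemma le_of_log_threshold:
  fixes A B r b :: real and k :: nat
  assumes A: "A > 0" and B: "B > 0" and r: "r > 0" and k: "k \<ge> 1"
    and b: "b \<ge> 1 / r * ln_plus (real (k + 1) * B / (real k * A))"
  shows "b \<ge> 0" and "1 / real (k + 1) * A + B * exp (- r * b) \<le> A"
proof -
  let ?q = "real (k + 1) * B / (real k * A)"
  have q: "?q > 0" using A B k by (intro divide_pos_pos mult_pos_pos) auto
  have "0 \<le> 1 / r * ln_plus ?q" using r by (simp add: ln_plus_def)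
  then show "b \<ge> 0" using b by linarith
  have "ln_plus ?q \<le> r * b" using b r by (simp add: field_simps)
  then have "ln ?q \<le> r * b" by (simp add: ln_plus_def)
  then have "?q \<le> exp (r * b)" using q by (metis exp_le_cancel_iff exp_ln)
  then have "?q * exp (- r * b) \<le> exp (r * b) * exp (- r * b)" by (rule mult_right_mono) simp
  also have "\<dots> = 1" by (simp add: mult_exp_exp)
  finally have "B * exp (- r * b) \<le> real k * A / real (k + 1)"
    using A k by (simp add: field_simps)
  moreover have "1 / real (k + 1) * A + real k * A / real (k + 1) = A"
  proof -
    have "1 / real (k + 1) * A + real k * A / real (k + 1) = (A + real k * A) / real (k + 1)"
      by (simp add: add_divide_distrib)
    also have "A + real k * A = A * real (k + 1)" by (simp add: algebra_simps)
    finally show ?thesis by simp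
  qed
  ultimately show "1 / real (k + 1) * A + B * exp (- r * b) \<le> A" by linarith
qed

theorem corollary1:
  fixes F0 :: "real measure" and \<theta>max :: ereal
    and P :: "real \<Rightarrow> 'a measure" and X :: "nat \<Rightarrow> 'a \<Rightarrow> real"
  assumes "standard_exponential_family F0 \<theta>max"
    and "\<And>\<theta>. \<theta> \<in> param_set \<theta>max \<Longrightarrow> iid_with_law (P \<theta>) X (tilted F0 \<theta>)"
  shows "\<exists>C r \<theta>star :: real. C > 0 \<and> r > 0 \<and> \<theta>star > 0 \<and> {0..\<theta>star} \<subseteq> param_set \<theta>max \<and>
    (\<forall>k::nat. \<forall>b::real. \<forall>\<theta>\<in>{0<..\<theta>star}. k \<ge> 1 \<longrightarrow> b > 0 \<longrightarrow>
       overshoot_moment (P \<theta>) X b k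
         \<le> ennreal (1 / real (k + 1) * moment_ratio (P \<theta>) X k
                     + C * (real k * Gamma (real k) / r ^ k) * exp (- r * b))) \<and>
    (\<forall>k::nat. \<forall>\<theta>\<in>{0<..\<theta>star}. k \<ge> 1 \<longrightarrow>
       (let A = moment_ratio (P \<theta>) X k;
            B = C * (real k * Gamma (real k) / r ^ k);
            b0 = 1 / r * ln_plus (real (k + 1) * B / (real k * A))
        in \<forall>b\<ge>b0. overshoot_moment (P \<theta>) X b k \<le> ennreal A))"
proof -
  obtain h where "tilting F0 h" and sub: "{0..h} \<subseteq> param_set \<theta>max"
    and F0: "integrable F0 (\<lambda>x. x\<^sup>2)" "strongly_nonlattice F0"
    using standard_exponential_family_tilting[OF assms(1)] .
  then interpret tilting F0 h by simp
  obtain M K \<eta> a v m T c \<rho> where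
    "eventually (\<lambda>\<theta>. step_law (tilted F0 \<theta>) (tilted_mean \<theta>) \<theta> h M K \<eta> a v m T c \<rho>) near_0"
    using eventually_step_law[OF F0] .
  note law = this
  have nontriv: "near_0 \<noteq> bot" using h by (simp add: trivial_limit_within islimpt_Ioc)
  obtain \<theta>0 where "step_law (tilted F0 \<theta>0) (tilted_mean \<theta>0) \<theta>0 h M K \<eta> a v m T c \<rho>"
    using eventually_happens'[OF nontriv law] by blast
  \<comment> \<open>This instance only supplies the constants and their positivity. Their
    definitions mention neither the law nor \<open>\<mu>\<close> nor \<open>\<kappa>\<close>, so
    they are the same for every other \<open>\<theta>\<close>.\<close>
  then interpret S0: step_law "tilted F0 \<theta>0" "tilted_mean \<theta>0" \<theta>0 h M K \<eta> a v m T c \<rho> .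
  define r where "r = S0.rate"
  define C where "C = S0.interval_const * M"
  define \<mu>0 where "\<mu>0 = S0.drift_threshold"
  have pos: "r > 0" "C > 0" "\<mu>0 > 0"
    using S0.rate_pos S0.interval_const_pos S0.drift_threshold_pos S0.pos
    by (auto simp: r_def C_def \<mu>0_def)
  have "eventually (\<lambda>\<theta>. tilted_mean \<theta> < \<mu>0) near_0"
    using order_tendstoD(2)[OF tendsto_tilted_mean pos(3)] .
  with law have "eventually (\<lambda>\<theta>. step_law (tilted F0 \<theta>) (tilted_mean \<theta>) \<theta> h M K \<eta> a v m T c \<rho>
      \<and> tilted_mean \<theta> < \<mu>0) near_0" by (rule eventually_conj)
  then obtain d where d: "d > 0" and good: "\<And>\<theta>. 0 < \<theta> \<Longrightarrow> \<theta> \<le> h \<Longrightarrow> \<theta> < d \<Longrightarrow>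
      step_law (tilted F0 \<theta>) (tilted_mean \<theta>) \<theta> h M K \<eta> a v m T c \<rho> \<and> tilted_mean \<theta> < \<mu>0"
    unfolding eventually_at by (auto simp: dist_real_def)
  \<comment> \<open>Half of \<open>d\<close>, because \<open>good\<close> needs a strict
    inequality.\<close>
  define \<theta>star where "\<theta>star = min h (d / 2)"
  have star: "\<theta>star > 0" "{0..\<theta>star} \<subseteq> param_set \<theta>max"
    using h d sub by (auto simp: \<theta>star_def subset_eq)
  \<comment> \<open>Proved for \<open>b \<ge> 0\<close>, since the threshold of the second claim may
    be 0; positivity of the ratio is recorded because the threshold divides by it.\<close>
  have key: "overshoot_moment (P \<theta>) X b k
         \<le> ennreal (1 / real (k + 1) * moment_ratio (P \<theta>) X k
                     + C * (real k * Gamma (real k) / r ^ k) * exp (- r * b))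
       \<and> moment_ratio (P \<theta>) X k > 0"
    if \<theta>: "0 < \<theta>" "\<theta> \<le> \<theta>star" and k: "k \<ge> 1" and b: "b \<ge> 0" for \<theta> k b
  proof -
    have \<theta>': "\<theta> \<le> h" "\<theta> < d" using \<theta> d by (auto simp: \<theta>star_def)
    interpret S: step_law "tilted F0 \<theta>" "tilted_mean \<theta>" \<theta> h M K \<eta> a v m T c \<rho>
      using good[OF \<theta>(1) \<theta>'] by simp
    have \<mu>: "tilted_mean \<theta> \<le> \<mu>0" using good[OF \<theta>(1) \<theta>'] by simp
    have "\<theta> \<in> param_set \<theta>max" using star(2) \<theta> by (auto simp: subset_eq)
    then have iid: "iid_with_law (P \<theta>) X (tilted F0 \<theta>)" by (rule assms(2))
    then have "prob_space (P \<theta>)" by (simp add: iid_with_law_def)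
    then interpret W: iid_walk "P \<theta>" X "tilted F0 \<theta>"
      using iid by (simp add: iid_walk_def iid_walk_axioms_def)
    have distr: "(\<integral>\<omega>. f (X 1 \<omega>) \<partial>P \<theta>) = (\<integral>x. f x \<partial>tilted F0 \<theta>)"
      if "f \<in> borel_measurable borel" for f :: "real \<Rightarrow> real"
      using integral_distr[OF W.rv[of 1] that] W.law[of 1] by simp
    have ratio: "moment_ratio (P \<theta>) X k
      = (\<integral>x. (max x 0) ^ (k + 1) \<partial>tilted F0 \<theta>) / tilted_mean \<theta>"
      unfolding moment_ratio_def using distr[of "\<lambda>x. (max x 0) ^ (k + 1)"] distr[of "\<lambda>x. x"] S.mean by simp
    \<comment> \<open>A step that is almost surely nonpositive could not have positive mean.\<close>
    have "(\<integral>x. (max x 0) ^ (k + 1) \<partial>tilted F0 \<theta>) \<noteq> 0"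
    proof
      assume "(\<integral>x. (max x 0) ^ (k + 1) \<partial>tilted F0 \<theta>) = 0"
      then have "AE x in tilted F0 \<theta>. (max x 0) ^ (k + 1) = 0"
        by (subst (asm) integral_nonneg_eq_0_iff_AE[OF S.positive_part_power_integrable]) auto
      then have "AE x in tilted F0 \<theta>. x \<le> 0" by eventually_elim (auto simp: max_def split: if_splits)
      then have "(\<integral>x. x \<partial>tilted F0 \<theta>) \<le> (\<integral>x. 0 \<partial>tilted F0 \<theta>)"
        by (intro integral_mono_AE S.integrable) auto
      then show False using S.mean S.pos by simp
    qed
    moreover have "(\<integral>x. (max x 0) ^ (k + 1) \<partial>tilted F0 \<theta>) \<ge> 0" by (intro integral_nonneg_AE) auto
    ultimately have "(\<integral>x. (max x 0) ^ (k + 1) \<partial>tilted F0 \<theta>) > 0" by linarith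
    then have "moment_ratio (P \<theta>) X k > 0" unfolding ratio using S.pos(1) by (rule divide_pos_pos)
    moreover have "overshoot_moment (P \<theta>) X b k = green (tilted F0 \<theta>) (overshoot_kernel (tilted F0 \<theta>) k) b"
      by (rule W.overshoot_moment_eq_green[OF S.survival_tendsto_0[OF b]])
    ultimately show ?thesis
      using S.overshoot_bound[OF \<mu>[unfolded \<mu>0_def] k b] unfolding ratio r_def C_def by simp
  qed
  show ?thesis
  proof (intro exI conjI allI ballI impI)
    show "C > 0" "r > 0" "\<theta>star > 0" "{0..\<theta>star} \<subseteq> param_set \<theta>max" using pos star by auto
    fix k :: nat and \<theta> :: real assume \<theta>: "\<theta> \<in> {0<..\<theta>star}" and k: "k \<ge> 1"
    show "overshoot_moment (P \<theta>) X b k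
         \<le> ennreal (1 / real (k + 1) * moment_ratio (P \<theta>) X k
                     + C * (real k * Gamma (real k) / r ^ k) * exp (- r * b))" if "b > 0" for b
      using key \<theta> k that by simp
    show "let A = moment_ratio (P \<theta>) X k;
            B = C * (real k * Gamma (real k) / r ^ k);
            b0 = 1 / r * ln_plus (real (k + 1) * B / (real k * A))
        in \<forall>b\<ge>b0. overshoot_moment (P \<theta>) X b k \<le> ennreal A"
      unfolding Let_def
    proof (intro allI impI)
      let ?A = "moment_ratio (P \<theta>) X k"
      let ?B = "C * (real k * Gamma (real k) / r ^ k)"
      fix b assume b: "b \<ge> 1 / r * ln_plus (real (k + 1) * ?B / (real k * ?A))"
      have A: "?A > 0" using key[of \<theta> k 0] \<theta> k by simp
      have B: "?B > 0" using pos k by (intro mult_pos_pos divide_pos_pos Gamma_real_pos) auto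
      note le = le_of_log_threshold[OF A B pos(1) k b]
      have "overshoot_moment (P \<theta>) X b k \<le> ennreal (1 / real (k + 1) * ?A + ?B * exp (- r * b))"
        using key[of \<theta> k b] \<theta> k le(1) by simp
      also have "\<dots> \<le> ennreal ?A" using le(2) by (rule ennreal_leI)
      finally show "overshoot_moment (P \<theta>) X b k \<le> ennreal ?A" .
    qed
  qed
qed

end
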